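(* Let $H\in(\frac13,\frac12]$, $\beta\in(\frac13,H)$, let $A\in\mathbb{R}^{m\times m}$, let $f:\mathbb{R}^m\to\mathbb{R}^m$ be globally Lipschitz continuous, and let $g\in C_b^3(\mathbb{R}^m,\mathbb{R}^{m\times d})$. Then the rough differential equation $$dy=(Ay+f(y))\,dt+g(y)\,d\boldsymbol{\omega},\qquad y_0=\xi\in\mathbb{R}^m,$$ generates a random dynamical system $\varphi:\mathbb{R}^+\times\Omega'\times\mathbb{R}^m\to\mathbb{R}^m$ over the metric dynamical system $(\Omega',\mathcal{F}',\mathbb{P}'_H,\theta')$, given by $\varphi(t,\omega,\xi)=y_t$ for $t\in[0,T]$ (with $T>0$ arbitrary), where $y$ is the solution with $y_0=\xi$ on $[0,T]$.
   Context: Noise: $\omega^1$ is the canonical two-sided fractional Brownian motion in $\mathbb{R}^d$ with Hurst index $H$ and independent components, i.e. the coordinate process on $(\Omega,\mathcal{F},\mathbb{P}_H)$, where $\Omega\subset C_0(\mathbb{R},\mathbb{R}^d)$ is the $\theta$-invariant full-measure set of paths that are $\gamma$-Hölder on every $[-T,T]$ for every $\gamma<H$, $\mathcal{F}$ is the trace of the Borel $\sigma$-algebra of $C_0(\mathbb{R},\mathbb{R}^d)$ (compact-open topology), and $\theta_t\omega(\cdot)=\omega(\cdot+t)-\omega(t)$. For $\delta\in(0,1)$ put $W_\delta(t,\omega^1)=\int_0^t\frac1\delta(\omega^1(r+\delta)-\omega^1(r))dr$, $\mathbb{W}_\delta(\omega^1)_{s,t}=\int_s^tW_\delta(\cdot,\omega^1)_{s,r}\otimes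 dW_\delta(r,\omega^1)$. $\Omega'\subset\Omega$ is a $\theta$-invariant set of full measure such that for each $\omega\in\Omega'$ the pairs $(W_\delta(\cdot,\omega^1),\mathbb{W}_\delta(\omega^1))$ converge as $\delta\to0$, on every $[-T,T]$, to the fractional Brownian rough path $\boldsymbol{\omega}=(\omega^1,\omega^2)$ in the metric $\rho_\beta(\mathbf{X},\mathbf{Y})=\sup_{s<t}\frac{|X_{s,t}-Y_{s,t}|}{|t-s|^\beta}+\sup_{s<t}\frac{|\mathbb{X}_{s,t}-\mathbb{Y}_{s,t}|}{|t-s|^{2\beta}}$; on $\Omega'$ the second order process $\omega^2$ is this limit of $\mathbb{W}_\delta(\omega^1)$. $\mathcal{F}'=\mathcal{F}\cap\Omega'$, and $\mathbb{P}'_H$, $\theta'$ are the restrictions of $\mathbb{P}_H$, $\theta$; $(\Omega',\mathcal{F}',\mathbb{P}'_H,\theta')$ is an (ergodic) metric dynamical system. Random dynamical system over $(\Omega',\mathcal{F}',\mathbb{P}'_H,\theta')$: a map $\varphi:\mathbb{R}^+\times\Omega'\times\mathbb{R}^m\to\mathbb{R}^m$ that is $(\mathcal{B}(\mathbb{R}^+)\otimes\mathcal{F}'\otimes\mathcal{B}(\mathbb{R}^m),\mathcal{B}(\mathbb{R}^m))$-measurable, with $\varphi(0,\omega,\cdot)=\mathrm{Id}$ and $\varphi(t_1+t_2,\omega,\cdot)=\varphi(t_2,\theta'_{t_1}\omega,\varphi(t_1,\omega,\cdot))$ for all $t_1,t_2\in\mathbb{R}^+$, $\omega\in\Omega'$.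 Solutions: $y_{s,t}=y_t-y_s$. A solution on $[0,T]$ is a path $y\in C^\beta([0,T],\mathbb{R}^m)$ controlled by $\omega^1$ with Gubinelli derivative $g(y)$, i.e. $R^y_{s,t}:=y_{s,t}-g(y_s)\omega^1_{s,t}$ is $2\beta$-Hölder, satisfying $y_{s,t}=\int_s^t(Ay_r+f(y_r))dr+\int_s^tg(y_r)d\boldsymbol{\omega}_r$, where $\int_s^tg(y_r)d\boldsymbol{\omega}_r=\lim_{|\mathcal{P}|\to0}\sum_{[u,v]\in\mathcal{P}}\left(g(y_u)\omega^1_{u,v}+Dg(y_u)g(y_u)\omega^2_{u,v}\right)$ over partitions $\mathcal{P}$ of $[s,t]$. Under the stated assumptions the solution exists and is unique for every initial value and every $T>0$. $g\in C_b^3$ means three times continuously differentiable with $g,Dg,D^2g,D^3g$ bounded. *)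

theory Defs
  imports "HOL-Probability.Probability"
begin

subsection \<open>Path space and fractional Brownian motion\<close>

definition C0_paths :: "(real \<Rightarrow> 'a::real_normed_vector) set"
  where "C0_paths = {\<omega>. continuous_on UNIV \<omega> \<and> \<omega> 0 = 0}"

definition C0_compact_open :: "(real \<Rightarrow> 'a::real_normed_vector) topology"
  where "C0_compact_open =
    topology_generated_by {{\<omega> \<in> C0_paths. \<omega> ` K \<subseteq> U} | K U. compact K \<and> open U}"

lemma topspace_C0_compact_open: "topspace C0_compact_open = C0_paths"
proof -
  have "C0_paths \<in> {{\<omega> \<in> C0_paths. \<omega> ` K \<subseteq> U} | K U. compact K \<and> open (U :: 'a set)}"
    by (intro CollectI exI[of _ "{}"]) auto
  then show ?thesis
    unfolding C0_compact_open_def topology_generated_by_topspace by blast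
qed

definition C0_borel :: "(real \<Rightarrow> 'a::real_normed_vector) measure"
  where "C0_borel = sigma C0_paths {U. openin C0_compact_open U}"

definition wiener_shift :: "real \<Rightarrow> (real \<Rightarrow> 'a::real_normed_vector) \<Rightarrow> real \<Rightarrow> 'a"
  where "wiener_shift t \<omega> = (\<lambda>s. \<omega> (s + t) - \<omega> t)"

definition hoelder_on :: "real \<Rightarrow> real set \<Rightarrow> (real \<Rightarrow> 'a::real_normed_vector) \<Rightarrow> bool"
  where "hoelder_on \<gamma> S x \<longleftrightarrow>
    (\<exists>C. \<forall>s\<in>S. \<forall>t\<in>S. norm (x t - x s) \<le> C * \<bar>t - s\<bar> powr \<gamma>)"

definition fbm_paths :: "real \<Rightarrow> (real \<Rightarrow> 'a::real_normed_vector) set"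
  where "fbm_paths H =
    {\<omega> \<in> C0_paths. \<forall>\<gamma>. 0 < \<gamma> \<and> \<gamma> < H \<longrightarrow> (\<forall>T>0. hoelder_on \<gamma> {-T..T} \<omega>)}"

text \<open>Degenerate (almost surely constant) variables count as Gaussian; they occur among
  the linear combinations of a Gaussian process.\<close>

definition gaussian_rv :: "'w measure \<Rightarrow> ('w \<Rightarrow> real) \<Rightarrow> bool"
  where "gaussian_rv M X \<longleftrightarrow> X \<in> borel_measurable M \<and>
    ((\<exists>c. AE w in M. X w = c) \<or>
     (\<exists>\<mu> \<sigma>. 0 < \<sigma> \<and> distributed M lborel X (\<lambda>x. ennreal (normal_density \<mu> \<sigma> x))))"

definition gaussian_process :: "'w measure \<Rightarrow> (real \<Rightarrow> 'w \<Rightarrow> real) \<Rightarrow> bool"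
  where "gaussian_process M X \<longleftrightarrow>
    (\<forall>J c. finite J \<longrightarrow> gaussian_rv M (\<lambda>w. \<Sum>t\<in>J. c t * X t w))"

definition fbm_covariance :: "real \<Rightarrow> real \<Rightarrow> real \<Rightarrow> real"
  where "fbm_covariance H s t =
    (\<bar>s\<bar> powr (2 * H) + \<bar>t\<bar> powr (2 * H) - \<bar>t - s\<bar> powr (2 * H)) / 2"

text \<open>Path regularity is not part of this definition, since below the process is the
  coordinate process on a space of continuous paths.\<close>

definition scalar_fbm :: "real \<Rightarrow> 'w measure \<Rightarrow> (real \<Rightarrow> 'w \<Rightarrow> real) \<Rightarrow> bool"
  where "scalar_fbm H M X \<longleftrightarrow> prob_space M \<and> gaussian_process M X \<and>
    (\<forall>t. (LINT w|M. X t w) = 0) \<and>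
    (\<forall>s t. (LINT w|M. X s w * X t w) = fbm_covariance H s t)"

text \<open>\<open>P\<close> is the law of two-sided \<open>d\<close>-dimensional fractional Brownian motion with
  independent components, on \<open>fbm_paths H\<close> with the trace of the Borel sets of \<open>C0_paths\<close>.
  The components are independent as processes, that is, as random elements of the
  product space \<open>\<real>\<^sup>\<real>\<close>.\<close>

definition canonical_fbm :: "real \<Rightarrow> (real \<Rightarrow> real ^ 'd) measure \<Rightarrow> bool"
  where "canonical_fbm H P \<longleftrightarrow> prob_space P \<and>
    sets P = sets (restrict_space C0_borel (fbm_paths H)) \<and>
    prob_space.indep_vars P (\<lambda>_. \<Pi>\<^sub>M t\<in>(UNIV :: real set). (borel :: real measure))
      (\<lambda>i \<omega> t. \<omega> t $ i) UNIV \<and>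
    (\<forall>i. scalar_fbm H P (\<lambda>t \<omega>. \<omega> t $ i))"


subsection \<open>The rough path lift\<close>

definition tensor :: "real ^ 'd \<Rightarrow> real ^ 'd \<Rightarrow> real ^ 'd ^ 'd"
  where "tensor x y = (\<chi> j k. x $ j * y $ k)"

text \<open>Interval integrals are oriented, so the definition also covers \<open>t < 0\<close>.\<close>

definition W_approx :: "real \<Rightarrow> (real \<Rightarrow> real ^ 'd) \<Rightarrow> real \<Rightarrow> real ^ 'd"
  where "W_approx \<delta> \<omega> t = (LBINT r=0..t. (1 / \<delta>) *\<^sub>R (\<omega> (r + \<delta>) - \<omega> r))"

text \<open>For continuous \<open>\<omega>\<close> the path \<open>W_approx \<delta> \<omega>\<close> is continuously differentiable, so that
  integration against \<open>dW\<close> is integration against its derivative.\<close>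

definition WW_approx :: "real \<Rightarrow> (real \<Rightarrow> real ^ 'd) \<Rightarrow> real \<Rightarrow> real \<Rightarrow> real ^ 'd ^ 'd"
  where "WW_approx \<delta> \<omega> s t =
    (LBINT r=s..t. tensor (W_approx \<delta> \<omega> r - W_approx \<delta> \<omega> s)
                          (vector_derivative (W_approx \<delta> \<omega>) (at r)))"

text \<open>The metric \<open>\<rho>\<^sub>\<beta>\<close> on \<open>[-T, T]\<close>, with values in \<open>[0, \<infinity>]\<close> so that no finiteness is
  presupposed.\<close>

definition rough_dist ::
  "real \<Rightarrow> real \<Rightarrow> (real \<Rightarrow> real ^ 'd) \<Rightarrow> (real \<Rightarrow> real \<Rightarrow> real ^ 'd ^ 'd) \<Rightarrow>
   (real \<Rightarrow> real ^ 'd) \<Rightarrow> (real \<Rightarrow> real \<Rightarrow> real ^ 'd ^ 'd) \<Rightarrow> ennreal"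
  where "rough_dist \<beta> T X XX Y YY =
    (SUP (s, t)\<in>{(s, t). -T \<le> s \<and> s < t \<and> t \<le> T}.
       ennreal (norm ((X t - X s) - (Y t - Y s)) / \<bar>t - s\<bar> powr \<beta>)) +
    (SUP (s, t)\<in>{(s, t). -T \<le> s \<and> s < t \<and> t \<le> T}.
       ennreal (norm (XX s t - YY s t) / \<bar>t - s\<bar> powr (2 * \<beta>)))"

text \<open>The second order process is meaningful for those paths for which the limit exists, in
  particular on every \<open>rough_lift_domain\<close> below.\<close>

definition second_order :: "(real \<Rightarrow> real ^ 'd) \<Rightarrow> real \<Rightarrow> real \<Rightarrow> real ^ 'd ^ 'd"
  where "second_order \<omega> s t = Lim (at_right 0) (\<lambda>\<delta>. WW_approx \<delta> \<omega> s t)"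

definition rough_lift_domain ::
  "real \<Rightarrow> (real \<Rightarrow> real ^ 'd) measure \<Rightarrow> (real \<Rightarrow> real ^ 'd) set \<Rightarrow> bool"
  where "rough_lift_domain \<beta> P \<Omega>' \<longleftrightarrow>
    \<Omega>' \<in> sets P \<and> emeasure P \<Omega>' = 1 \<and> (\<forall>t. wiener_shift t ` \<Omega>' = \<Omega>') \<and>
    (\<forall>\<omega>\<in>\<Omega>'. \<forall>T>0.
      ((\<lambda>\<delta>. rough_dist \<beta> T (W_approx \<delta> \<omega>) (WW_approx \<delta> \<omega>) \<omega> (second_order \<omega>))
        \<longlongrightarrow> 0) (at_right 0))"


subsection \<open>Metric and random dynamical systems\<close>

definition metric_dynamical_system :: "'w measure \<Rightarrow> (real \<Rightarrow> 'w \<Rightarrow> 'w) \<Rightarrow> bool"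
  where "metric_dynamical_system M \<theta> \<longleftrightarrow> prob_space M \<and>
    (\<lambda>(t, \<omega>). \<theta> t \<omega>) \<in> borel \<Otimes>\<^sub>M M \<rightarrow>\<^sub>M M \<and>
    (\<forall>\<omega>\<in>space M. \<theta> 0 \<omega> = \<omega>) \<and>
    (\<forall>s t. \<forall>\<omega>\<in>space M. \<theta> (s + t) \<omega> = \<theta> s (\<theta> t \<omega>)) \<and>
    (\<forall>t. distr M M (\<theta> t) = M)"

text \<open>The values of \<open>\<phi>\<close> at negative times and outside \<open>space M\<close> are irrelevant.\<close>

definition random_dynamical_system ::
  "'w measure \<Rightarrow> (real \<Rightarrow> 'w \<Rightarrow> 'w) \<Rightarrow> (real \<Rightarrow> 'w \<Rightarrow> 'x \<Rightarrow> 'x::topological_space) \<Rightarrow> bool"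
  where "random_dynamical_system M \<theta> \<phi> \<longleftrightarrow>
    (\<lambda>(t, \<omega>, x). \<phi> t \<omega> x)
      \<in> restrict_space borel {0..} \<Otimes>\<^sub>M (M \<Otimes>\<^sub>M borel) \<rightarrow>\<^sub>M borel \<and>
    (\<forall>\<omega>\<in>space M. \<forall>x. \<phi> 0 \<omega> x = x) \<and>
    (\<forall>t\<^sub>1\<ge>0. \<forall>t\<^sub>2\<ge>0. \<forall>\<omega>\<in>space M. \<forall>x.
      \<phi> (t\<^sub>1 + t\<^sub>2) \<omega> x = \<phi> t\<^sub>2 (\<theta> t\<^sub>1 \<omega>) (\<phi> t\<^sub>1 \<omega> x))"


subsection \<open>Rough differential equations\<close>

definition Cb3 :: "('a::real_normed_vector \<Rightarrow> 'b::real_normed_vector) \<Rightarrow> bool"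
  where "Cb3 g \<longleftrightarrow>
    (\<exists>(D1 :: 'a \<Rightarrow> 'a \<Rightarrow>\<^sub>L 'b) (D2 :: 'a \<Rightarrow> 'a \<Rightarrow>\<^sub>L 'a \<Rightarrow>\<^sub>L 'b)
      (D3 :: 'a \<Rightarrow> 'a \<Rightarrow>\<^sub>L 'a \<Rightarrow>\<^sub>L 'a \<Rightarrow>\<^sub>L 'b).
      (\<forall>x. (g has_derivative blinfun_apply (D1 x)) (at x)) \<and>
      (\<forall>x. (D1 has_derivative blinfun_apply (D2 x)) (at x)) \<and>
      (\<forall>x. (D2 has_derivative blinfun_apply (D3 x)) (at x)) \<and>
      continuous_on UNIV D3 \<and>
      bounded (range g) \<and> bounded (range D1) \<and> bounded (range D2) \<and> bounded (range D3))"

text \<open>\<open>Dg(x) g(x)\<close> is the bilinear map \<open>(u, v) \<mapsto> (Dg(x)(g(x) u)) v\<close>, extended linearly from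
  \<open>u \<otimes> v\<close> to matrices. With \<open>MM\<close> the second order process, the index \<open>j\<close> belongs to the
  integrand and \<open>k\<close> to the integrator, in accordance with \<open>tensor\<close>.\<close>

definition Dg_g ::
  "(real ^ 'm \<Rightarrow> real ^ 'd ^ 'm) \<Rightarrow> real ^ 'm \<Rightarrow> real ^ 'd ^ 'd \<Rightarrow> real ^ 'm"
  where "Dg_g g x MM = (\<Sum>j\<in>UNIV. \<Sum>k\<in>UNIV.
    (MM $ j $ k) *\<^sub>R (frechet_derivative g (at x) (g x *v axis j 1) *v axis k 1))"

definition has_partition_limit ::
  "(real \<Rightarrow> real \<Rightarrow> 'a::real_normed_vector) \<Rightarrow> real \<Rightarrow> real \<Rightarrow> 'a \<Rightarrow> bool"
  where "has_partition_limit \<Xi> s t I \<longleftrightarrow>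
    (\<forall>\<epsilon>>0. \<exists>\<eta>>0. \<forall>n (p :: nat \<Rightarrow> real).
      p 0 = s \<and> p n = t \<and> (\<forall>i<n. p i < p (Suc i) \<and> p (Suc i) - p i < \<eta>) \<longrightarrow>
      norm ((\<Sum>i<n. \<Xi> (p i) (p (Suc i))) - I) < \<epsilon>)"

definition has_rough_integral ::
  "(real ^ 'm \<Rightarrow> real ^ 'd ^ 'm) \<Rightarrow> (real \<Rightarrow> real ^ 'd) \<Rightarrow> (real \<Rightarrow> real ^ 'm) \<Rightarrow>
   real \<Rightarrow> real \<Rightarrow> real ^ 'm \<Rightarrow> bool"
  where "has_rough_integral g \<omega> y s t I \<longleftrightarrow>
    has_partition_limit
      (\<lambda>u v. g (y u) *v (\<omega> v - \<omega> u) + Dg_g g (y u) (second_order \<omega> u v)) s t I"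

definition controlled_on ::
  "real \<Rightarrow> real \<Rightarrow> (real \<Rightarrow> real ^ 'd) \<Rightarrow> (real \<Rightarrow> real ^ 'm) \<Rightarrow> (real \<Rightarrow> real ^ 'd ^ 'm) \<Rightarrow> bool"
  where "controlled_on \<beta> T \<omega> y y' \<longleftrightarrow>
    (\<exists>C. \<forall>s t. 0 \<le> s \<and> s \<le> t \<and> t \<le> T \<longrightarrow>
      norm ((y t - y s) - y' s *v (\<omega> t - \<omega> s)) \<le> C * \<bar>t - s\<bar> powr (2 * \<beta>))"

definition rde_solution ::
  "real \<Rightarrow> real ^ 'm ^ 'm \<Rightarrow> (real ^ 'm \<Rightarrow> real ^ 'm) \<Rightarrow> (real ^ 'm \<Rightarrow> real ^ 'd ^ 'm) \<Rightarrow>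
   (real \<Rightarrow> real ^ 'd) \<Rightarrow> real \<Rightarrow> real ^ 'm \<Rightarrow> (real \<Rightarrow> real ^ 'm) \<Rightarrow> bool"
  where "rde_solution \<beta> A f g \<omega> T \<xi> y \<longleftrightarrow>
    y 0 = \<xi> \<and> hoelder_on \<beta> {0..T} y \<and> controlled_on \<beta> T \<omega> y (\<lambda>t. g (y t)) \<and>
    (\<forall>s t. 0 \<le> s \<and> s \<le> t \<and> t \<le> T \<longrightarrow>
      (\<exists>I. has_rough_integral g \<omega> y s t I \<and>
           y t - y s = (LBINT r=s..t. A *v y r + f (y r)) + I))"

end

theory Submission
  imports Defs
begin

text \<open>
  The solution is constructed as the limit of the Euler schemes on the dyadic grids, whose one-step
  map is \<open>step s t x = x + (t - s) b x + g x (X t - X s) + F x (X2 s t)\<close> with \<open>F = Dg g\<close>. Following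
  Davie, a path solves the rough differential equation iff \<open>y t - step s t (y s)\<close> is of order
  \<open>\<bar>t - s\<bar> powr (3 * \<beta>)\<close> locally. A discrete sewing lemma bounds this defect for the Euler scheme,
  linearly in the maximum of \<open>1 + norm y\<close>, so that \<open>1 + norm y\<close> at most doubles on time blocks of a
  fixed length. The same argument for the difference of two such paths, in which the merely Lipschitz
  drift is treated as an exactly additive term, gives uniqueness and the convergence of the schemes.
  The limit does not depend on the time horizon and is measurable as a limit of measurable maps; the
  cocycle property follows from uniqueness and the shift invariance of the one-step map.
\<close>

subsection \<open>Discrete sewing and Euler schemes\<close>

text \<open>The drift is unbounded, so a block length that does not depend on the initial value
  requires a sewing defect linear in the size of the path. Taylor's formula is therefore applied at
  \<open>g x (X u - X s)\<close>, which is bounded independently of the path; the actual increment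
  would enter squared. For two paths such squares are harmless, since both have controlled
  increments by then, and the obstacle is the drift: for a Lipschitz \<open>b\<close> the second
  difference \<open>(b x' - b x) - (b y' - b y)\<close> is bounded by the distance of the paths with
  no gain in time, so drift inside the germ would give a defect of order 1, while sewing needs an
  order above 1. As a sum over grid cells it cancels from the defect, and the local errors of both
  paths can join that sum. A scheme depends on the driving path through finitely many values, whence
  measurability, and dyadic grids are nested, so that each scheme is compared with the next finer
  one on its own grid. The exponent \<open>3 * \<beta>\<close> exceeds 1 because
  \<open>\<beta> > 1/3\<close>, and \<open>\<beta> \<le> 1/2\<close> makes time increments second
  order terms.\<close>

lemma powr_split_le:
  fixes p q \<gamma> :: real
  assumes \<gamma>: "1 < \<gamma>" and p: "0 < p" "p \<le> 2/3 * (p + q)" and q: "0 < q" "q \<le> 2/3 * (p + q)"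
  shows "p powr \<gamma> + q powr \<gamma> \<le> (2/3) powr (\<gamma> - 1) * (p + q) powr \<gamma>"
proof -
  have *: "x powr \<gamma> \<le> x * ((2/3) powr (\<gamma> - 1) * (p + q) powr (\<gamma> - 1))"
    if "0 < x" "x \<le> 2/3 * (p + q)" for x
  proof -
    have "x powr \<gamma> = x * x powr (\<gamma> - 1)"
      using that by (simp add: powr_diff)
    also have "\<dots> \<le> x * (2/3 * (p + q)) powr (\<gamma> - 1)"
      using that \<gamma> by (intro mult_left_mono powr_mono2) auto
    also have "(2/3 * (p + q)) powr (\<gamma> - 1) = (2/3) powr (\<gamma> - 1) * (p + q) powr (\<gamma> - 1)"
      by (rule powr_mult)
    finally show ?thesis .
  qed
  have "p powr \<gamma> + q powr \<gamma> \<le> (p + q) * ((2/3) powr (\<gamma> - 1) * (p + q) powr (\<gamma> - 1))"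
    using *[OF p] *[OF q] by (simp add: distrib_right)
  also have "\<dots> = (2/3) powr (\<gamma> - 1) * ((p + q) * (p + q) powr (\<gamma> - 1))"
    by (simp only: mult.left_commute)
  also have "(p + q) * (p + q) powr (\<gamma> - 1) = (p + q) powr \<gamma>"
    using p q powr_add[of "p + q" 1 "\<gamma> - 1"] by simp
  finally show ?thesis .
qed

text \<open>Splitting near the midpoint costs the defect, which uses up the fraction
  \<open>1 - (2/3) powr (\<gamma> - 1)\<close> of the bound; the two halves use up the rest, so the
  constant \<open>K\<close> reproduces itself. The defect may be estimated under the bound for
  \<open>R i k\<close>, which the induction has already supplied: in the applications the size of
  the path increment from \<open>i\<close> to \<open>k\<close> is read off from that
  remainder.\<close>

lemma discrete_sewing:
  fixes R :: "nat \<Rightarrow> nat \<Rightarrow> 'a::real_normed_vector" and h \<gamma> K :: real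
  assumes \<gamma>: "1 < \<gamma>" and h: "0 < h" and K: "0 \<le> K"
    and step: "\<And>i. a \<le> i \<Longrightarrow> i < b \<Longrightarrow> R i (Suc i) = 0"
    and delta: "\<And>i k j. a \<le> i \<Longrightarrow> i < k \<Longrightarrow> k < j \<Longrightarrow> j \<le> b \<Longrightarrow>
      norm (R i k) \<le> K * (real k * h - real i * h) powr \<gamma> \<Longrightarrow>
      norm (R i j - R i k - R k j)
        \<le> (1 - (2/3) powr (\<gamma> - 1)) * K * (real j * h - real i * h) powr \<gamma>"
    and ij: "a \<le> i" "i < j" "j \<le> b"
  shows "norm (R i j) \<le> K * (real j * h - real i * h) powr \<gamma>"
  using ij
proof (induction "j - i" arbitrary: i j rule: less_induct)
  case less
  show ?case
  proof (cases "j = Suc i")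
    case True
    then show ?thesis using step[of i] less.prems K by simp
  next
    case False
    \<comment> \<open>Since \<open>j - i\<close> is at least 2, rounding down leaves each part with
      at most two thirds of the length; length 3, split as 1 and 2, is the extreme case.\<close>
    define k where "k = i + (j - i) div 2"
    have k: "i < k" "k < j" "2 * (k - i) \<le> j - i" "j - i \<le> 3 * (k - i)"
      using False less.prems unfolding k_def by auto
    let ?t = "\<lambda>l. real l * h"
    have Rik: "norm (R i k) \<le> K * (?t k - ?t i) powr \<gamma>"
      using less.hyps[of k i] k less.prems by simp
    have Rkj: "norm (R k j) \<le> K * (?t j - ?t k) powr \<gamma>"
      using less.hyps[of j k] k less.prems by simp
    have "2 * k \<le> j + i" "j + 2 * i \<le> 3 * k" using k less.prems by linarith+
    then have "real (2 * k) \<le> real (j + i)" "real (j + 2 * i) \<le> real (3 * k)"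
      by (simp_all only: of_nat_le_iff)
    then have 1: "2 * (real k - real i) \<le> real j - real i" "real j - real i \<le> 3 * (real k - real i)"
      by simp_all
    have 2: "2 * (?t k - ?t i) \<le> ?t j - ?t i" "?t j - ?t i \<le> 3 * (?t k - ?t i)"
      using mult_right_mono[OF 1(1), of h] mult_right_mono[OF 1(2), of h] h
      by (simp_all add: algebra_simps)
    have 3: "?t i < ?t k" "?t k < ?t j" using k h by auto
    have split: "(?t k - ?t i) powr \<gamma> + (?t j - ?t k) powr \<gamma>
        \<le> (2/3) powr (\<gamma> - 1) * (?t j - ?t i) powr \<gamma>"
    proof -
      have *: "p \<le> 2/3 * (p + q)" "q \<le> 2/3 * (p + q)"
        if "2 * p \<le> p + q" "p + q \<le> 3 * p" "0 < p" "0 < q" for p q :: real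
        using that by auto
      have "?t k - ?t i \<le> 2/3 * ((?t k - ?t i) + (?t j - ?t k))"
        "?t j - ?t k \<le> 2/3 * ((?t k - ?t i) + (?t j - ?t k))"
        by (rule *; use 2 3 in simp)+
      from powr_split_le[OF \<gamma> _ this(1) _ this(2)] 3 show ?thesis by simp
    qed
    have "norm (R i j) \<le> norm (R i j - R i k - R k j) + norm (R i k) + norm (R k j)"
      using norm_triangle_ineq[of "R i j - R i k - R k j + R i k" "R k j"]
        norm_triangle_ineq[of "R i j - R i k - R k j" "R i k"] by simp
    also have "\<dots> \<le> (1 - (2/3) powr (\<gamma> - 1)) * K * (?t j - ?t i) powr \<gamma>
        + K * ((?t k - ?t i) powr \<gamma> + (?t j - ?t k) powr \<gamma>)"
      using delta[of i k j] k less.prems Rik Rkj by (simp add: distrib_left)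
    also have "\<dots> \<le> (1 - (2/3) powr (\<gamma> - 1)) * K * (?t j - ?t i) powr \<gamma>
        + K * ((2/3) powr (\<gamma> - 1) * (?t j - ?t i) powr \<gamma>)"
      using mult_left_mono[OF split K] by simp
    also have "\<dots> = K * (?t j - ?t i) powr \<gamma>"
      by (simp add: algebra_simps)
    finally show ?thesis .
  qed
qed

lemma doubling_blocks:
  fixes u :: "nat \<Rightarrow> real"
  assumes "\<And>a j. a \<le> j \<Longrightarrow> j \<le> a + q \<Longrightarrow> j \<le> N \<Longrightarrow> u j \<le> 2 * u a"
    and "0 \<le> u 0" and "j \<le> r * q" and "j \<le> N"
  shows "u j \<le> 2 ^ r * u 0"
  using assms(3,4)
proof (induction r arbitrary: j)
  case (Suc r)
  show ?case
  proof (cases "j \<le> r * q")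
    case True
    have "2 ^ r * u 0 \<le> 2 ^ Suc r * u 0"
      using assms(2) by (intro mult_right_mono) auto
    then show ?thesis using Suc.IH[OF True Suc.prems(2)] by linarith
  next
    case False
    then have "u j \<le> 2 * u (r * q)"
      using Suc.prems by (intro assms(1)) auto
    also have "u (r * q) \<le> 2 ^ r * u 0"
      using False Suc.prems by (intro Suc.IH) auto
    finally show ?thesis by simp
  qed
qed simp

section \<open>One-step maps and the additivity defect of their germs\<close>

locale rde_data =
  fixes b :: "'e::banach \<Rightarrow> 'e"
    and g :: "'e \<Rightarrow> 'v::real_normed_vector \<Rightarrow>\<^sub>L 'e"
    and F :: "'e \<Rightarrow> 'w::real_normed_vector \<Rightarrow>\<^sub>L 'e"
    and X :: "real \<Rightarrow> 'v" and X2 :: "real \<Rightarrow> real \<Rightarrow> 'w"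
begin

definition germ :: "real \<Rightarrow> real \<Rightarrow> 'e \<Rightarrow> 'e"
  where "germ s t x = g x (X t - X s) + F x (X2 s t)"

definition step :: "real \<Rightarrow> real \<Rightarrow> 'e \<Rightarrow> 'e"
  where "step s t x = x + (t - s) *\<^sub>R b x + germ s t x"

primrec euler :: "nat \<Rightarrow> 'e \<Rightarrow> nat \<Rightarrow> 'e"
  where
    "euler n x 0 = x"
  | "euler n x (Suc k) = step (real k / 2 ^ n) (real (Suc k) / 2 ^ n) (euler n x k)"

definition euler_path :: "nat \<Rightarrow> 'e \<Rightarrow> real \<Rightarrow> 'e"
  where "euler_path n x t = euler n x (nat \<lfloor>t * 2 ^ n\<rfloor>)"

text \<open>The locale has no assumptions and \<open>lim\<close> is total, so \<open>flow\<close> is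
  defined for every driving path and mentions neither a horizon nor a constant. One map thus serves
  all horizons, and its measurability does not rest on convergence.\<close>

definition flow :: "real \<Rightarrow> 'e \<Rightarrow> 'e"
  where "flow t x = lim (\<lambda>n. euler_path n x t)"

end

text \<open>A single \<open>C\<close> serves all bounds, because it is later enlarged to absorb the
  Hoelder constants of the individual path. \<open>taylor\<close> and \<open>F_diff\<close> compare
  remainders at two base points, as the difference of two paths requires; for \<open>w = 0\<close>
  they contain the estimates for one path.\<close>

locale rough_field =
  fixes b :: "'e::banach \<Rightarrow> 'e"
    and g :: "'e \<Rightarrow> 'v::real_normed_vector \<Rightarrow>\<^sub>L 'e"
    and F :: "'e \<Rightarrow> 'w::real_normed_vector \<Rightarrow>\<^sub>L 'e"
    and Dg :: "'e \<Rightarrow> 'e \<Rightarrow>\<^sub>L 'v \<Rightarrow>\<^sub>L 'e" and C :: real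
  assumes C: "1 \<le> C"
    and b_lip: "\<And>x y. norm (b x - b y) \<le> C * norm (x - y)"
    and b_growth: "\<And>x. norm (b x) \<le> C * (1 + norm x)"
    and g_bound: "\<And>x. norm (g x) \<le> C" and Dg_bound: "\<And>x. norm (Dg x) \<le> C"
    and F_bound: "\<And>x. norm (F x) \<le> C"
    and g_lip: "\<And>x y. norm (g x - g y) \<le> C * norm (x - y)"
    and Dg_lip: "\<And>x y. norm (Dg x - Dg y) \<le> C * norm (x - y)"
    and taylor: "\<And>x y v w. norm ((g (x + v) - g x - Dg x v) - (g (y + w) - g y - Dg y w))
      \<le> C * (norm (x - y) * (norm v)\<^sup>2 + norm (v - w) * (norm v + norm w))"
    and F_diff: "\<And>x y v w. norm ((F (x + v) - F x) - (F (y + w) - F y))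
      \<le> C * (norm (x - y) * norm v + norm (v - w))"

text \<open>Chen's relation is imposed after application of \<open>F x\<close>, so that no tensor
  product appears in the abstract part. Its mixed term is also what ties \<open>F\<close> to the
  product of \<open>Dg\<close> and \<open>g\<close>.\<close>

locale rough_rde = rde_data b g F X X2 + rough_field b g F Dg C
  for b :: "'e::banach \<Rightarrow> 'e"
    and g :: "'e \<Rightarrow> 'v::real_normed_vector \<Rightarrow>\<^sub>L 'e"
    and F :: "'e \<Rightarrow> 'w::real_normed_vector \<Rightarrow>\<^sub>L 'e"
    and X :: "real \<Rightarrow> 'v" and X2 :: "real \<Rightarrow> real \<Rightarrow> 'w"
    and Dg :: "'e \<Rightarrow> 'e \<Rightarrow>\<^sub>L 'v \<Rightarrow>\<^sub>L 'e" and C :: real +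
  fixes \<beta> T :: real
  assumes \<beta>: "1/3 < \<beta>" "\<beta> \<le> 1/2"
    and X_bound: "\<And>s t. 0 \<le> s \<Longrightarrow> s < t \<Longrightarrow> t \<le> T \<Longrightarrow> norm (X t - X s) \<le> C * (t - s) powr \<beta>"
    and X2_bound: "\<And>s t. 0 \<le> s \<Longrightarrow> s < t \<Longrightarrow> t \<le> T \<Longrightarrow> norm (X2 s t) \<le> C * ((t - s) powr \<beta>)\<^sup>2"
    and chen: "\<And>x s u t. 0 \<le> s \<Longrightarrow> s < u \<Longrightarrow> u < t \<Longrightarrow> t \<le> T \<Longrightarrow>
      F x (X2 s t) = F x (X2 s u) + F x (X2 u t) + Dg x (g x (X u - X s)) (X t - X u)"
begin

lemma F_lip: "norm (F x - F y) \<le> C * norm (x - y)"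
  using F_diff[of y "x - y" y 0] by simp

lemma taylor1: "norm (g (x + v) - g x - Dg x v) \<le> C * (norm v)\<^sup>2"
  using taylor[of x v x 0] by (simp add: power2_eq_square)

lemma blinfun_le:
  fixes f :: "'x::real_normed_vector \<Rightarrow>\<^sub>L 'y::real_normed_vector"
  assumes "norm f \<le> c" "norm v \<le> d"
  shows "norm (f v) \<le> c * d"
proof -
  have "norm (f v) \<le> norm f * norm v" by (rule norm_blinfun)
  also have "\<dots> \<le> c * d"
    using assms order.trans[OF norm_ge_zero assms(1)] by (intro mult_mono) auto
  finally show ?thesis .
qed

text \<open>The mixed term of Chen's relation supplies exactly the linear part that turns
  \<open>g y - g x\<close> into a Taylor remainder, up to the gap between \<open>y - x\<close> and
  \<open>g x (X u - X s)\<close>.\<close>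

lemma germ_delta:
  assumes "0 \<le> s" "s < u" "u < t" "t \<le> T"
  shows "germ s u x + germ u t y - germ s t x
    = (g y - g x - Dg x (g x (X u - X s))) (X t - X u) + (F y - F x) (X2 u t)"
proof -
  have "X t - X s = (X u - X s) + (X t - X u)" by simp
  then have "g x (X t - X s) = g x (X u - X s) + g x (X t - X u)"
    by (metis blinfun.add_right)
  then show ?thesis
    unfolding germ_def chen[OF assms, of x] by (simp add: blinfun.bilinear_simps)
qed

definition wt :: "real \<Rightarrow> real \<Rightarrow> real"
  where "wt s t = (t - s) powr \<beta>"

lemma wt_nonneg [simp]: "0 \<le> wt s t"
  by (simp add: wt_def)

lemma wt_mono: "s' \<le> s \<Longrightarrow> s \<le> t \<Longrightarrow> t \<le> t' \<Longrightarrow> wt s t \<le> wt s' t'"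
  unfolding wt_def using \<beta> by (intro powr_mono2) auto

lemma wt_cube: "s < t \<Longrightarrow> (wt s t) ^ 3 = (t - s) powr (3 * \<beta>)"
  by (simp add: wt_def powr_power mult.commute)

lemma wt_square: "s < t \<Longrightarrow> (wt s t)\<^sup>2 = (t - s) powr (2 * \<beta>)"
  by (simp add: wt_def powr_power mult.commute)

lemma wt_le_1: "s \<le> t \<Longrightarrow> t - s \<le> 1 \<Longrightarrow> wt s t \<le> 1"
  unfolding wt_def using \<beta> powr_le1[of \<beta> "t - s"] by auto

text \<open>By \<open>\<beta> \<le> 1/2\<close>, a drift increment over at most one unit of time is
  dominated by the second order weight.\<close>

lemma le_wt_square:
  assumes "s < t" "t - s \<le> 1"
  shows "t - s \<le> (wt s t)\<^sup>2"
proof -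
  have "(t - s) powr 1 \<le> (t - s) powr (2 * \<beta>)"
    using assms \<beta> by (intro powr_mono') auto
  then show ?thesis using assms wt_square by simp
qed

lemma X_wt: "0 \<le> s \<Longrightarrow> s < t \<Longrightarrow> t \<le> T \<Longrightarrow> norm (X t - X s) \<le> C * wt s t"
  using X_bound by (simp add: wt_def)

lemma X2_wt: "0 \<le> s \<Longrightarrow> s < t \<Longrightarrow> t \<le> T \<Longrightarrow> norm (X2 s t) \<le> C * (wt s t)\<^sup>2"
  using X2_bound by (simp add: wt_def)

lemma germ_delta_bound:
  assumes t: "0 \<le> s" "s < u" "u < t" "t \<le> T" and P: "1 \<le> P"
    and xy: "norm (y - x) \<le> P * wt s t"
    and r: "norm (y - x - g x (X u - X s)) \<le> P * (wt s t)\<^sup>2"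
  shows "norm (germ s u x + germ u t y - germ s t x) \<le> 3 * C ^ 6 * P * (wt s t) ^ 3"
proof -
  let ?w = "wt s t" and ?v = "g x (X u - X s)"
  have Xsu: "norm (X u - X s) \<le> C * ?w"
    using X_wt[of s u] wt_mono[of s s u t] t C
    by (meson less_imp_le mult_left_mono order.trans zero_le_one order.refl less_le_trans)
  have Xut: "norm (X t - X u) \<le> C * ?w"
    using X_wt[of u t] wt_mono[of s u t t] t C
    by (smt (verit) mult_left_mono)
  have X2ut: "norm (X2 u t) \<le> C * ?w\<^sup>2"
    using X2_wt[of u t] power_mono[OF wt_mono[of s u t t], of 2] t C
    by (smt (verit) mult_left_mono wt_nonneg)
  have v: "norm ?v \<le> C * (C * ?w)"
    by (intro blinfun_le g_bound Xsu)
  \<comment> \<open>The detour through \<open>g (x + ?v)\<close> keeps \<open>P\<close> linear: the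
    Lipschitz part sees the remainder of the path, and the Taylor part sees only \<open>?v\<close>,
    whose bound does not contain \<open>P\<close>.\<close>
  have 1: "norm (g y - g x - Dg x ?v) \<le> C * (P * ?w\<^sup>2) + C * (C * (C * ?w))\<^sup>2"
  proof -
    have "norm (g y - g (x + ?v)) \<le> C * norm (y - (x + ?v))" by (rule g_lip)
    also have "\<dots> \<le> C * (P * ?w\<^sup>2)"
      using r C by (intro mult_left_mono) (auto simp: algebra_simps)
    finally have "norm (g y - g (x + ?v)) \<le> C * (P * ?w\<^sup>2)" .
    moreover have "norm (g (x + ?v) - g x - Dg x ?v) \<le> C * (C * (C * ?w))\<^sup>2"
      using taylor1[of x ?v] power_mono[OF v, of 2] C
      by (smt (verit) mult_left_mono norm_ge_zero)
    moreover have "g y - g x - Dg x ?v = (g y - g (x + ?v)) + (g (x + ?v) - g x - Dg x ?v)"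
      by simp
    ultimately show ?thesis by (metis norm_triangle_mono)
  qed
  have 2: "norm (F y - F x) \<le> C * (P * ?w)"
    using F_lip[of y x] xy C by (smt (verit) mult_left_mono)
  have "norm (germ s u x + germ u t y - germ s t x)
      \<le> (C * (P * ?w\<^sup>2) + C * (C * (C * ?w))\<^sup>2) * (C * ?w) + C * (P * ?w) * (C * ?w\<^sup>2)"
    unfolding germ_delta[OF t]
    by (intro norm_triangle_le add_mono blinfun_le 1 2 Xut X2ut)
  also have "\<dots> = (2 * (C\<^sup>2 * P) + C ^ 6) * ?w ^ 3"
    by (simp add: power2_eq_square power3_eq_cube algebra_simps eval_nat_numeral)
  also have "\<dots> \<le> 3 * C ^ 6 * P * ?w ^ 3"
  proof (intro mult_right_mono)
    have "C\<^sup>2 \<le> C ^ 6" using C by (intro power_increasing) auto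
    then have "C\<^sup>2 * P \<le> C ^ 6 * P" using P by (intro mult_right_mono) auto
    moreover have "C ^ 6 * 1 \<le> C ^ 6 * P" using C P by (intro mult_left_mono) auto
    ultimately show "2 * (C\<^sup>2 * P) + C ^ 6 \<le> 3 * C ^ 6 * P" by simp
  qed simp
  finally show ?thesis .
qed

text \<open>\<open>P\<close> measures the two paths separately, \<open>Q * W\<close> the increments
  of their difference. Every summand of the defect carries exactly one factor \<open>W\<close>, so
  the comparison of two paths is linear in their distance. Splitting \<open>Dg x r - Dg y r'\<close>
  as \<open>Dg x (r - r') + (Dg x - Dg y) r'\<close> is the reason why a remainder bound is asked
  for the second path alone.\<close>

lemma germ_delta_diff_bound:
  assumes t: "0 \<le> s" "s < u" "u < t" "t \<le> T"
    and P: "0 \<le> P" "0 \<le> Q" "0 \<le> W"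
    and x: "norm (x' - x) \<le> P * wt s t" and y: "norm (y' - y) \<le> P * wt s t"
    and ry: "norm (y' - y - g y (X u - X s)) \<le> P * (wt s t)\<^sup>2"
    and xy: "norm (x - y) \<le> W"
    and d: "norm ((x' - x) - (y' - y)) \<le> Q * W * wt s t"
    and rd: "norm ((x' - x - g x (X u - X s)) - (y' - y - g y (X u - X s))) \<le> Q * W * (wt s t)\<^sup>2"
  shows "norm ((germ s u x + germ u t x' - germ s t x) - (germ s u y + germ u t y' - germ s t y))
    \<le> C\<^sup>2 * (P\<^sup>2 + 2 * P * Q + 2 * P + 2 * Q) * W * (wt s t) ^ 3"
proof -
  let ?w = "wt s t"
  define r where "r = x' - x - g x (X u - X s)"
  define r' where "r' = y' - y - g y (X u - X s)"
  define Tx where "Tx = g x' - g x - Dg x (x' - x)"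
  define Ty where "Ty = g y' - g y - Dg y (y' - y)"
  have C0: "0 \<le> C" using C by simp
  have Xut: "norm (X t - X u) \<le> C * ?w"
    using X_wt[of u t] wt_mono[of s u t t] t C
    by (smt (verit) mult_left_mono)
  have X2ut: "norm (X2 u t) \<le> C * ?w\<^sup>2"
    using X2_wt[of u t] power_mono[OF wt_mono[of s u t t], of 2] t C
    by (smt (verit) mult_left_mono wt_nonneg)
  have TT: "norm (Tx - Ty) \<le> C * (W * (P * ?w)\<^sup>2 + Q * W * ?w * (P * ?w + P * ?w))"
  proof -
    have "norm (Tx - Ty) \<le> C * (norm (x - y) * (norm (x' - x))\<^sup>2
        + norm ((x' - x) - (y' - y)) * (norm (x' - x) + norm (y' - y)))"
      using taylor[of x "x' - x" y "y' - y"] by (simp add: Tx_def Ty_def)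
    also have "\<dots> \<le> C * (W * (P * ?w)\<^sup>2 + Q * W * ?w * (P * ?w + P * ?w))"
      using C0 P x y xy d
      by (intro mult_left_mono add_mono mult_mono power_mono) auto
    finally show ?thesis .
  qed
  have DD: "norm (Dg x r - Dg y r') \<le> C * (Q * W * ?w\<^sup>2) + C * W * (P * ?w\<^sup>2)"
  proof -
    have "Dg x r - Dg y r' = Dg x (r - r') + (Dg x - Dg y) r'"
      by (simp add: blinfun.bilinear_simps)
    moreover have "norm (Dg x (r - r')) \<le> C * (Q * W * ?w\<^sup>2)"
      using rd by (intro blinfun_le Dg_bound) (simp add: r_def r'_def)
    moreover have "norm ((Dg x - Dg y) r') \<le> C * W * (P * ?w\<^sup>2)"
      using ry order.trans[OF Dg_lip mult_left_mono[OF xy C0]]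
      by (intro blinfun_le) (auto simp: r'_def)
    ultimately show ?thesis by (metis norm_triangle_mono)
  qed
  have FF: "norm ((F x' - F x) - (F y' - F y)) \<le> C * (W * (P * ?w) + Q * W * ?w)"
  proof -
    have "norm ((F x' - F x) - (F y' - F y)) \<le> C * (norm (x - y) * norm (x' - x)
        + norm ((x' - x) - (y' - y)))"
      using F_diff[of x "x' - x" y "y' - y"] by simp
    also have "\<dots> \<le> C * (W * (P * ?w) + Q * W * ?w)"
      using C0 P x xy d by (intro mult_left_mono add_mono mult_mono) auto
    finally show ?thesis .
  qed
  have "(germ s u x + germ u t x' - germ s t x) - (germ s u y + germ u t y' - germ s t y)
    = ((Tx - Ty) + (Dg x r - Dg y r')) (X t - X u) + ((F x' - F x) - (F y' - F y)) (X2 u t)"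
    unfolding germ_delta[OF t] Tx_def Ty_def r_def r'_def by (simp add: blinfun.bilinear_simps)
  also have "norm \<dots> \<le> ((C * (W * (P * ?w)\<^sup>2 + Q * W * ?w * (P * ?w + P * ?w)))
        + (C * (Q * W * ?w\<^sup>2) + C * W * (P * ?w\<^sup>2))) * (C * ?w)
      + (C * (W * (P * ?w) + Q * W * ?w)) * (C * ?w\<^sup>2)"
    by (intro norm_triangle_le add_mono blinfun_le TT DD FF Xut X2ut)
  also have "\<dots> = C\<^sup>2 * (P\<^sup>2 + 2 * P * Q + 2 * P + 2 * Q) * W * ?w ^ 3"
    by (simp add: power2_eq_square power3_eq_cube algebra_simps)
  finally show ?thesis .
qed

section \<open>Uniform estimates for Euler schemes on short blocks\<close>

definition gap :: real
  where "gap = 1 - (2/3) powr (3 * \<beta> - 1)"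

lemma gap_pos: "0 < gap"
  using \<beta> powr_less_mono'[of "2/3::real" 0 "3 * \<beta> - 1"] by (simp add: gap_def)

text \<open>The defect constant \<open>3 * C ^ 6 * P\<close> at
  \<open>P = 4 * C\<^sup>2 * M\<close>, divided by the fraction \<open>gap\<close> that sewing
  reserves for the defect; the factor \<open>M\<close> is carried separately.\<close>

definition K_euler :: real
  where "K_euler = 12 * C ^ 8 / gap"

lemma K_euler_nonneg: "0 \<le> K_euler"
  using gap_pos C by (simp add: K_euler_def)

lemma sum_block_bound:
  fixes a :: "nat \<Rightarrow> 'x::real_normed_vector"
  assumes "\<And>l. i \<le> l \<Longrightarrow> l < j \<Longrightarrow> norm (a l) \<le> c * h" and "i < j"
  shows "norm (\<Sum>l=i..<j. a l) \<le> c * (real j * h - real i * h)"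
proof -
  have "norm (\<Sum>l=i..<j. a l) \<le> (\<Sum>l=i..<j. c * h)"
    using assms by (intro sum_norm_le) auto
  also have "\<dots> = c * (real j * h - real i * h)"
    using assms by (simp add: of_nat_diff algebra_simps)
  finally show ?thesis .
qed

text \<open>A bootstrap: \<open>K_euler\<close> is computed from the constant
  \<open>4 * C\<^sup>2\<close> of the increments, and these are in turn read off from the remainder.
  The circle closes through \<open>small\<close>, which turns a third order remainder with constant
  \<open>K_euler\<close> into a second order one with constant 1, so that the increments do not feel
  \<open>K_euler\<close>.\<close>

lemma euler_block_bound:
  fixes y :: "nat \<Rightarrow> 'e" and h M :: real
  defines "t \<equiv> \<lambda>l. real l * h"
  assumes h: "0 < h" and NT: "t N \<le> T" and len: "t N - t a \<le> 1"
    and small: "K_euler * wt (t a) (t N) \<le> 1"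
    and ystep: "\<And>l. a \<le> l \<Longrightarrow> l < N \<Longrightarrow> y (Suc l) = step (t l) (t (Suc l)) (y l)"
    and M: "\<And>l. a \<le> l \<Longrightarrow> l \<le> N \<Longrightarrow> 1 + norm (y l) \<le> M"
    and ij: "a \<le> i" "i < j" "j \<le> N"
  shows "norm (y j - y i) \<le> 4 * C\<^sup>2 * M * wt (t i) (t j)"
    and "norm (y j - step (t i) (t j) (y i)) \<le> (K_euler + 4 * C ^ 3) * M * (wt (t i) (t j)) ^ 3"
proof -
  \<comment> \<open>The sum of the actual drift terms is additive over adjacent index ranges, so it
    drops out of the defect of \<open>R\<close>; and \<open>R\<close> vanishes on single
    steps.\<close>
  define A where "A i j = (\<Sum>l=i..<j. h *\<^sub>R b (y l))" for i j
  define R where "R i j = y j - y i - A i j - germ (t i) (t j) (y i)" for i j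
  have C0: "0 \<le> C" using C by simp
  have M1: "1 \<le> M" using M[of i] ij norm_ge_zero[of "y i"] by linarith
  have tmono: "t i \<le> t j" if "i \<le> j" for i j
    using that h by (simp add: t_def)
  have tmono': "t i < t j" if "i < j" for i j
    using that h by (simp add: t_def)
  have t0: "0 \<le> t i" for i using h by (simp add: t_def)
  have tb: "t i < t j" "t j \<le> T" "t j - t i \<le> 1" "0 \<le> t i" if "a \<le> i" "i < j" "j \<le> N" for i j
    using that tmono[of a i] tmono[of j N] tmono'[of i j] NT len t0[of i] by linarith+
  have Ab: "norm (A i j) \<le> C * M * (t j - t i)" if "a \<le> i" "i < j" "j \<le> N" for i j
    unfolding A_def t_def
  proof (rule sum_block_bound)
    fix l assume "i \<le> l" "l < j"
    then have "norm (b (y l)) \<le> C * M"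
      using order.trans[OF b_growth mult_left_mono[OF M C0]] that by simp
    then show "norm (h *\<^sub>R b (y l)) \<le> C * M * h"
      using h by (simp add: mult.commute)
  qed (use that in auto)
  have inc: "norm (y j - y i) \<le> 4 * C\<^sup>2 * M * wt (t i) (t j)"
      "norm (y j - y i - g (y i) (X (t j) - X (t i))) \<le> 4 * C\<^sup>2 * M * (wt (t i) (t j))\<^sup>2"
    if ij: "a \<le> i" "i < j" "j \<le> N" and R: "norm (R i j) \<le> K_euler * M * (wt (t i) (t j)) ^ 3" for i j
  proof -
    let ?w = "wt (t i) (t j)"
    note tb = tb[OF ij]
    have w1: "?w \<le> 1" using tb by (intro wt_le_1) auto
    have w2: "?w\<^sup>2 \<le> ?w" using w1 by (simp add: power2_eq_square mult_left_le)
    have "K_euler * ?w \<le> K_euler * wt (t a) (t N)"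
      using tmono[of a i] tmono[of j N] ij tb by (intro mult_left_mono wt_mono K_euler_nonneg) auto
    then have K1: "K_euler * ?w \<le> 1" using small by linarith
    have "K_euler * M * ?w ^ 3 = (K_euler * ?w) * (M * ?w\<^sup>2)"
      by (simp add: power3_eq_cube power2_eq_square)
    also have "\<dots> \<le> 1 * (M * ?w\<^sup>2)" using K1 M1 by (intro mult_right_mono) auto
    finally have R1: "norm (R i j) \<le> M * ?w\<^sup>2" using R by linarith
    have A1: "norm (A i j) \<le> C * M * ?w\<^sup>2"
      using order.trans[OF Ab[OF ij] mult_left_mono[OF le_wt_square]] tb C M1 by simp
    have F1: "norm (F (y i) (X2 (t i) (t j))) \<le> C * (C * ?w\<^sup>2)"
      using tb by (intro blinfun_le F_bound X2_wt) auto
    have g1: "norm (g (y i) (X (t j) - X (t i))) \<le> C * (C * ?w)"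
      using tb by (intro blinfun_le g_bound X_wt) auto
    have "y j - y i - g (y i) (X (t j) - X (t i)) = A i j + F (y i) (X2 (t i) (t j)) + R i j"
      by (simp add: R_def germ_def)
    then have "norm (y j - y i - g (y i) (X (t j) - X (t i)))
        \<le> norm (A i j) + norm (F (y i) (X2 (t i) (t j))) + norm (R i j)"
      using norm_triangle_ineq[of "A i j + F (y i) (X2 (t i) (t j))" "R i j"]
        norm_triangle_ineq[of "A i j" "F (y i) (X2 (t i) (t j))"] by simp
    also have "\<dots> \<le> (C * M + C\<^sup>2 + M) * ?w\<^sup>2"
      using A1 F1 R1 by (simp add: algebra_simps power2_eq_square)
    also have "\<dots> \<le> (3 * C\<^sup>2 * M) * ?w\<^sup>2"
    proof (intro mult_right_mono)
      have CC: "C \<le> C\<^sup>2" "1 \<le> C\<^sup>2" using C self_le_power[of C 2] by auto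
      have "C * M \<le> C\<^sup>2 * M" "1 * M \<le> C\<^sup>2 * M" "C\<^sup>2 * 1 \<le> C\<^sup>2 * M"
        using CC M1 by (intro mult_right_mono mult_left_mono; simp)+
      then show "C * M + C\<^sup>2 + M \<le> 3 * C\<^sup>2 * M" by simp
    qed simp
    finally have r: "norm (y j - y i - g (y i) (X (t j) - X (t i))) \<le> 3 * C\<^sup>2 * M * ?w\<^sup>2" .
    have CM: "C\<^sup>2 \<le> C\<^sup>2 * M" "0 \<le> C\<^sup>2 * M" using M1 by (auto simp: mult_le_cancel_left1)
    show "norm (y j - y i - g (y i) (X (t j) - X (t i))) \<le> 4 * C\<^sup>2 * M * ?w\<^sup>2"
      using r mult_right_mono[OF CM(2), of "?w\<^sup>2"] by (simp add: algebra_simps)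
    have "norm (y j - y i) \<le> 3 * C\<^sup>2 * M * ?w\<^sup>2 + C * (C * ?w)"
      using norm_triangle_ineq[of "y j - y i - g (y i) (X (t j) - X (t i))" "g (y i) (X (t j) - X (t i))"]
        r g1 by simp
    also have "\<dots> \<le> 3 * C\<^sup>2 * M * ?w + C\<^sup>2 * M * ?w"
      using w2 CM mult_right_mono[OF CM(1), of ?w]
      by (intro add_mono mult_left_mono) (auto simp: power2_eq_square algebra_simps)
    finally show "norm (y j - y i) \<le> 4 * C\<^sup>2 * M * ?w" by (simp add: algebra_simps)
  qed
  have Rb: "norm (R i j) \<le> K_euler * M * (real j * h - real i * h) powr (3 * \<beta>)"
    if "a \<le> i" "i < j" "j \<le> N" for i j
  proof (rule discrete_sewing[where a = a and b = N])
    show "1 < 3 * \<beta>" "0 < h" "a \<le> i" "i < j" "j \<le> N"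
      using \<beta> h that by auto
    show "0 \<le> K_euler * M" using K_euler_nonneg M1 by simp
    show "R l (Suc l) = 0" if "a \<le> l" "l < N" for l
      using ystep[OF that] by (simp add: R_def A_def step_def t_def algebra_simps)
    fix i k j assume ikj: "a \<le> i" "i < k" "k < j" "j \<le> N"
      and Rik: "norm (R i k) \<le> K_euler * M * (real k * h - real i * h) powr (3 * \<beta>)"
    have "A i k + A k j = A i j"
      unfolding A_def using ikj by (intro sum.atLeastLessThan_concat) auto
    then have "R i j - R i k - R k j
        = germ (t i) (t k) (y i) + germ (t k) (t j) (y k) - germ (t i) (t j) (y i)"
      by (simp add: R_def algebra_simps)
    also have "norm \<dots> \<le> 3 * C ^ 6 * (4 * C\<^sup>2 * M) * (wt (t i) (t j)) ^ 3"
    proof (rule germ_delta_bound)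
      show "0 \<le> t i" "t i < t k" "t k < t j" "t j \<le> T"
        using tb[of i j] tmono' ikj by auto
      have "1 \<le> C\<^sup>2 * M" using C M1 mult_mono[of 1 "C\<^sup>2" 1 M] by simp
      then show "1 \<le> 4 * C\<^sup>2 * M" by simp
      have ww: "wt (t i) (t k) \<le> wt (t i) (t j)"
        using tmono'[of i k] tmono'[of k j] ikj by (intro wt_mono) auto
      have "norm (R i k) \<le> K_euler * M * (wt (t i) (t k)) ^ 3"
        using Rik tmono'[of i k] ikj by (simp add: wt_cube t_def)
      note inc = inc[OF \<open>a \<le> i\<close> \<open>i < k\<close> _ this]
      have "4 * C\<^sup>2 * M * wt (t i) (t k) \<le> 4 * C\<^sup>2 * M * wt (t i) (t j)"
        "4 * C\<^sup>2 * M * (wt (t i) (t k))\<^sup>2 \<le> 4 * C\<^sup>2 * M * (wt (t i) (t j))\<^sup>2"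
        using ww M1 by (auto intro!: mult_left_mono power_mono)
      then show "norm (y k - y i) \<le> 4 * C\<^sup>2 * M * wt (t i) (t j)"
        "norm (y k - y i - g (y i) (X (t k) - X (t i))) \<le> 4 * C\<^sup>2 * M * (wt (t i) (t j))\<^sup>2"
        using inc ikj by auto
    qed
    also have "3 * C ^ 6 * (4 * C\<^sup>2 * M) = (1 - (2/3) powr (3 * \<beta> - 1)) * (K_euler * M)"
    proof -
      have "gap * K_euler = 12 * C ^ 8" using gap_pos by (simp add: K_euler_def)
      then have "(1 - (2/3) powr (3 * \<beta> - 1)) * (K_euler * M) = 12 * C ^ 8 * M"
        unfolding gap_def by (metis mult.assoc)
      then show ?thesis by (auto simp flip: power_add)
    qed
    also have "(wt (t i) (t j)) ^ 3 = (real j * h - real i * h) powr (3 * \<beta>)"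
      using tmono'[of i j] ikj by (simp add: wt_cube t_def)
    finally show "norm (R i j - R i k - R k j)
      \<le> (1 - (2/3) powr (3 * \<beta> - 1)) * (K_euler * M) * (real j * h - real i * h) powr (3 * \<beta>)" .
  qed
  have Rb': "norm (R i j) \<le> K_euler * M * (wt (t i) (t j)) ^ 3" if "a \<le> i" "i < j" "j \<le> N" for i j
    using Rb[OF that] tmono'[of i j] that by (simp add: wt_cube t_def)
  show "norm (y j - y i) \<le> 4 * C\<^sup>2 * M * wt (t i) (t j)"
    by (rule inc[OF ij Rb'[OF ij]])
  let ?w = "wt (t i) (t j)"
  \<comment> \<open>For the second claim the drift is frozen at the left end point. Each summand
    changes by \<open>C\<close> times a first order increment, and the length of the interval
    supplies the two missing orders.\<close>
  have "norm (\<Sum>l=i..<j. h *\<^sub>R (b (y l) - b (y i))) \<le> (4 * C ^ 3 * M * ?w) * (real j * h - real i * h)"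
  proof (rule sum_block_bound)
    fix l assume l: "i \<le> l" "l < j"
    have "norm (y l - y i) \<le> 4 * C\<^sup>2 * M * ?w"
    proof (cases "l = i")
      case True
      then show ?thesis using M1 by simp
    next
      case False
      then have "norm (y l - y i) \<le> 4 * C\<^sup>2 * M * wt (t i) (t l)"
        using l ij by (intro inc Rb') auto
      also have "\<dots> \<le> 4 * C\<^sup>2 * M * ?w"
        using M1 l tmono by (intro mult_left_mono wt_mono) auto
      finally show ?thesis .
    qed
    then have "norm (b (y l) - b (y i)) \<le> C * (4 * C\<^sup>2 * M * ?w)"
      using order.trans[OF b_lip mult_left_mono[OF _ C0]] by blast
    then have "norm (b (y l) - b (y i)) \<le> 4 * C ^ 3 * M * ?w"
      by (simp add: power2_eq_square power3_eq_cube algebra_simps)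
    then show "norm (h *\<^sub>R (b (y l) - b (y i))) \<le> 4 * C ^ 3 * M * ?w * h"
      using h mult_left_mono[of _ _ h] by (simp add: mult.commute)
  qed (rule ij)
  also have "\<dots> \<le> (4 * C ^ 3 * M * ?w) * ?w\<^sup>2"
    using le_wt_square[of "t i" "t j"] tb[OF ij] C M1 by (intro mult_left_mono) (auto simp: t_def)
  finally have S: "norm (\<Sum>l=i..<j. h *\<^sub>R (b (y l) - b (y i))) \<le> 4 * C ^ 3 * M * ?w ^ 3"
    by (simp add: power2_eq_square power3_eq_cube algebra_simps)
  have "(\<Sum>l=i..<j. h *\<^sub>R (b (y l) - b (y i))) = A i j - (t j - t i) *\<^sub>R b (y i)"
    using ij by (simp add: A_def t_def scaleR_diff_right sum_subtractf sum_constant_scaleR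
      of_nat_diff left_diff_distrib scaleR_diff_left)
  then have "y j - step (t i) (t j) (y i) = R i j + (\<Sum>l=i..<j. h *\<^sub>R (b (y l) - b (y i)))"
    by (simp add: R_def step_def)
  then have "norm (y j - step (t i) (t j) (y i))
      \<le> K_euler * M * ?w ^ 3 + 4 * C ^ 3 * M * ?w ^ 3"
    using Rb'[OF ij] S by (metis norm_triangle_mono)
  then show "norm (y j - step (t i) (t j) (y i)) \<le> (K_euler + 4 * C ^ 3) * M * ?w ^ 3"
    by (simp add: algebra_simps)
qed

text \<open>At an index where the maximum \<open>M\<close> over the block is attained, the path has
  moved by at most \<open>M / 2\<close>, by the second smallness condition; this half is absorbed on
  the left.\<close>

lemma euler_block_doubling:
  fixes y :: "nat \<Rightarrow> 'e" and h :: real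
  defines "t \<equiv> \<lambda>l. real l * h"
  assumes h: "0 < h" and NT: "t N \<le> T" and len: "t N - t a \<le> 1"
    and small: "K_euler * wt (t a) (t N) \<le> 1" "8 * C\<^sup>2 * wt (t a) (t N) \<le> 1"
    and ystep: "\<And>l. a \<le> l \<Longrightarrow> l < N \<Longrightarrow> y (Suc l) = step (t l) (t (Suc l)) (y l)"
    and aN: "a \<le> N"
  shows "1 + norm (y N) \<le> 2 * (1 + norm (y a))"
proof -
  define M where "M = Max ((\<lambda>l. 1 + norm (y l)) ` {a..N})"
  have M: "1 + norm (y l) \<le> M" if "a \<le> l" "l \<le> N" for l
    unfolding M_def using that by (intro Max_ge) auto
  have "M \<in> (\<lambda>l. 1 + norm (y l)) ` {a..N}"
    unfolding M_def using aN by (intro Max_in) auto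
  then obtain l where l: "a \<le> l" "l \<le> N" "M = 1 + norm (y l)" by auto
  have M0: "0 \<le> M" using M[OF l(1,2)] norm_ge_zero[of "y l"] by linarith
  have "norm (y l - y a) \<le> M / 2"
  proof (cases "l = a")
    case True
    then show ?thesis using M0 by simp
  next
    case False
    then have "norm (y l - y a) \<le> 4 * C\<^sup>2 * M * wt (t a) (t l)"
      unfolding t_def
      by (intro euler_block_bound(1)[where a = a and N = N])
         (use h NT len small ystep M l in \<open>auto simp: t_def\<close>)
    also have "\<dots> \<le> 4 * C\<^sup>2 * M * wt (t a) (t N)"
      using h l M0 by (intro mult_left_mono wt_mono) (auto simp: t_def)
    also have "\<dots> = (8 * C\<^sup>2 * wt (t a) (t N)) * (M / 2)" by simp
    also have "\<dots> \<le> 1 * (M / 2)" using small M0 by (intro mult_right_mono) auto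
    finally show ?thesis by simp
  qed
  then have "M \<le> 1 + norm (y a) + M / 2"
    using l norm_triangle_sub[of "y l" "y a"] by linarith
  then show ?thesis using M[OF aN order.refl] by simp
qed

section \<open>Difference of two approximate solutions on short blocks\<close>

definition K_two :: "real \<Rightarrow> real"
  where "K_two P = C\<^sup>2 * (P\<^sup>2 + 2 * P * (4 * C\<^sup>2) + 2 * P + 2 * (4 * C\<^sup>2)) / gap"

lemma K_two_nonneg: "0 \<le> P \<Longrightarrow> 0 \<le> K_two P"
  using gap_pos C by (simp add: K_two_def)

text \<open>Both paths may violate the one-step equation, as long as their local errors differ by at
  most \<open>\<eta> * h\<close>. Since \<open>W\<close> dominates the distance plus
  \<open>\<eta>\<close>, the single quantity \<open>C * W * h\<close> bounds the drift difference
  and the local error of one cell together.\<close>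

lemma two_point_block_bound:
  fixes y y' :: "nat \<Rightarrow> 'e" and h W \<eta> P :: real
  defines "t \<equiv> \<lambda>l. real l * h"
  assumes h: "0 < h" and NT: "t N \<le> T" and len: "t N - t a \<le> 1"
    and P: "0 \<le> P" and \<eta>: "0 \<le> \<eta>"
    and small: "K_two P * wt (t a) (t N) \<le> 1"
    and y: "\<And>i j. a \<le> i \<Longrightarrow> i < j \<Longrightarrow> j \<le> N \<Longrightarrow> norm (y j - y i) \<le> P * wt (t i) (t j)"
    and y': "\<And>i j. a \<le> i \<Longrightarrow> i < j \<Longrightarrow> j \<le> N \<Longrightarrow> norm (y' j - y' i) \<le> P * wt (t i) (t j)"
    and r: "\<And>i j. a \<le> i \<Longrightarrow> i < j \<Longrightarrow> j \<le> N \<Longrightarrow>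
      norm (y' j - y' i - g (y' i) (X (t j) - X (t i))) \<le> P * (wt (t i) (t j))\<^sup>2"
    and e: "\<And>l. a \<le> l \<Longrightarrow> l < N \<Longrightarrow>
      norm ((y (Suc l) - step (t l) (t (Suc l)) (y l)) - (y' (Suc l) - step (t l) (t (Suc l)) (y' l)))
        \<le> \<eta> * h"
    and W: "\<And>l. a \<le> l \<Longrightarrow> l \<le> N \<Longrightarrow> norm (y l - y' l) + \<eta> \<le> W"
    and ij: "a \<le> i" "i < j" "j \<le> N"
  shows "norm ((y j - y' j) - (y i - y' i)) \<le> 4 * C\<^sup>2 * W * wt (t i) (t j)"
proof -
  \<comment> \<open>The local errors are put into the additive part next to the drift, so
    \<open>R\<close> vanishes on single steps for arbitrary paths and the errors do not enter the
    defect.\<close>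
  define \<alpha> where "\<alpha> l = h *\<^sub>R (b (y l) - b (y' l)) +
    ((y (Suc l) - step (t l) (t (Suc l)) (y l)) - (y' (Suc l) - step (t l) (t (Suc l)) (y' l)))" for l
  define A where "A i j = (\<Sum>l=i..<j. \<alpha> l)" for i j
  define R where "R i j = (y j - y' j) - (y i - y' i) - A i j
    - (germ (t i) (t j) (y i) - germ (t i) (t j) (y' i))" for i j
  have C0: "0 \<le> C" using C by simp
  have Wz: "norm (y l - y' l) \<le> W" if "a \<le> l" "l \<le> N" for l
    using W[OF that] \<eta> by linarith
  have W0: "0 \<le> W" using Wz[of i] ij norm_ge_zero[of "y i - y' i"] by linarith
  have tmono: "t i \<le> t j" if "i \<le> j" for i j
    using that h by (simp add: t_def)
  have tmono': "t i < t j" if "i < j" for i j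
    using that h by (simp add: t_def)
  have t0: "0 \<le> t i" for i using h by (simp add: t_def)
  have tb: "t i < t j" "t j \<le> T" "t j - t i \<le> 1" "0 \<le> t i" if "a \<le> i" "i < j" "j \<le> N" for i j
    using that tmono[of a i] tmono[of j N] tmono'[of i j] NT len t0[of i] by linarith+
  have Ab: "norm (A i j) \<le> C * W * (t j - t i)" if "a \<le> i" "i < j" "j \<le> N" for i j
    unfolding A_def t_def
  proof (rule sum_block_bound)
    fix l assume l: "i \<le> l" "l < j"
    have "norm (\<alpha> l) \<le> h * (C * norm (y l - y' l)) + \<eta> * h"
      unfolding \<alpha>_def using h b_lip e[of l] l that
      by (intro norm_triangle_le add_mono) auto
    also have "\<dots> \<le> h * (C * norm (y l - y' l)) + (C * \<eta>) * h"
      using C \<eta> h mult_right_mono[OF C \<eta>] by (intro add_left_mono mult_right_mono) auto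
    also have "\<dots> = C * (norm (y l - y' l) + \<eta>) * h" by (simp add: algebra_simps)
    also have "\<dots> \<le> C * W * h"
      using W[of l] l that h C0 by (intro mult_right_mono mult_left_mono) auto
    finally show "norm (\<alpha> l) \<le> C * W * h" .
  qed (use that in auto)
  have CC: "C \<le> C\<^sup>2" "1 \<le> C\<^sup>2" using C self_le_power[of C 2] by auto
  have CW: "C * W \<le> C\<^sup>2 * W" "W \<le> C\<^sup>2 * W" "0 \<le> C\<^sup>2 * W"
    using CC W0 mult_right_mono[OF CC(1) W0] mult_right_mono[OF CC(2) W0] by auto
  have inc: "norm ((y j - y i) - (y' j - y' i)) \<le> 4 * C\<^sup>2 * W * wt (t i) (t j)"
      "norm ((y j - y i - g (y i) (X (t j) - X (t i))) - (y' j - y' i - g (y' i) (X (t j) - X (t i))))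
        \<le> 4 * C\<^sup>2 * W * (wt (t i) (t j))\<^sup>2"
    if ij: "a \<le> i" "i < j" "j \<le> N" and R: "norm (R i j) \<le> K_two P * W * (wt (t i) (t j)) ^ 3" for i j
  proof -
    let ?w = "wt (t i) (t j)"
    note tb = tb[OF ij]
    have w1: "?w \<le> 1" using tb by (intro wt_le_1) auto
    have w2: "?w\<^sup>2 \<le> ?w" using w1 by (simp add: power2_eq_square mult_left_le)
    have "K_two P * ?w \<le> K_two P * wt (t a) (t N)"
      using tmono[of a i] tmono[of j N] ij tb P by (intro mult_left_mono wt_mono K_two_nonneg) auto
    then have K1: "K_two P * ?w \<le> 1" using small by linarith
    have "K_two P * W * ?w ^ 3 = (K_two P * ?w) * (W * ?w\<^sup>2)"
      by (simp add: power3_eq_cube power2_eq_square)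
    also have "\<dots> \<le> 1 * (W * ?w\<^sup>2)" using K1 W0 by (intro mult_right_mono) auto
    finally have R1: "norm (R i j) \<le> W * ?w\<^sup>2" using R by linarith
    have A1: "norm (A i j) \<le> C * W * ?w\<^sup>2"
      using order.trans[OF Ab[OF ij] mult_left_mono[OF le_wt_square]] tb C W0 by simp
    have zW: "norm (y i - y' i) \<le> W" using Wz ij by simp
    have F1: "norm ((F (y i) - F (y' i)) (X2 (t i) (t j))) \<le> (C * W) * (C * ?w\<^sup>2)"
      using tb order.trans[OF F_lip mult_left_mono[OF zW C0]] by (intro blinfun_le X2_wt) auto
    have g1: "norm ((g (y i) - g (y' i)) (X (t j) - X (t i))) \<le> (C * W) * (C * ?w)"
      using tb order.trans[OF g_lip mult_left_mono[OF zW C0]] by (intro blinfun_le X_wt) auto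
    let ?r = "(y j - y i - g (y i) (X (t j) - X (t i))) - (y' j - y' i - g (y' i) (X (t j) - X (t i)))"
    have "?r = A i j + (F (y i) - F (y' i)) (X2 (t i) (t j)) + R i j"
      by (simp add: R_def germ_def blinfun.bilinear_simps)
    then have "norm ?r \<le> norm (A i j) + norm ((F (y i) - F (y' i)) (X2 (t i) (t j))) + norm (R i j)"
      using norm_triangle_ineq[of "A i j + (F (y i) - F (y' i)) (X2 (t i) (t j))" "R i j"]
        norm_triangle_ineq[of "A i j" "(F (y i) - F (y' i)) (X2 (t i) (t j))"] by simp
    also have "\<dots> \<le> (C * W + C\<^sup>2 * W + W) * ?w\<^sup>2"
      using A1 F1 R1 by (simp add: algebra_simps power2_eq_square)
    also have "\<dots> \<le> (3 * C\<^sup>2 * W) * ?w\<^sup>2"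
      using CW by (intro mult_right_mono zero_le_power2) linarith
    finally have r: "norm ?r \<le> 3 * C\<^sup>2 * W * ?w\<^sup>2" .
    show "norm ?r \<le> 4 * C\<^sup>2 * W * ?w\<^sup>2"
      using r mult_right_mono[OF CW(3), of "?w\<^sup>2"] by (simp add: algebra_simps)
    have "(y j - y i) - (y' j - y' i) = ?r + (g (y i) - g (y' i)) (X (t j) - X (t i))"
      by (simp add: blinfun.bilinear_simps)
    then have "norm ((y j - y i) - (y' j - y' i)) \<le> 3 * C\<^sup>2 * W * ?w\<^sup>2 + (C * W) * (C * ?w)"
      using r g1 by (metis norm_triangle_mono)
    also have "\<dots> \<le> 3 * C\<^sup>2 * W * ?w + C\<^sup>2 * W * ?w"
      using w2 CW by (intro add_mono mult_left_mono) (auto simp: power2_eq_square algebra_simps)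
    finally show "norm ((y j - y i) - (y' j - y' i)) \<le> 4 * C\<^sup>2 * W * ?w"
      by (simp add: algebra_simps)
  qed
  have Rb: "norm (R i j) \<le> K_two P * W * (real j * h - real i * h) powr (3 * \<beta>)"
    if "a \<le> i" "i < j" "j \<le> N" for i j
  proof (rule discrete_sewing[where a = a and b = N])
    show "1 < 3 * \<beta>" "0 < h" "a \<le> i" "i < j" "j \<le> N"
      using \<beta> h that by auto
    show "0 \<le> K_two P * W" using K_two_nonneg[OF P] W0 by simp
    show "R l (Suc l) = 0" if "a \<le> l" "l < N" for l
      by (simp add: R_def A_def \<alpha>_def step_def t_def algebra_simps)
    fix i k j assume ikj: "a \<le> i" "i < k" "k < j" "j \<le> N"
      and Rik: "norm (R i k) \<le> K_two P * W * (real k * h - real i * h) powr (3 * \<beta>)"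
    have "A i k + A k j = A i j"
      unfolding A_def using ikj by (intro sum.atLeastLessThan_concat) auto
    then have "R i j - R i k - R k j
        = (germ (t i) (t k) (y i) + germ (t k) (t j) (y k) - germ (t i) (t j) (y i))
        - (germ (t i) (t k) (y' i) + germ (t k) (t j) (y' k) - germ (t i) (t j) (y' i))"
      by (simp add: R_def algebra_simps)
    \<comment> \<open>Here \<open>Q = 4 * C\<^sup>2\<close> is the constant obtained in
      \<open>inc\<close>; \<open>K_two P\<close> is the resulting factor divided by
      \<open>gap\<close>.\<close>
    also have "norm \<dots> \<le> C\<^sup>2 * (P\<^sup>2 + 2 * P * (4 * C\<^sup>2) + 2 * P + 2 * (4 * C\<^sup>2)) * W * (wt (t i) (t j)) ^ 3"
    proof (rule germ_delta_diff_bound)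
      show "0 \<le> t i" "t i < t k" "t k < t j" "t j \<le> T"
        using tb[of i j] tmono' ikj by auto
      show "0 \<le> P" "0 \<le> 4 * C\<^sup>2" "0 \<le> W" using P W0 by auto
      have ww: "wt (t i) (t k) \<le> wt (t i) (t j)"
        using tmono'[of i k] tmono'[of k j] ikj by (intro wt_mono) auto
      have ww2: "(wt (t i) (t k))\<^sup>2 \<le> (wt (t i) (t j))\<^sup>2"
        using ww by (intro power_mono) auto
      have "norm (R i k) \<le> K_two P * W * (wt (t i) (t k)) ^ 3"
        using Rik tmono'[of i k] ikj by (simp add: wt_cube t_def)
      note inc = inc[OF \<open>a \<le> i\<close> \<open>i < k\<close> _ this]
      have c: "0 \<le> 4 * C\<^sup>2 * W" using W0 by simp
      show "norm (y k - y i) \<le> P * wt (t i) (t j)" "norm (y' k - y' i) \<le> P * wt (t i) (t j)"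
        "norm (y' k - y' i - g (y' i) (X (t k) - X (t i))) \<le> P * (wt (t i) (t j))\<^sup>2"
        using order.trans[OF y[of i k] mult_left_mono[OF ww P]]
          order.trans[OF y'[of i k] mult_left_mono[OF ww P]]
          order.trans[OF r[of i k] mult_left_mono[OF ww2 P]] ikj by auto
      show "norm (y i - y' i) \<le> W" using Wz ikj by simp
      show "norm ((y k - y i) - (y' k - y' i)) \<le> 4 * C\<^sup>2 * W * wt (t i) (t j)"
        "norm ((y k - y i - g (y i) (X (t k) - X (t i))) - (y' k - y' i - g (y' i) (X (t k) - X (t i))))
          \<le> 4 * C\<^sup>2 * W * (wt (t i) (t j))\<^sup>2"
        using order.trans[OF inc(1) mult_left_mono[OF ww c]]
          order.trans[OF inc(2) mult_left_mono[OF ww2 c]] ikj by auto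
    qed
    also have "C\<^sup>2 * (P\<^sup>2 + 2 * P * (4 * C\<^sup>2) + 2 * P + 2 * (4 * C\<^sup>2))
        = (1 - (2/3) powr (3 * \<beta> - 1)) * K_two P"
      using gap_pos by (simp add: K_two_def flip: gap_def)
    also have "(wt (t i) (t j)) ^ 3 = (real j * h - real i * h) powr (3 * \<beta>)"
      using tmono'[of i j] ikj by (simp add: wt_cube t_def)
    finally show "norm (R i j - R i k - R k j)
      \<le> (1 - (2/3) powr (3 * \<beta> - 1)) * (K_two P * W) * (real j * h - real i * h) powr (3 * \<beta>)"
      by (simp only: mult.assoc)
  qed
  have "norm (R i j) \<le> K_two P * W * (wt (t i) (t j)) ^ 3"
    using Rb[OF ij] tmono'[of i j] ij by (simp add: wt_cube t_def)
  from inc(1)[OF ij this] show ?thesis by (simp add: algebra_simps)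
qed

text \<open>Adding \<open>\<eta>\<close> to the distance makes the accumulated local errors obey the
  same doubling law, by the same absorption at a maximum as for a single scheme.\<close>

lemma two_point_block_doubling:
  fixes y y' :: "nat \<Rightarrow> 'e" and h \<eta> P :: real
  defines "t \<equiv> \<lambda>l. real l * h"
  assumes h: "0 < h" and NT: "t N \<le> T" and len: "t N - t a \<le> 1"
    and P: "0 \<le> P" and \<eta>: "0 \<le> \<eta>"
    and small: "K_two P * wt (t a) (t N) \<le> 1" "8 * C\<^sup>2 * wt (t a) (t N) \<le> 1"
    and y: "\<And>i j. a \<le> i \<Longrightarrow> i < j \<Longrightarrow> j \<le> N \<Longrightarrow> norm (y j - y i) \<le> P * wt (t i) (t j)"
    and y': "\<And>i j. a \<le> i \<Longrightarrow> i < j \<Longrightarrow> j \<le> N \<Longrightarrow> norm (y' j - y' i) \<le> P * wt (t i) (t j)"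
    and r: "\<And>i j. a \<le> i \<Longrightarrow> i < j \<Longrightarrow> j \<le> N \<Longrightarrow>
      norm (y' j - y' i - g (y' i) (X (t j) - X (t i))) \<le> P * (wt (t i) (t j))\<^sup>2"
    and e: "\<And>l. a \<le> l \<Longrightarrow> l < N \<Longrightarrow>
      norm ((y (Suc l) - step (t l) (t (Suc l)) (y l)) - (y' (Suc l) - step (t l) (t (Suc l)) (y' l)))
        \<le> \<eta> * h"
    and aN: "a \<le> N"
  shows "norm (y N - y' N) + \<eta> \<le> 2 * (norm (y a - y' a) + \<eta>)"
proof -
  define W where "W = Max ((\<lambda>l. norm (y l - y' l) + \<eta>) ` {a..N})"
  have W: "norm (y l - y' l) + \<eta> \<le> W" if "a \<le> l" "l \<le> N" for l
    unfolding W_def using that by (intro Max_ge) auto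
  have "W \<in> (\<lambda>l. norm (y l - y' l) + \<eta>) ` {a..N}"
    unfolding W_def using aN by (intro Max_in) auto
  then obtain l where l: "a \<le> l" "l \<le> N" "W = norm (y l - y' l) + \<eta>" by auto
  have W0: "0 \<le> W" using l(3) \<eta> by simp
  have "norm ((y l - y' l) - (y a - y' a)) \<le> W / 2"
  proof (cases "l = a")
    case True
    then show ?thesis using W0 by simp
  next
    case False
    then have "norm ((y l - y' l) - (y a - y' a)) \<le> 4 * C\<^sup>2 * W * wt (t a) (t l)"
      unfolding t_def
      by (intro two_point_block_bound[where a = a and N = N and P = P and \<eta> = \<eta>])
         (use h NT len P \<eta> small(1) y y' r e W l in \<open>auto simp: t_def\<close>)
    also have "\<dots> \<le> 4 * C\<^sup>2 * W * wt (t a) (t N)"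
      using h l W0 by (intro mult_left_mono wt_mono) (auto simp: t_def)
    also have "\<dots> = (8 * C\<^sup>2 * wt (t a) (t N)) * (W / 2)" by simp
    also have "\<dots> \<le> 1 * (W / 2)" using small W0 by (intro mult_right_mono) auto
    finally show ?thesis by simp
  qed
  then have "W \<le> norm (y a - y' a) + \<eta> + W / 2"
    using l norm_triangle_sub[of "y l - y' l" "y a - y' a"] by linarith
  then show ?thesis using W[OF aN order.refl] by simp
qed

end

section \<open>Dyadic grids, and the passage from short blocks to the whole horizon\<close>

lemma small_dyadic_scale:
  fixes \<beta> c \<tau> :: real
  assumes "0 < \<beta>" "0 \<le> c" "0 < \<tau>"
  shows "\<exists>p::nat. 1 / 2 ^ p \<le> \<tau> \<and> (\<forall>r. 0 \<le> r \<longrightarrow> r \<le> 1 / 2 ^ p \<longrightarrow> c * r powr \<beta> \<le> 1)"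
proof -
  \<comment> \<open>With \<open>c + 1\<close> in place of \<open>c\<close> the quotient is defined
    for \<open>c = 0\<close> as well.\<close>
  define \<delta> where "\<delta> = min \<tau> ((1 / (c + 1)) powr (1 / \<beta>))"
  have "0 < \<delta>" using assms by (simp add: \<delta>_def)
  then obtain p :: nat where p: "(1/2) ^ p < \<delta>"
    using real_arch_pow_inv[of \<delta> "1/2"] by auto
  have "c * r powr \<beta> \<le> 1" if "0 \<le> r" "r \<le> 1 / 2 ^ p" for r
  proof -
    have "r \<le> (1 / (c + 1)) powr (1 / \<beta>)"
      using that p by (simp add: \<delta>_def power_one_over)
    then have "r powr \<beta> \<le> ((1 / (c + 1)) powr (1 / \<beta>)) powr \<beta>"
      using that assms by (intro powr_mono2) auto
    also have "\<dots> = 1 / (c + 1)"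
      using assms by (simp add: powr_powr)
    finally have "c * r powr \<beta> \<le> c * (1 / (c + 1))"
      using assms by (intro mult_left_mono) auto
    also have "\<dots> \<le> 1" using assms by (simp add: divide_simps)
    finally show ?thesis .
  qed
  then show ?thesis using p by (intro exI[of _ p]) (auto simp: \<delta>_def power_one_over)
qed

definition dyadic_floor :: "nat \<Rightarrow> real \<Rightarrow> real"
  where "dyadic_floor n t = \<lfloor>t * 2 ^ n\<rfloor> / 2 ^ n"

lemma dyadic_floor_le: "dyadic_floor n t \<le> t"
  by (simp add: dyadic_floor_def divide_simps)

lemma dyadic_floor_gt: "t - 1 / 2 ^ n < dyadic_floor n t"
proof -
  have "t * 2 ^ n - 1 < real_of_int \<lfloor>t * 2 ^ n\<rfloor>" by linarith
  then have "(t * 2 ^ n - 1) / 2 ^ n < real_of_int \<lfloor>t * 2 ^ n\<rfloor> / 2 ^ n"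
    by (intro divide_strict_right_mono) auto
  then show ?thesis by (simp add: dyadic_floor_def diff_divide_distrib)
qed

lemma dyadic_floor_nonneg: "0 \<le> t \<Longrightarrow> 0 \<le> dyadic_floor n t"
  by (simp add: dyadic_floor_def)

lemma dyadic_floor_eq: "0 \<le> t \<Longrightarrow> dyadic_floor n t = real (nat \<lfloor>t * 2 ^ n\<rfloor>) / 2 ^ n"
  by (simp add: dyadic_floor_def)

lemma tendsto_dyadic_floor: "(\<lambda>n. dyadic_floor n t) \<longlonglongrightarrow> t"
proof (rule tendsto_sandwich)
  show "\<forall>\<^sub>F n in sequentially. t - (1/2) ^ n \<le> dyadic_floor n t"
    using dyadic_floor_gt[of t] by (auto simp: power_one_over intro!: always_eventually less_imp_le)
  show "\<forall>\<^sub>F n in sequentially. dyadic_floor n t \<le> t"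
    by (simp add: dyadic_floor_le)
  have "(\<lambda>n. t - (1/2) ^ n) \<longlonglongrightarrow> t - 0"
    by (intro tendsto_intros LIMSEQ_power_zero) auto
  then show "(\<lambda>n. t - (1/2) ^ n) \<longlonglongrightarrow> t" by simp
qed simp

lemma dyadic_floor_Suc_ge: "dyadic_floor n t \<le> dyadic_floor (Suc n) t"
proof -
  have "2 * \<lfloor>t * 2 ^ n\<rfloor> \<le> \<lfloor>t * 2 ^ Suc n\<rfloor>"
    by (simp add: le_floor_iff mult.assoc[symmetric])
  then have "real_of_int (2 * \<lfloor>t * 2 ^ n\<rfloor>) / 2 ^ Suc n \<le> real_of_int \<lfloor>t * 2 ^ Suc n\<rfloor> / 2 ^ Suc n"
    by (intro divide_right_mono of_int_le_iff[THEN iffD2]) simp_all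
  then show ?thesis by (simp add: dyadic_floor_def)
qed

context rough_rde
begin

definition grid :: "nat \<Rightarrow> real set"
  where "grid n = {real k / 2 ^ n | k. real k / 2 ^ n \<le> T}"

text \<open>The set of times is a parameter so that the same notion covers schemes on their grids
  and paths on \<open>{0..T}\<close>, which restrict to every grid. The bound on the path belongs to
  it because the drift, and with it the increments, grows with the path.\<close>

definition davie :: "real \<Rightarrow> real \<Rightarrow> real set \<Rightarrow> (real \<Rightarrow> 'e) \<Rightarrow> bool"
  where "davie K \<tau> S y \<longleftrightarrow> (\<forall>s\<in>S. norm (y s) \<le> K) \<and>
    (\<forall>s\<in>S. \<forall>t\<in>S. s < t \<and> t - s \<le> \<tau> \<longrightarrow>
      norm (y t - step s t (y s)) \<le> K * (t - s) powr (3 * \<beta>))"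

lemma davie_mono:
  assumes "davie K \<tau> S y" "K \<le> K'" "\<tau>' \<le> \<tau>" "S' \<subseteq> S"
  shows "davie K' \<tau>' S' y"
  unfolding davie_def
proof (intro conjI ballI impI)
  fix s assume "s \<in> S'"
  then show "norm (y s) \<le> K'" using assms unfolding davie_def by force
next
  fix s t assume "s \<in> S'" "t \<in> S'" "s < t \<and> t - s \<le> \<tau>'"
  then have "norm (y t - step s t (y s)) \<le> K * (t - s) powr (3 * \<beta>)"
    using assms(1,3,4) unfolding davie_def by (meson order.trans subsetD)
  also have "\<dots> \<le> K' * (t - s) powr (3 * \<beta>)"
    using assms by (intro mult_right_mono) auto
  finally show "norm (y t - step s t (y s)) \<le> K' * (t - s) powr (3 * \<beta>)" .
qed

lemma grid_sub: "grid n \<subseteq> {0..T}"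
  by (auto simp: grid_def)

lemma grid_Suc: "grid n \<subseteq> grid (Suc n)"
proof
  fix t assume "t \<in> grid n"
  then obtain k where "t = real k / 2 ^ n" "t \<le> T" by (auto simp: grid_def)
  then show "t \<in> grid (Suc n)"
    by (auto simp: grid_def intro!: exI[of _ "2 * k"])
qed

lemma dyadic_floor_in_grid: "0 \<le> t \<Longrightarrow> t \<le> T \<Longrightarrow> dyadic_floor n t \<in> grid n"
  using dyadic_floor_le[of n t] unfolding grid_def
  by (intro CollectI exI[of _ "nat \<lfloor>t * 2 ^ n\<rfloor>"]) (simp add: dyadic_floor_def)

lemma euler_path_grid: "euler_path n x (real k / 2 ^ n) = euler n x k"
  by (simp add: euler_path_def)

lemma euler_path_dyadic_floor: "0 \<le> t \<Longrightarrow> euler_path n x (dyadic_floor n t) = euler_path n x t"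
  by (simp add: dyadic_floor_eq euler_path_grid) (simp add: euler_path_def)

definition K_inc :: "real \<Rightarrow> real"
  where "K_inc K = C * (1 + K) + 2 * C\<^sup>2 + K"

text \<open>Once the path is bounded, every term of \<open>step\<close> beyond the \<open>g\<close>
  term is of second order at least, so a Davie path is controlled by \<open>X\<close>.\<close>

lemma davie_increments:
  assumes d: "davie K \<tau> S y" and S: "S \<subseteq> {0..T}" and st: "s \<in> S" "t \<in> S" "s < t"
    and \<tau>: "t - s \<le> \<tau>" "t - s \<le> 1"
  shows "norm (y t - y s) \<le> K_inc K * wt s t"
    and "norm (y t - y s - g (y s) (X t - X s)) \<le> K_inc K * (wt s t)\<^sup>2"
proof -
  let ?w = "wt s t"
  have t: "0 \<le> s" "t \<le> T" using S st by auto
  have K: "norm (y s) \<le> K" using d st by (simp add: davie_def)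
  then have K0: "0 \<le> K" using norm_ge_zero order.trans by blast
  have w1: "?w \<le> 1" using st \<tau> by (intro wt_le_1) auto
  have w2: "?w\<^sup>2 \<le> ?w" using w1 by (simp add: power2_eq_square mult_left_le)
  have "norm (y t - step s t (y s)) \<le> K * ?w ^ 3"
    using d st \<tau> by (simp add: davie_def wt_cube)
  also have "\<dots> \<le> K * ?w\<^sup>2"
    using K0 w1 by (intro mult_left_mono power_decreasing) auto
  finally have 1: "norm (y t - step s t (y s)) \<le> K * ?w\<^sup>2" .
  have "norm (b (y s)) \<le> C * (1 + K)"
    using order.trans[OF b_growth[of "y s"] mult_left_mono[of _ _ C]] K C by simp
  then have "norm ((t - s) *\<^sub>R b (y s)) \<le> ?w\<^sup>2 * (C * (1 + K))"
    using le_wt_square[of s t] st \<tau> by (simp add: mult_mono)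
  moreover have "norm (F (y s) (X2 s t)) \<le> C * (C * ?w\<^sup>2)"
    using t st by (intro blinfun_le F_bound X2_wt) auto
  moreover have "y t - y s - g (y s) (X t - X s)
      = (t - s) *\<^sub>R b (y s) + F (y s) (X2 s t) + (y t - step s t (y s))"
    by (simp add: step_def germ_def)
  ultimately have "norm (y t - y s - g (y s) (X t - X s)) \<le> ?w\<^sup>2 * (C * (1 + K)) + C * (C * ?w\<^sup>2) + K * ?w\<^sup>2"
    using 1 by (metis norm_triangle_mono)
  then have 2: "norm (y t - y s - g (y s) (X t - X s)) \<le> (C * (1 + K) + C\<^sup>2 + K) * ?w\<^sup>2"
    by (simp add: algebra_simps power2_eq_square)
  also have "\<dots> \<le> K_inc K * ?w\<^sup>2"
    by (intro mult_right_mono) (auto simp: K_inc_def)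
  finally show "norm (y t - y s - g (y s) (X t - X s)) \<le> K_inc K * ?w\<^sup>2" .
  have "norm (g (y s) (X t - X s)) \<le> C * (C * ?w)"
    using t st by (intro blinfun_le g_bound X_wt) auto
  then have "norm (y t - y s) \<le> (C * (1 + K) + C\<^sup>2 + K) * ?w\<^sup>2 + C * (C * ?w)"
    using 2 norm_triangle_sub[of "y t - y s" "g (y s) (X t - X s)"] by linarith
  also have "\<dots> \<le> (C * (1 + K) + C\<^sup>2 + K) * ?w + C * (C * ?w)"
    using w2 K0 C by (intro add_right_mono mult_left_mono) auto
  also have "\<dots> = K_inc K * ?w" by (simp add: K_inc_def algebra_simps power2_eq_square)
  finally show "norm (y t - y s) \<le> K_inc K * ?w" .
qed

text \<open>The number of blocks depends on \<open>T\<close> and \<open>p\<close> alone, which makes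
  doubling over all blocks uniform in the level \<open>n\<close>. The scale is a power of two so
  that a block consists of \<open>2 ^ (n - p)\<close> whole cells.\<close>

lemma block_count:
  assumes "p \<le> n" "real k / 2 ^ n \<le> T"
  shows "k \<le> nat \<lceil>T * 2 ^ p\<rceil> * 2 ^ (n - p)"
proof -
  have "(2::real) ^ n = 2 ^ p * 2 ^ (n - p)" using assms by (simp flip: power_add)
  then have "real k \<le> (T * 2 ^ p) * 2 ^ (n - p)" using assms by (simp add: field_simps)
  also have "\<dots> \<le> real (nat \<lceil>T * 2 ^ p\<rceil>) * 2 ^ (n - p)"
    by (intro mult_right_mono) (auto simp: real_nat_ceiling_ge)
  also have "\<dots> = real (nat \<lceil>T * 2 ^ p\<rceil> * 2 ^ (n - p))" by simp
  finally show ?thesis by (simp only: of_nat_le_iff)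
qed

lemma block_length:
  assumes "p \<le> n" "j \<le> a + 2 ^ (n - p)"
  shows "real j * (1 / 2 ^ n) - real a * (1 / 2 ^ n) \<le> 1 / 2 ^ p"
proof -
  have n: "(2::real) ^ n = 2 ^ p * 2 ^ (n - p)" using assms by (simp flip: power_add)
  have "real j \<le> real (a + 2 ^ (n - p))" using assms(2) by (simp only: of_nat_le_iff)
  then have "real j \<le> real a + 2 ^ (n - p)" by simp
  then have "(real j - real a) * (1 / 2 ^ n) \<le> 2 ^ (n - p) * (1 / 2 ^ n)"
    by (intro mult_right_mono) auto
  also have "\<dots> = 1 / 2 ^ p" by (simp add: n)
  finally show ?thesis by (simp add: diff_divide_distrib)
qed

text \<open>Doubling over all blocks gives the level-independent bound \<open>G\<close> first. After
  that every interval of length at most \<open>1 / 2 ^ p\<close> between grid points is taken as a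
  block of its own, with \<open>G\<close> as the bound on the path.\<close>

lemma euler_davie:
  "\<exists>K p. 0 \<le> K \<and> (\<forall>n\<ge>p. davie K (1 / 2 ^ p) (grid n) (euler_path n x))"
proof -
  obtain p :: nat where p: "\<And>r. 0 \<le> r \<Longrightarrow> r \<le> 1 / 2 ^ p \<Longrightarrow> (K_euler + 8 * C\<^sup>2) * r powr \<beta> \<le> 1"
    using small_dyadic_scale[of \<beta> "K_euler + 8 * C\<^sup>2" 1] \<beta> K_euler_nonneg by auto
  have small: "K_euler * wt s t \<le> 1" "8 * C\<^sup>2 * wt s t \<le> 1" if "s \<le> t" "t - s \<le> 1 / 2 ^ p" for s t
  proof -
    have "(K_euler + 8 * C\<^sup>2) * wt s t \<le> 1" using p[of "t - s"] that by (simp add: wt_def)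
    moreover have "0 \<le> K_euler * wt s t" "0 \<le> 8 * C\<^sup>2 * wt s t" using K_euler_nonneg by auto
    ultimately have "K_euler * wt s t \<le> 1 \<and> 8 * C\<^sup>2 * wt s t \<le> 1"
      unfolding distrib_right by linarith
    then show "K_euler * wt s t \<le> 1" "8 * C\<^sup>2 * wt s t \<le> 1" by auto
  qed
  have p1: "1 / 2 ^ p \<le> (1::real)" by simp
  define r where "r = nat \<lceil>T * 2 ^ p\<rceil>"
  define G where "G = 2 ^ r * (1 + norm x)"
  have bound: "1 + norm (euler n x k) \<le> G" if n: "p \<le> n" and k: "real k / 2 ^ n \<le> T" for n k
  proof -
    have "1 + norm (euler n x k) \<le> 2 ^ r * (1 + norm (euler n x 0))"
    proof (rule doubling_blocks[where q = "2 ^ (n - p)" and N = k])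
      fix a j assume j: "a \<le> j" "j \<le> a + 2 ^ (n - p)" "j \<le> k"
      have len: "real j * (1 / 2 ^ n) - real a * (1 / 2 ^ n) \<le> 1 / 2 ^ p"
        by (rule block_length[OF n j(2)])
      have aj: "real a * (1 / 2 ^ n) \<le> real j * (1 / 2 ^ n)"
        using j by (intro mult_right_mono) auto
      have "real j / 2 ^ n \<le> real k / 2 ^ n" using j by (intro divide_right_mono) auto
      then have jT: "real j * (1 / 2 ^ n) \<le> T" using k by simp
      show "1 + norm (euler n x j) \<le> 2 * (1 + norm (euler n x a))"
        using order.trans[OF len p1] jT small[OF aj len] j
        by (intro euler_block_doubling[where h = "1 / 2 ^ n"]) auto
    qed (use block_count[OF n k] in \<open>auto simp: r_def\<close>)
    then show ?thesis by (simp add: G_def)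
  qed
  define K where "K = G + (K_euler + 4 * C ^ 3) * G"
  have G: "1 \<le> G" using mult_mono[of 1 "2 ^ r" 1 "1 + norm x"] by (simp add: G_def)
  have KG: "0 \<le> (K_euler + 4 * C ^ 3) * G" using G K_euler_nonneg C by simp
  have "davie K (1 / 2 ^ p) (grid n) (euler_path n x)" if n: "p \<le> n" for n
    unfolding davie_def
  proof (intro conjI ballI impI)
    fix s assume "s \<in> grid n"
    then obtain k where k: "s = real k / 2 ^ n" "real k / 2 ^ n \<le> T" by (auto simp: grid_def)
    show "norm (euler_path n x s) \<le> K"
      using bound[OF n k(2)] KG by (simp add: k(1) euler_path_grid K_def)
  next
    fix s t assume s: "s \<in> grid n" and t: "t \<in> grid n" and st: "s < t \<and> t - s \<le> 1 / 2 ^ p"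
    obtain i where i: "s = real i / 2 ^ n" using s by (auto simp: grid_def)
    obtain j where j: "t = real j / 2 ^ n" "real j / 2 ^ n \<le> T" using t by (auto simp: grid_def)
    have ij: "i < j" using st unfolding i j by (simp add: divide_less_cancel)
    have M: "1 + norm (euler n x l) \<le> G" if "l \<le> j" for l
    proof -
      have "real l / 2 ^ n \<le> real j / 2 ^ n" using that by (intro divide_right_mono) auto
      then show ?thesis using j(2) by (intro bound n) auto
    qed
    have len: "real j * (1 / 2 ^ n) - real i * (1 / 2 ^ n) \<le> 1 / 2 ^ p"
      using st by (simp add: i j)
    have "norm (euler n x j - step (real i * (1 / 2 ^ n)) (real j * (1 / 2 ^ n)) (euler n x i))
        \<le> (K_euler + 4 * C ^ 3) * G * (wt (real i * (1 / 2 ^ n)) (real j * (1 / 2 ^ n))) ^ 3"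
      by (rule euler_block_bound(2)[where a = i and N = j])
        (use order.trans[OF len p1] j(2) ij st small(1)[OF _ len] M in \<open>auto simp: i j(1)\<close>)
    also have "\<dots> = (K_euler + 4 * C ^ 3) * G * (t - s) powr (3 * \<beta>)"
      using st by (simp add: i j wt_cube divide_strict_right_mono ij)
    also have "\<dots> \<le> K * (t - s) powr (3 * \<beta>)"
      using G by (intro mult_right_mono) (auto simp: K_def)
    finally show "norm (euler_path n x t - step s t (euler_path n x s)) \<le> K * (t - s) powr (3 * \<beta>)"
      by (simp add: i j euler_path_grid)
  qed
  moreover have "0 \<le> K" using G KG by (simp add: K_def)
  ultimately show ?thesis by blast
qed

text \<open>A local error of order \<open>h powr (3 * \<beta>)\<close> is \<open>h\<close> times
  \<open>h powr (3 * \<beta> - 1)\<close>. Two such errors give \<open>\<eta>\<close>, and as the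
  initial distance vanishes, the \<open>r\<close> doublings act on \<open>\<eta>\<close> alone. The
  constants are uniform over levels and over all pairs of Davie paths, which serves convergence and
  uniqueness alike.\<close>

lemma two_point_global:
  assumes K: "0 \<le> K" and \<tau>: "0 < \<tau>"
  shows "\<exists>L p. 0 \<le> L \<and> (\<forall>n\<ge>p. \<forall>y y'. davie K \<tau> (grid n) y \<longrightarrow> davie K \<tau> (grid n) y' \<longrightarrow> y 0 = y' 0
    \<longrightarrow> (\<forall>t\<in>grid n. norm (y t - y' t) \<le> L * (1 / 2 ^ n) powr (3 * \<beta> - 1)))"
proof -
  define P where "P = K_inc K"
  have P: "0 \<le> P" using K C by (simp add: P_def K_inc_def)
  obtain p :: nat where p: "1 / 2 ^ p \<le> min \<tau> 1"
    "\<And>r. 0 \<le> r \<Longrightarrow> r \<le> 1 / 2 ^ p \<Longrightarrow> (K_two P + 8 * C\<^sup>2) * r powr \<beta> \<le> 1"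
    using small_dyadic_scale[of \<beta> "K_two P + 8 * C\<^sup>2" "min \<tau> 1"] \<beta> K_two_nonneg[OF P] \<tau> by auto
  have small: "K_two P * wt s t \<le> 1" "8 * C\<^sup>2 * wt s t \<le> 1" if "s \<le> t" "t - s \<le> 1 / 2 ^ p" for s t
  proof -
    have "(K_two P + 8 * C\<^sup>2) * wt s t \<le> 1" using p(2)[of "t - s"] that by (simp add: wt_def)
    moreover have "0 \<le> K_two P * wt s t" "0 \<le> 8 * C\<^sup>2 * wt s t" using K_two_nonneg[OF P] by auto
    ultimately have "K_two P * wt s t \<le> 1 \<and> 8 * C\<^sup>2 * wt s t \<le> 1"
      unfolding distrib_right by linarith
    then show "K_two P * wt s t \<le> 1" "8 * C\<^sup>2 * wt s t \<le> 1" by auto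
  qed
  define r where "r = nat \<lceil>T * 2 ^ p\<rceil>"
  define L where "L = 2 ^ r * (2 * K)"
  have "norm (y t - y' t) \<le> L * (1 / 2 ^ n) powr (3 * \<beta> - 1)"
    if n: "p \<le> n" and y: "davie K \<tau> (grid n) y" and y': "davie K \<tau> (grid n) y'"
      and 0: "y 0 = y' 0" and t: "t \<in> grid n" for n y y' t
  proof -
    obtain k where k: "t = real k / 2 ^ n" "real k / 2 ^ n \<le> T" using t by (auto simp: grid_def)
    define h :: real where "h = 1 / 2 ^ n"
    have h: "0 < h" by (simp add: h_def)
    define \<eta> where "\<eta> = 2 * K * h powr (3 * \<beta> - 1)"
    have \<eta>: "0 \<le> \<eta>" using K by (simp add: \<eta>_def)
    have h\<tau>: "h \<le> \<tau>"
    proof -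
      have "h \<le> 1 / 2 ^ p" using n by (simp add: h_def frac_le)
      then show ?thesis using p(1) by simp
    qed
    have in_grid: "real j * h \<in> grid n" if "j \<le> k" for j
    proof -
      have "real j / 2 ^ n \<le> real k / 2 ^ n" using that by (intro divide_right_mono) auto
      then show ?thesis using k(2) by (auto simp: grid_def h_def)
    qed
    have inc: "norm (y (real j * h) - y (real i * h)) \<le> P * wt (real i * h) (real j * h)"
        "norm (y' (real j * h) - y' (real i * h)) \<le> P * wt (real i * h) (real j * h)"
        "norm (y' (real j * h) - y' (real i * h) - g (y' (real i * h)) (X (real j * h) - X (real i * h)))
          \<le> P * (wt (real i * h) (real j * h))\<^sup>2"
      if "i < j" "j \<le> k" "real j * h - real i * h \<le> 1 / 2 ^ p" for i j
    proof -
      have 1: "real i * h \<in> grid n" "real j * h \<in> grid n" "real i * h < real j * h"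
        using that h by (auto intro: in_grid)
      have 2: "real j * h - real i * h \<le> \<tau>" "real j * h - real i * h \<le> 1"
        using order.trans[OF that(3), of \<tau>] order.trans[OF that(3), of 1] p(1) by auto
      show "norm (y (real j * h) - y (real i * h)) \<le> P * wt (real i * h) (real j * h)"
        "norm (y' (real j * h) - y' (real i * h)) \<le> P * wt (real i * h) (real j * h)"
        "norm (y' (real j * h) - y' (real i * h) - g (y' (real i * h)) (X (real j * h) - X (real i * h)))
          \<le> P * (wt (real i * h) (real j * h))\<^sup>2"
        unfolding P_def using davie_increments[OF y grid_sub 1 2] davie_increments[OF y' grid_sub 1 2]
        by auto
    qed
    have e: "norm (u (real (Suc l) * h) - step (real l * h) (real (Suc l) * h) (u (real l * h)))
        \<le> K * h powr (3 * \<beta> - 1) * h"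
      if "davie K \<tau> (grid n) u" "l < k" for u l
    proof -
      have "norm (u (real (Suc l) * h) - step (real l * h) (real (Suc l) * h) (u (real l * h)))
        \<le> K * (real (Suc l) * h - real l * h) powr (3 * \<beta>)"
      proof (rule that(1)[unfolded davie_def, THEN conjunct2, rule_format])
        show "real l * h \<in> grid n" "real (Suc l) * h \<in> grid n" using that(2) by (auto intro!: in_grid simp del: of_nat_Suc)
        show "real l * h < real (Suc l) * h \<and> real (Suc l) * h - real l * h \<le> \<tau>"
          using h h\<tau> by (simp add: algebra_simps)
      qed
      also have "real (Suc l) * h - real l * h = h" by (simp add: algebra_simps)
      also have "K * h powr (3 * \<beta>) = K * h powr (3 * \<beta> - 1) * h"
        using h by (simp add: powr_diff)
      finally show ?thesis .
    qed
    have "norm (y (real k * h) - y' (real k * h)) + \<eta>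
        \<le> 2 ^ r * (norm (y (real 0 * h) - y' (real 0 * h)) + \<eta>)"
    proof (rule doubling_blocks[where q = "2 ^ (n - p)" and N = k])
      fix a j assume j: "a \<le> j" "j \<le> a + 2 ^ (n - p)" "j \<le> k"
      have len: "real j * h - real a * h \<le> 1 / 2 ^ p"
        unfolding h_def by (rule block_length[OF n j(2)])
      have aj: "real a * h \<le> real j * h" using j h by (intro mult_right_mono) auto
      have len': "real j' * h - real i' * h \<le> 1 / 2 ^ p" if "a \<le> i'" "j' \<le> j" for i' j'
      proof -
        have "real j' * h \<le> real j * h" "real a * h \<le> real i' * h"
          using that h by (auto intro!: mult_right_mono)
        then show ?thesis using len by linarith
      qed
      show "norm (y (real j * h) - y' (real j * h)) + \<eta>
          \<le> 2 * (norm (y (real a * h) - y' (real a * h)) + \<eta>)"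
      proof (rule two_point_block_doubling[where P = P and h = h])
        show "real j * h \<le> T" using in_grid[OF j(3)] by (auto simp: grid_def)
        show "real j * h - real a * h \<le> 1" using len p(1) by linarith
        show "K_two P * wt (real a * h) (real j * h) \<le> 1" "8 * C\<^sup>2 * wt (real a * h) (real j * h) \<le> 1"
          using small[OF aj len] by auto
        fix l assume l: "a \<le> l" "l < j"
        have "l < k" using l j by simp
        then show "norm ((y (real (Suc l) * h) - step (real l * h) (real (Suc l) * h) (y (real l * h)))
           - (y' (real (Suc l) * h) - step (real l * h) (real (Suc l) * h) (y' (real l * h)))) \<le> \<eta> * h"
          using norm_triangle_le_diff[OF add_mono[OF e[OF y, of l] e[OF y', of l]]]
          by (simp add: \<eta>_def algebra_simps)
      qed (use h P \<eta> j inc len' in auto)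
    qed (use block_count[OF n k(2)] \<eta> in \<open>auto simp: r_def\<close>)
    then have "norm (y (real k * h) - y' (real k * h)) \<le> 2 ^ r * \<eta>" using 0 \<eta> by simp
    then show ?thesis by (simp add: k(1) h_def \<eta>_def L_def mult.assoc)
  qed
  moreover have "0 \<le> L" using K by (simp add: L_def)
  ultimately show ?thesis by blast
qed

end

section \<open>Convergence of the schemes and uniqueness of the limit\<close>

lemma dyadic_powr: "(1 / 2 ^ n :: real) powr a = ((1/2) powr a) ^ n"
proof (induction n)
  case (Suc n)
  have "(1 / 2 ^ Suc n :: real) powr a = ((1/2) * (1 / 2 ^ n)) powr a" by simp
  also have "\<dots> = (1/2) powr a * (1 / 2 ^ n) powr a" by (rule powr_mult)
  finally show ?case by (simp only: Suc.IH power_Suc)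
qed simp

context rough_rde
begin

lemma tendsto_dyadic_powr: "0 < a \<Longrightarrow> (\<lambda>n. (1 / 2 ^ n) powr a) \<longlonglongrightarrow> (0::real)"
proof -
  assume a: "0 < a"
  have "(\<lambda>n. ((1/2::real) powr a) ^ n) \<longlonglongrightarrow> 0"
    using a powr_less_mono'[of "1/2::real" 0 a] by (intro LIMSEQ_power_zero) auto
  then show ?thesis by (simp only: dyadic_powr)
qed

lemma wt_dyadic_floor: "wt (dyadic_floor n t) t \<le> (1 / 2 ^ n) powr \<beta>"
  unfolding wt_def using dyadic_floor_gt[of t n] dyadic_floor_le[of n t] \<beta>
  by (intro powr_mono2) auto

lemma tendsto_wt_dyadic_floor: "(\<lambda>n. wt (dyadic_floor n t) t) \<longlonglongrightarrow> 0"
proof (rule tendsto_sandwich[OF _ _ tendsto_const tendsto_dyadic_powr])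
  show "\<forall>\<^sub>F n in sequentially. wt (dyadic_floor n t) t \<le> (1 / 2 ^ n) powr \<beta>"
    by (simp add: wt_dyadic_floor)
  show "0 < \<beta>" using \<beta> by simp
qed simp

text \<open>The finer scheme is again a Davie path on the coarser grid, so consecutive schemes
  differ there by a multiple of \<open>\<rho> ^ n\<close>. Moving from the coarse to the fine dyadic
  floor of \<open>t\<close> costs a multiple of \<open>(1 / 2 ^ n) powr \<beta>\<close>, which is no
  larger than \<open>\<rho> ^ n\<close> because \<open>3 * \<beta> - 1 \<le> \<beta>\<close>. The
  differences are therefore dominated by a geometric series.\<close>

lemma euler_path_convergent:
  assumes t: "0 \<le> t" "t \<le> T"
  shows "convergent (\<lambda>n. euler_path n x t)"
proof -
  obtain K p where K: "0 \<le> K" and d: "\<And>n. n \<ge> p \<Longrightarrow> davie K (1 / 2 ^ p) (grid n) (euler_path n x)"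
    using euler_davie by blast
  have "0 < (1::real) / 2 ^ p" by simp
  from two_point_global[OF K this] obtain L q
    where L: "0 \<le> L" and two: "\<And>n y y' t. n \<ge> q \<Longrightarrow> davie K (1 / 2 ^ p) (grid n) y \<Longrightarrow>
      davie K (1 / 2 ^ p) (grid n) y' \<Longrightarrow> y 0 = y' 0 \<Longrightarrow> t \<in> grid n \<Longrightarrow>
      norm (y t - y' t) \<le> L * (1 / 2 ^ n) powr (3 * \<beta> - 1)"
    by metis
  define P where "P = K_inc K"
  have P: "0 \<le> P" using K C by (simp add: P_def K_inc_def)
  define \<rho> :: real where "\<rho> = (1/2) powr (3 * \<beta> - 1)"
  have \<rho>: "0 \<le> \<rho>" "\<rho> < 1"
    using \<beta> powr_less_mono'[of "1/2::real" 0 "3 * \<beta> - 1"] by (auto simp: \<rho>_def)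
  have pow: "(1 / 2 ^ n :: real) powr (3 * \<beta> - 1) = \<rho> ^ n" for n
    unfolding \<rho>_def by (rule dyadic_powr)
  have "norm (euler_path (Suc n) x t - euler_path n x t) \<le> (L + P) * \<rho> ^ n"
    if n: "p \<le> n" "q \<le> n" for n
  proof -
    let ?s = "dyadic_floor n t" and ?s' = "dyadic_floor (Suc n) t"
    have s: "?s \<in> grid n" "?s \<in> grid (Suc n)" "?s' \<in> grid (Suc n)"
      using dyadic_floor_in_grid[OF t] grid_Suc[of n] by auto
    have ss: "?s \<le> ?s'" "?s' - ?s \<le> 1 / 2 ^ n"
      using dyadic_floor_Suc_ge[of n t] dyadic_floor_gt[of t n] dyadic_floor_le[of "Suc n" t] by auto
    have d': "davie K (1 / 2 ^ p) (grid (Suc n)) (euler_path (Suc n) x)" using d n by simp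
    have 1: "norm (euler_path (Suc n) x ?s - euler_path n x ?s) \<le> L * \<rho> ^ n"
      using two[OF n(2) davie_mono[OF d' order.refl order.refl grid_Suc] d[OF n(1)] _ s(1)]
      by (simp add: pow euler_path_def)
    have "norm (euler_path (Suc n) x ?s' - euler_path (Suc n) x ?s) \<le> P * \<rho> ^ n"
    proof (cases "?s = ?s'")
      case True
      then show ?thesis using P \<rho> by simp
    next
      case False
      have n1: "1 / 2 ^ n \<le> 1 / (2::real) ^ p" "1 / 2 ^ n \<le> (1::real)"
        using n by (auto simp: frac_le)
      have "norm (euler_path (Suc n) x ?s' - euler_path (Suc n) x ?s) \<le> P * wt ?s ?s'"
        unfolding P_def using ss False n1
        by (intro davie_increments(1)[OF d' grid_sub s(2,3)]) linarith+
      also have "wt ?s ?s' \<le> (1 / 2 ^ n) powr \<beta>"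
        unfolding wt_def using ss \<beta> by (intro powr_mono2) auto
      also have "\<dots> \<le> (1 / 2 ^ n) powr (3 * \<beta> - 1)"
        using \<beta> n1 by (intro powr_mono') auto
      finally show ?thesis using P by (simp add: pow mult_left_mono)
    qed
    with 1 have "norm ((euler_path (Suc n) x ?s' - euler_path (Suc n) x ?s)
        + (euler_path (Suc n) x ?s - euler_path n x ?s)) \<le> P * \<rho> ^ n + L * \<rho> ^ n"
      by (intro norm_triangle_mono)
    then show ?thesis using t(1) by (simp add: euler_path_dyadic_floor algebra_simps)
  qed
  then have "\<forall>\<^sub>F n in sequentially. norm (euler_path (Suc n) x t - euler_path n x t) \<le> (L + P) * \<rho> ^ n"
    using eventually_ge_at_top[of "max p q"] by (auto elim: eventually_mono)
  moreover have "summable (\<lambda>n. (L + P) * \<rho> ^ n)"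
    using \<rho> by (intro summable_mult summable_geometric) auto
  ultimately have "summable (\<lambda>n. euler_path (Suc n) x t - euler_path n x t)"
    by (rule summable_comparison_test_ev)
  then have "convergent (\<lambda>n. \<Sum>k<n. euler_path (Suc k) x t - euler_path k x t)"
    by (simp add: summable_iff_convergent)
  then have "convergent (\<lambda>n. (euler_path n x t - euler_path 0 x t) + euler_path 0 x t)"
    unfolding sum_lessThan_telescope[of "\<lambda>n. euler_path n x t"]
    by (intro convergent_add convergent_const)
  then show ?thesis by simp
qed

lemma tendsto_flow:
  assumes "0 \<le> t" "t \<le> T"
  shows "(\<lambda>n. euler_path n x t) \<longlonglongrightarrow> flow t x"
  using euler_path_convergent[OF assms, of x] by (simp add: flow_def convergent_LIMSEQ_iff)

lemma wt_le_T: "0 \<le> s \<Longrightarrow> s \<le> t \<Longrightarrow> t \<le> T \<Longrightarrow> wt s t \<le> wt 0 T"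
  by (rule wt_mono) auto

text \<open>Continuity of the second order term in its end points comes from Chen's relation: moving
  one end point adds a term over the short interval and a mixed term with one factor over
  it.\<close>

lemma second_order_left:
  assumes "0 \<le> s'" "s' \<le> s" "s < t" "t \<le> T"
  shows "norm (F x (X2 s' t) - F x (X2 s t)) \<le> 2 * C ^ 4 * wt 0 T * wt s' s"
proof (cases "s' = s")
  case True
  then show ?thesis using C by simp
next
  case False
  then have *: "0 \<le> s'" "s' < s" "s < t" "t \<le> T" using assms by auto
  have C0: "0 \<le> C" using C by simp
  have 1: "norm (F x (X2 s' s)) \<le> C * (C * (wt s' s)\<^sup>2)"
    using * by (intro blinfun_le F_bound X2_wt) auto
  have 2: "norm (Dg x (g x (X s - X s')) (X t - X s)) \<le> (C * (C * (C * wt s' s))) * (C * wt 0 T)"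
    using * order.trans[OF X_wt[of s t] mult_left_mono[OF wt_le_T C0]]
    by (intro blinfun_le Dg_bound g_bound X_wt) auto
  have "norm (F x (X2 s' t) - F x (X2 s t))
      \<le> C * (C * (wt s' s)\<^sup>2) + (C * (C * (C * wt s' s))) * (C * wt 0 T)"
    unfolding chen[OF *, of x] using norm_triangle_mono[OF 1 2] by simp
  also have "\<dots> \<le> C\<^sup>2 * (wt 0 T * wt s' s) + C ^ 4 * wt 0 T * wt s' s"
    using mult_right_mono[OF wt_le_T[of s' s] wt_nonneg[of s' s]] * C
    by (simp add: power2_eq_square eval_nat_numeral algebra_simps)
  also have "C\<^sup>2 * (wt 0 T * wt s' s) \<le> C ^ 4 * (wt 0 T * wt s' s)"
    using C by (intro mult_right_mono power_increasing) auto
  finally show ?thesis by (simp add: algebra_simps)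
qed

lemma second_order_right:
  assumes "0 \<le> s" "s < t'" "t' \<le> t" "t \<le> T"
  shows "norm (F x (X2 s t) - F x (X2 s t')) \<le> 2 * C ^ 4 * wt 0 T * wt t' t"
proof (cases "t' = t")
  case True
  then show ?thesis using C by simp
next
  case False
  then have *: "0 \<le> s" "s < t'" "t' < t" "t \<le> T" using assms by auto
  have C0: "0 \<le> C" using C by simp
  have 1: "norm (F x (X2 t' t)) \<le> C * (C * (wt t' t)\<^sup>2)"
    using * by (intro blinfun_le F_bound X2_wt) auto
  have 2: "norm (Dg x (g x (X t' - X s)) (X t - X t')) \<le> (C * (C * (C * wt 0 T))) * (C * wt t' t)"
    using * order.trans[OF X_wt[of s t'] mult_left_mono[OF wt_le_T C0]]
    by (intro blinfun_le Dg_bound g_bound X_wt) auto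
  have "norm (F x (X2 s t) - F x (X2 s t'))
      \<le> C * (C * (wt t' t)\<^sup>2) + (C * (C * (C * wt 0 T))) * (C * wt t' t)"
    unfolding chen[OF *, of x] using norm_triangle_mono[OF 1 2] by simp
  also have "\<dots> \<le> C\<^sup>2 * (wt 0 T * wt t' t) + C ^ 4 * wt 0 T * wt t' t"
    using mult_right_mono[OF wt_le_T[of t' t] wt_nonneg[of t' t]] * C
    by (simp add: power2_eq_square eval_nat_numeral algebra_simps)
  also have "C\<^sup>2 * (wt 0 T * wt t' t) \<le> C ^ 4 * (wt 0 T * wt t' t)"
    using C by (intro mult_right_mono power_increasing) auto
  finally show ?thesis by (simp add: algebra_simps)
qed

lemma tendsto_second_order:
  assumes st: "0 \<le> s" "s < t" "t \<le> T"
  shows "(\<lambda>n. F x (X2 (dyadic_floor n s) (dyadic_floor n t))) \<longlonglongrightarrow> F x (X2 s t)"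
proof (rule LIM_zero_cancel, rule Lim_null_comparison)
  let ?c = "2 * C ^ 4 * wt 0 T"
  have "\<forall>\<^sub>F n in sequentially. s < dyadic_floor n t"
    using order_tendstoD(1)[OF tendsto_dyadic_floor st(2)] .
  then show "\<forall>\<^sub>F n in sequentially. norm (F x (X2 (dyadic_floor n s) (dyadic_floor n t)) - F x (X2 s t))
      \<le> ?c * wt (dyadic_floor n s) s + ?c * wt (dyadic_floor n t) t"
  proof eventually_elim
    case (elim n)
    let ?s = "dyadic_floor n s" and ?t = "dyadic_floor n t"
    have "norm (F x (X2 ?s ?t) - F x (X2 s ?t)) \<le> ?c * wt ?s s"
      using elim st dyadic_floor_le[of n s] dyadic_floor_le[of n t] dyadic_floor_nonneg[of s n]
      by (intro second_order_left) auto
    moreover have "norm (F x (X2 s t) - F x (X2 s ?t)) \<le> ?c * wt ?t t"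
      using elim st dyadic_floor_le[of n t] by (intro second_order_right) auto
    ultimately show ?case
      using norm_triangle_ineq4[of "F x (X2 ?s ?t) - F x (X2 s ?t)" "F x (X2 s t) - F x (X2 s ?t)"]
      by simp
  qed
  have "(\<lambda>n. ?c * wt (dyadic_floor n s) s + ?c * wt (dyadic_floor n t) t) \<longlonglongrightarrow> ?c * 0 + ?c * 0"
    by (intro tendsto_intros tendsto_wt_dyadic_floor)
  then show "(\<lambda>n. ?c * wt (dyadic_floor n s) s + ?c * wt (dyadic_floor n t) t) \<longlonglongrightarrow> 0" by simp
qed

lemma tendsto_X_dyadic_floor:
  assumes "0 \<le> t" "t \<le> T"
  shows "(\<lambda>n. X (dyadic_floor n t)) \<longlonglongrightarrow> X t"
proof -
  have "(\<lambda>n. X t - X (dyadic_floor n t)) \<longlonglongrightarrow> 0"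
  proof (rule Lim_null_comparison)
    show "\<forall>\<^sub>F n in sequentially. norm (X t - X (dyadic_floor n t)) \<le> C * wt (dyadic_floor n t) t"
    proof (intro always_eventually allI)
      fix n
      show "norm (X t - X (dyadic_floor n t)) \<le> C * wt (dyadic_floor n t) t"
        using X_wt[of "dyadic_floor n t" t] assms dyadic_floor_le[of n t] dyadic_floor_nonneg[of t n] C
        by (cases "dyadic_floor n t = t") auto
    qed
    show "(\<lambda>n. C * wt (dyadic_floor n t) t) \<longlonglongrightarrow> 0"
      using tendsto_mult_left[OF tendsto_wt_dyadic_floor[of t], of C] by simp
  qed
  from tendsto_diff[OF tendsto_const[of "X t"] this] show ?thesis by simp
qed

lemma tendsto_lipschitz:
  fixes f :: "'e \<Rightarrow> 'y::real_normed_vector"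
  assumes "\<And>x y. norm (f x - f y) \<le> C * norm (x - y)" and "u \<longlonglongrightarrow> l"
  shows "(\<lambda>n. f (u n)) \<longlonglongrightarrow> f l"
proof (rule LIM_zero_cancel, rule Lim_null_comparison)
  show "\<forall>\<^sub>F n in sequentially. norm (f (u n) - f l) \<le> C * norm (u n - l)" using assms(1) by simp
  show "(\<lambda>n. C * norm (u n - l)) \<longlonglongrightarrow> 0"
    using tendsto_mult_left[OF tendsto_norm[OF LIM_zero[OF assms(2)]], of C] by simp
qed

lemma tendsto_step:
  assumes st: "0 \<le> s" "s < t" "t \<le> T" and u: "u \<longlonglongrightarrow> y"
  shows "(\<lambda>n. step (dyadic_floor n s) (dyadic_floor n t) (u n)) \<longlonglongrightarrow> step s t y"
proof -
  have F: "(\<lambda>n. F (u n) (X2 (dyadic_floor n s) (dyadic_floor n t))) \<longlonglongrightarrow> F y (X2 s t)"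
  proof -
    \<comment> \<open>The change of the base point is separated from the change of the times: here a
      null sequence of operators acts on bounded arguments, and afterwards the base point is
      fixed.\<close>
    have "(\<lambda>n. (F (u n) - F y) (X2 (dyadic_floor n s) (dyadic_floor n t))) \<longlonglongrightarrow> 0"
    proof (rule Lim_null_comparison)
      have "\<forall>\<^sub>F n in sequentially. s < dyadic_floor n t"
        using order_tendstoD(1)[OF tendsto_dyadic_floor st(2)] .
      then show "\<forall>\<^sub>F n in sequentially. norm ((F (u n) - F y) (X2 (dyadic_floor n s) (dyadic_floor n t)))
          \<le> norm (F (u n) - F y) * (C * (wt 0 T)\<^sup>2)"
      proof eventually_elim
        case (elim n)
        let ?s = "dyadic_floor n s" and ?t = "dyadic_floor n t"
        have *: "0 \<le> ?s" "?s < ?t" "?t \<le> T"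
          using elim st dyadic_floor_le[of n s] dyadic_floor_le[of n t] dyadic_floor_nonneg[of s n] by auto
        have "norm (X2 ?s ?t) \<le> C * (wt ?s ?t)\<^sup>2" using * by (intro X2_wt)
        also have "\<dots> \<le> C * (wt 0 T)\<^sup>2"
          using * C by (intro mult_left_mono power_mono wt_le_T) auto
        finally show ?case by (intro blinfun_le) auto
      qed
      have "(\<lambda>n. norm (F (u n) - F y) * (C * (wt 0 T)\<^sup>2)) \<longlonglongrightarrow> norm (F y - F y) * (C * (wt 0 T)\<^sup>2)"
        by (intro tendsto_intros tendsto_lipschitz[OF F_lip u])
      then show "(\<lambda>n. norm (F (u n) - F y) * (C * (wt 0 T)\<^sup>2)) \<longlonglongrightarrow> 0" by simp
    qed
    from tendsto_add[OF this tendsto_second_order[OF st, of y]]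
    show ?thesis by (simp add: blinfun.bilinear_simps)
  qed
  show ?thesis
    unfolding step_def germ_def using st
    by (intro tendsto_intros u tendsto_lipschitz[OF b_lip u] F tendsto_dyadic_floor
        bounded_bilinear.tendsto[OF bounded_bilinear_blinfun_apply]
        tendsto_lipschitz[OF g_lip u] tendsto_X_dyadic_floor) auto
qed

text \<open>Real times are replaced by their dyadic floors, where the schemes satisfy the Davie
  bound with a common constant; both sides of the inequality then converge.\<close>

lemma flow_davie:
  "\<exists>K \<tau>. 0 \<le> K \<and> 0 < \<tau> \<and> davie K \<tau> {0..T} (\<lambda>t. flow t x)"
proof -
  obtain K p where K: "0 \<le> K" and d: "\<And>n. n \<ge> p \<Longrightarrow> davie K (1 / 2 ^ p) (grid n) (euler_path n x)"
    using euler_davie by blast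
  \<comment> \<open>Halving the scale leaves room for rounding: times at most
    \<open>1 / 2 ^ Suc p\<close> apart have dyadic floors that are eventually less than
    \<open>1 / 2 ^ p\<close> apart.\<close>
  have "davie K (1 / 2 ^ Suc p) {0..T} (\<lambda>t. flow t x)"
    unfolding davie_def
  proof (intro conjI ballI impI)
    fix t assume t: "t \<in> {0..T}"
    have "\<forall>\<^sub>F n in sequentially. norm (euler_path n x t) \<le> K"
      using eventually_ge_at_top[of p]
    proof eventually_elim
      case (elim n)
      have "norm (euler_path n x (dyadic_floor n t)) \<le> K"
        using d[OF elim] dyadic_floor_in_grid[of t n] t by (auto simp: davie_def)
      then show ?case using t by (simp add: euler_path_dyadic_floor)
    qed
    then show "norm (flow t x) \<le> K"
      using tendsto_upperbound[OF tendsto_norm[OF tendsto_flow]] t by force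
  next
    fix s t assume s: "s \<in> {0..T}" and t: "t \<in> {0..T}" and st: "s < t \<and> t - s \<le> 1 / 2 ^ Suc p"
    have st': "s < t" "t - s < 1 / 2 ^ p"
      using st by (auto intro: le_less_trans[OF _ divide_strict_left_mono])
    have lim: "(\<lambda>n. dyadic_floor n t - dyadic_floor n s) \<longlonglongrightarrow> t - s"
      by (intro tendsto_intros tendsto_dyadic_floor)
    have "\<forall>\<^sub>F n in sequentially. norm (euler_path n x t
          - step (dyadic_floor n s) (dyadic_floor n t) (euler_path n x s))
        \<le> K * (dyadic_floor n t - dyadic_floor n s) powr (3 * \<beta>)"
      using eventually_ge_at_top[of p] order_tendstoD(1)[OF lim diff_gt_0_iff_gt[THEN iffD2, OF st'(1)]]
        order_tendstoD(2)[OF lim st'(2)]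
    proof eventually_elim
      case (elim n)
      have "norm (euler_path n x (dyadic_floor n t)
          - step (dyadic_floor n s) (dyadic_floor n t) (euler_path n x (dyadic_floor n s)))
        \<le> K * (dyadic_floor n t - dyadic_floor n s) powr (3 * \<beta>)"
        using d[of n] elim dyadic_floor_in_grid[of t n] dyadic_floor_in_grid[of s n] s t
        by (auto simp: davie_def)
      then show ?case using s t by (simp add: euler_path_dyadic_floor)
    qed
    moreover have "(\<lambda>n. norm (euler_path n x t
          - step (dyadic_floor n s) (dyadic_floor n t) (euler_path n x s)))
        \<longlonglongrightarrow> norm (flow t x - step s t (flow s x))"
      using s t st' by (intro tendsto_intros tendsto_flow tendsto_step) auto
    moreover have "(\<lambda>n. K * (dyadic_floor n t - dyadic_floor n s) powr (3 * \<beta>))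
        \<longlonglongrightarrow> K * (t - s) powr (3 * \<beta>)"
      using st' by (intro tendsto_intros lim) auto
    ultimately show "norm (flow t x - step s t (flow s x)) \<le> K * (t - s) powr (3 * \<beta>)"
      by (intro tendsto_le[OF sequentially_bot])
  qed
  then show ?thesis using K by (intro exI[of _ K] exI[of _ "1 / 2 ^ Suc p"]) auto
qed

text \<open>On each grid the path and the Euler scheme from the same initial value are Davie paths
  with common constants, so their distance tends to zero with the mesh; continuity of the path
  carries this from the dyadic floors to \<open>t\<close>.\<close>

lemma davie_unique:
  assumes K: "0 \<le> K" and \<tau>: "0 < \<tau>" and y: "davie K \<tau> {0..T} y" and t: "0 \<le> t" "t \<le> T"
  shows "y t = flow t (y 0)"
proof -
  let ?x = "y 0"
  obtain K' p where K': "0 \<le> K'" and d: "\<And>n. n \<ge> p \<Longrightarrow> davie K' (1 / 2 ^ p) (grid n) (euler_path n ?x)"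
    using euler_davie by blast
  define M where "M = max K K'"
  define \<sigma> where "\<sigma> = min \<tau> (1 / 2 ^ p)"
  have M: "0 \<le> M" "0 < \<sigma>" using K \<tau> by (auto simp: M_def \<sigma>_def)
  obtain L q where L: "0 \<le> L" and two: "\<And>n y y' t. n \<ge> q \<Longrightarrow> davie M \<sigma> (grid n) y \<Longrightarrow>
      davie M \<sigma> (grid n) y' \<Longrightarrow> y 0 = y' 0 \<Longrightarrow> t \<in> grid n \<Longrightarrow>
      norm (y t - y' t) \<le> L * (1 / 2 ^ n) powr (3 * \<beta> - 1)"
    using two_point_global[OF M] by metis
  have "\<forall>\<^sub>F n in sequentially. norm (y (dyadic_floor n t) - euler_path n ?x t)
      \<le> L * (1 / 2 ^ n) powr (3 * \<beta> - 1)"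
    using eventually_ge_at_top[of "max p q"]
  proof eventually_elim
    case (elim n)
    have "norm (y (dyadic_floor n t) - euler_path n ?x (dyadic_floor n t))
        \<le> L * (1 / 2 ^ n) powr (3 * \<beta> - 1)"
    proof (rule two)
      show "davie M \<sigma> (grid n) y"
        by (rule davie_mono[OF y _ _ grid_sub]) (auto simp: M_def \<sigma>_def)
      show "davie M \<sigma> (grid n) (euler_path n ?x)"
        by (rule davie_mono[OF d]) (use elim in \<open>auto simp: M_def \<sigma>_def\<close>)
    qed (use elim t dyadic_floor_in_grid in \<open>auto simp: euler_path_def\<close>)
    then show ?case using t by (simp add: euler_path_dyadic_floor)
  qed
  moreover have "(\<lambda>n. L * (1 / 2 ^ n) powr (3 * \<beta> - 1)) \<longlonglongrightarrow> 0"
    using tendsto_mult_left[OF tendsto_dyadic_powr[of "3 * \<beta> - 1"], of L] \<beta> by simp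
  ultimately have 1: "(\<lambda>n. y (dyadic_floor n t) - euler_path n ?x t) \<longlonglongrightarrow> 0"
    by (rule Lim_null_comparison)
  have 2: "(\<lambda>n. y t - y (dyadic_floor n t)) \<longlonglongrightarrow> 0"
  proof (rule Lim_null_comparison)
    have "(\<lambda>n. t - dyadic_floor n t) \<longlonglongrightarrow> t - t"
      by (intro tendsto_intros tendsto_dyadic_floor)
    then have "(\<lambda>n. t - dyadic_floor n t) \<longlonglongrightarrow> 0" by simp
    then have "\<forall>\<^sub>F n in sequentially. t - dyadic_floor n t < min \<tau> 1"
      by (rule order_tendstoD) (use \<tau> in auto)
    then show "\<forall>\<^sub>F n in sequentially. norm (y t - y (dyadic_floor n t)) \<le> K_inc K * wt (dyadic_floor n t) t"
    proof eventually_elim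
      case (elim n)
      have "0 \<le> K_inc K" using K C by (simp add: K_inc_def)
      then show ?case
        using davie_increments(1)[OF y, of "dyadic_floor n t" t] elim t
          dyadic_floor_le[of n t] dyadic_floor_nonneg[of t n]
        by (cases "dyadic_floor n t = t") auto
    qed
    show "(\<lambda>n. K_inc K * wt (dyadic_floor n t) t) \<longlonglongrightarrow> 0"
      using tendsto_mult_left[OF tendsto_wt_dyadic_floor[of t], of "K_inc K"] by simp
  qed
  have "(\<lambda>n. y t - ((y t - y (dyadic_floor n t)) + (y (dyadic_floor n t) - euler_path n ?x t)))
      \<longlonglongrightarrow> y t - (0 + 0)"
    by (intro tendsto_intros 1 2)
  then have "(\<lambda>n. euler_path n ?x t) \<longlonglongrightarrow> y t" by simp
  then show ?thesis using tendsto_flow[OF t, of ?x] LIMSEQ_unique by blast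
qed

end

subsection \<open>Vector fields\<close>

text \<open>A bounded \<open>C^{1,1}\<close> condition expressed by second differences. In this form
  it passes to bilinear products and linear images, and its last clause is the one that
  \<open>rough_field\<close> demands of \<open>F\<close>.\<close>

definition c11 :: "('a::real_normed_vector \<Rightarrow> 'b::real_normed_vector) \<Rightarrow> bool"
  where "c11 f \<longleftrightarrow> (\<exists>c\<ge>0. \<forall>x y v w. norm (f x) \<le> c \<and> norm (f x - f y) \<le> c * norm (x - y) \<and>
    norm ((f (x + v) - f x) - (f (y + w) - f y)) \<le> c * (norm (x - y) * norm v + norm (v - w)))"

lemma lipschitz_of_derivative:
  fixes f :: "'a::real_normed_vector \<Rightarrow> 'b::real_normed_vector"
  assumes "\<And>x. (f has_derivative blinfun_apply (f' x)) (at x)" "\<And>x. norm (f' x) \<le> c"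
  shows "norm (f x - f y) \<le> c * norm (x - y)"
  by (rule differentiable_bound[of UNIV f "\<lambda>x. blinfun_apply (f' x)"])
     (use assms in \<open>auto simp: norm_blinfun.rep_eq[symmetric]\<close>)

lemma c11_of_derivative:
  fixes f :: "'a::real_normed_vector \<Rightarrow> 'b::real_normed_vector"
  assumes f': "\<And>x. (f has_derivative blinfun_apply (f' x)) (at x)"
    and f: "\<And>x. norm (f x) \<le> c" and bound: "\<And>x. norm (f' x) \<le> c"
    and lip: "\<And>x y. norm (f' x - f' y) \<le> c * norm (x - y)"
  shows "c11 f"
  unfolding c11_def
proof (intro exI conjI allI)
  show "0 \<le> c" using bound norm_ge_zero order.trans by blast
  fix x y v w
  show "norm (f x) \<le> c" by (rule f)
  show "norm (f x - f y) \<le> c * norm (x - y)"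
    by (rule lipschitz_of_derivative[OF f' bound])
  \<comment> \<open>For fixed \<open>v\<close> the map \<open>\<lambda>x. f (x + v) - f x\<close>
    has a derivative of size \<open>c * norm v\<close>, which produces the product term; replacing
    \<open>v\<close> by \<open>w\<close> afterwards costs only the Lipschitz constant.\<close>
  have "norm ((\<lambda>x. f (x + v) - f x) x - (\<lambda>x. f (x + v) - f x) y) \<le> (c * norm v) * norm (x - y)"
  proof (rule lipschitz_of_derivative)
    fix z
    have "((\<lambda>x. f (x + v)) has_derivative blinfun_apply (f' (z + v))) (at z)"
      by (rule has_derivative_compose[of "\<lambda>x. x + v" "\<lambda>h. h" z UNIV f, OF _ f'])
         (auto intro!: derivative_eq_intros)
    then show "((\<lambda>x. f (x + v) - f x) has_derivative blinfun_apply (f' (z + v) - f' z)) (at z)"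
      unfolding blinfun.diff_left using f' by (intro has_derivative_diff)
    show "norm (f' (z + v) - f' z) \<le> c * norm v" using lip[of "z + v" z] by simp
  qed
  moreover have "norm (f (y + v) - f (y + w)) \<le> c * norm (v - w)"
    using lipschitz_of_derivative[OF f' bound, of "y + v" "y + w"] by simp
  moreover have "(f (x + v) - f x) - (f (y + w) - f y)
      = ((f (x + v) - f x) - (f (y + v) - f y)) + (f (y + v) - f (y + w))" by simp
  ultimately have "norm ((f (x + v) - f x) - (f (y + w) - f y))
      \<le> (c * norm v) * norm (x - y) + c * norm (v - w)"
    using norm_triangle_mono by (metis (no_types, lifting))
  then show "norm ((f (x + v) - f x) - (f (y + w) - f y)) \<le> c * (norm (x - y) * norm v + norm (v - w))"
    by (simp add: algebra_simps)
qed

lemma c11_bilinear: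
  assumes B: "bounded_bilinear B" and f: "c11 f" and h: "c11 h"
  shows "c11 (\<lambda>x. B (f x) (h x))"
proof -
  interpret B: bounded_bilinear B by (rule B)
  obtain k where k: "0 < k" "\<And>a b. norm (B a b) \<le> norm a * norm b * k"
    using B.pos_bounded by blast
  obtain c1 where c1: "0 \<le> c1" "\<And>x. norm (f x) \<le> c1" "\<And>x y. norm (f x - f y) \<le> c1 * norm (x - y)"
    "\<And>x y v w. norm ((f (x + v) - f x) - (f (y + w) - f y)) \<le> c1 * (norm (x - y) * norm v + norm (v - w))"
    using f unfolding c11_def by blast
  obtain c2 where c2: "0 \<le> c2" "\<And>x. norm (h x) \<le> c2" "\<And>x y. norm (h x - h y) \<le> c2 * norm (x - y)"
    "\<And>x y v w. norm ((h (x + v) - h x) - (h (y + w) - h y)) \<le> c2 * (norm (x - y) * norm v + norm (v - w))"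
    using h unfolding c11_def by blast
  have le: "norm (B a b) \<le> p * q * k" if "norm a \<le> p" "norm b \<le> q" for a b p q
  proof -
    have "0 \<le> p" using that(1) norm_ge_zero order.trans by blast
    then have "norm a * norm b * k \<le> p * q * k"
      using that k(1) by (intro mult_right_mono mult_mono) auto
    then show ?thesis using k(2)[of a b] by linarith
  qed
  \<comment> \<open>The product rule for second differences has four summands; \<open>t1\<close>
    contributes twice and \<open>t2\<close>, \<open>t3\<close>, \<open>t4\<close> once each.\<close>
  define c where "c = 5 * (c1 * c2 * k)"
  have c: "0 \<le> c1 * c2 * k" using c1 c2 k by simp
  show ?thesis
    unfolding c11_def
  proof (intro exI[of _ c] conjI allI)
    show "0 \<le> c" using c by (simp add: c_def)
    fix x y v w
    show "norm (B (f x) (h x)) \<le> c"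
      using le[OF c1(2) c2(2), of x x] c by (simp add: c_def)
    have "B (f x) (h x) - B (f y) (h y) = B (f x - f y) (h x) + B (f y) (h x - h y)"
      by (simp add: B.diff_left B.diff_right)
    also have "norm \<dots> \<le> c1 * norm (x - y) * c2 * k + c1 * (c2 * norm (x - y)) * k"
      by (intro norm_triangle_mono le c1 c2)
    also have "\<dots> = 2 * (c1 * c2 * k) * norm (x - y)" by (simp add: algebra_simps)
    also have "\<dots> \<le> c * norm (x - y)"
      unfolding c_def using c by (intro mult_right_mono) auto
    finally show "norm (B (f x) (h x) - B (f y) (h y)) \<le> c * norm (x - y)" .
    define df where "df = f (x + v) - f x"
    define dh where "dh = h (x + v) - h x"
    define df' where "df' = f (y + w) - f y"
    define dh' where "dh' = h (y + w) - h y"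
    let ?m = "norm (x - y) * norm v + norm (v - w)"
    \<comment> \<open>Both bounds are used in \<open>t1\<close>: the first one beside the factor
      \<open>norm (x - y)\<close>, the second one where \<open>norm (v - w)\<close> already supplies
      the smallness.\<close>
    have df: "norm df \<le> c1 * norm v" "norm df \<le> 2 * c1"
      using c1(3)[of "x + v" x] norm_triangle_ineq4[of "f (x + v)" "f x"] c1(2)[of x] c1(2)[of "x + v"]
      by (auto simp: df_def)
    have hxy: "h (x + v) - h (y + w) = (h (x + v) - h (y + v)) + (h (y + v) - h (y + w))" by simp
    have t1: "norm (B df (h (x + v) - h (y + w))) \<le> 2 * (c1 * c2 * k) * ?m"
    proof -
      have "norm (B df (h (x + v) - h (y + v))) \<le> c1 * norm v * (c2 * norm (x - y)) * k"
        using df c2(3)[of "x + v" "y + v"] by (intro le) auto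
      moreover have "norm (B df (h (y + v) - h (y + w))) \<le> 2 * c1 * (c2 * norm (v - w)) * k"
        using df c2(3)[of "y + v" "y + w"] by (intro le) auto
      ultimately have "norm (B df (h (x + v) - h (y + w)))
          \<le> c1 * norm v * (c2 * norm (x - y)) * k + 2 * c1 * (c2 * norm (v - w)) * k"
        unfolding hxy B.add_right by (rule norm_triangle_mono)
      moreover have "0 \<le> (c1 * c2 * k) * (norm (x - y) * norm v)" using c by simp
      ultimately show ?thesis by (simp add: algebra_simps)
    qed
    have t2: "norm (B (df - df') (h (y + w))) \<le> c1 * ?m * c2 * k"
      unfolding df_def df'_def by (intro le c1 c2)
    have t3: "norm (B (f x - f y) dh) \<le> c1 * norm (x - y) * (c2 * norm v) * k"
      using c2(3)[of "x + v" x] by (intro le c1) (auto simp: dh_def)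
    have t4: "norm (B (f y) (dh - dh')) \<le> c1 * (c2 * ?m) * k"
      unfolding dh_def dh'_def by (intro le c1 c2)
    have "(B (f (x + v)) (h (x + v)) - B (f x) (h x)) - (B (f (y + w)) (h (y + w)) - B (f y) (h y))
      = B df (h (x + v) - h (y + w)) + B (df - df') (h (y + w)) + B (f x - f y) dh + B (f y) (dh - dh')"
      unfolding df_def df'_def dh_def dh'_def by (simp add: B.diff_left B.diff_right)
    also have "norm \<dots> \<le> 2 * (c1 * c2 * k) * ?m + c1 * ?m * c2 * k
        + c1 * norm (x - y) * (c2 * norm v) * k + c1 * (c2 * ?m) * k"
      by (intro norm_triangle_mono t1 t2 t3 t4)
    also have "\<dots> \<le> c * ?m"
    proof -
      have "c1 * norm (x - y) * (c2 * norm v) * k = (c1 * c2 * k) * (norm (x - y) * norm v)"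
        by (simp add: algebra_simps)
      also have "\<dots> \<le> (c1 * c2 * k) * ?m"
        using c by (intro mult_left_mono) auto
      finally show ?thesis unfolding c_def by (simp add: algebra_simps)
    qed
    finally show "norm ((B (f (x + v)) (h (x + v)) - B (f x) (h x))
      - (B (f (y + w)) (h (y + w)) - B (f y) (h y))) \<le> c * ?m" .
  qed
qed

lemma c11_linear:
  assumes L: "bounded_linear L" and f: "c11 f"
  shows "c11 (\<lambda>x. L (f x))"
proof -
  interpret L: bounded_linear L by (rule L)
  obtain k where k: "0 < k" "\<And>a. norm (L a) \<le> norm a * k"
    using L.pos_bounded by blast
  obtain c where c: "0 \<le> c" "\<And>x. norm (f x) \<le> c" "\<And>x y. norm (f x - f y) \<le> c * norm (x - y)"
    "\<And>x y v w. norm ((f (x + v) - f x) - (f (y + w) - f y)) \<le> c * (norm (x - y) * norm v + norm (v - w))"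
    using f unfolding c11_def by blast
  have le: "norm (L a) \<le> k * c * m" if "norm a \<le> c * m" for a m
  proof -
    have "norm (L a) \<le> norm a * k" by (rule k)
    also have "\<dots> \<le> (c * m) * k" using that k(1) by (intro mult_right_mono) auto
    finally show ?thesis by (simp add: algebra_simps)
  qed
  show ?thesis
    unfolding c11_def
  proof (intro exI[of _ "k * c"] conjI allI)
    show "0 \<le> k * c" using k c by simp
    fix x y v w
    show "norm (L (f x)) \<le> k * c" using le[of "f x" 1] c(2)[of x] by simp
    show "norm (L (f x) - L (f y)) \<le> k * c * norm (x - y)"
      unfolding L.diff[symmetric] by (intro le c)
    show "norm ((L (f (x + v)) - L (f x)) - (L (f (y + w)) - L (f y)))
      \<le> k * c * (norm (x - y) * norm v + norm (v - w))"
      unfolding L.diff[symmetric] by (intro le c)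
  qed
qed

text \<open>Comparing the two remainders along the segments \<open>x + s v\<close> and \<open>y + s w\<close> avoids the
  symmetry of the second derivative.\<close>

lemma taylor_difference:
  fixes g :: "'a::real_normed_vector \<Rightarrow> 'b::real_normed_vector"
  assumes D: "\<And>x. (g has_derivative blinfun_apply (D1 x)) (at x)" and c11: "c11 D1"
  shows "\<exists>c\<ge>0. \<forall>x y v w. norm ((g (x + v) - g x - D1 x v) - (g (y + w) - g y - D1 y w))
      \<le> c * (norm (x - y) * (norm v)\<^sup>2 + norm (v - w) * (norm v + norm w))"
proof -
  obtain c where c: "0 \<le> c" "\<And>x y. norm (D1 x - D1 y) \<le> c * norm (x - y)"
    "\<And>x y v w. norm ((D1 (x + v) - D1 x) - (D1 (y + w) - D1 y)) \<le> c * (norm (x - y) * norm v + norm (v - w))"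
    using c11 unfolding c11_def by blast
  show ?thesis
  proof (intro exI[of _ c] conjI allI c(1))
    fix x y v w :: 'a
    let ?m = "norm (x - y) * (norm v)\<^sup>2 + norm (v - w) * (norm v + norm w)"
    define \<psi> where "\<psi> s = (g (x + s *\<^sub>R v) - s *\<^sub>R D1 x v) - (g (y + s *\<^sub>R w) - s *\<^sub>R D1 y w)" for s :: real
    define \<psi>' where "\<psi>' s = (D1 (x + s *\<^sub>R v) - D1 x) v - (D1 (y + s *\<^sub>R w) - D1 y) w" for s :: real
    have gd: "((\<lambda>s. g (x + s *\<^sub>R v)) has_derivative (\<lambda>h. h *\<^sub>R D1 (x + s *\<^sub>R v) v)) (at s within {0..1})"
      for x v :: 'a and s :: real
    proof -
      have "((\<lambda>s. x + s *\<^sub>R v) has_derivative (\<lambda>h. h *\<^sub>R v)) (at s within {0..1})"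
        by (auto intro!: derivative_eq_intros)
      from has_derivative_compose[OF this D] show ?thesis by (simp add: blinfun.scaleR_right)
    qed
    have "norm (\<psi> 1 - \<psi> 0) \<le> (c * ?m) * norm (1 - 0 :: real)"
    proof (rule differentiable_bound[of "{0..1}" \<psi> "\<lambda>s h. h *\<^sub>R \<psi>' s"])
      fix s :: real assume s: "s \<in> {0..1}"
      show "(\<psi> has_derivative (\<lambda>h. h *\<^sub>R \<psi>' s)) (at s within {0..1})"
        unfolding \<psi>_def[abs_def] \<psi>'_def
        by (auto intro!: derivative_eq_intros gd simp: blinfun.diff_left algebra_simps)
      have "norm (\<psi>' s) \<le> c * ?m"
      proof -
        let ?a = "D1 (x + s *\<^sub>R v) - D1 x" and ?b = "D1 (y + s *\<^sub>R w) - D1 y"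
        have "norm (?a - ?b) \<le> c * (norm (x - y) * norm (s *\<^sub>R v) + norm (s *\<^sub>R v - s *\<^sub>R w))"
          by (rule c)
        also have "\<dots> \<le> c * (norm (x - y) * norm v + norm (v - w))"
          using s c(1) mult_left_le_one_le[of "norm v" s] mult_left_le_one_le[of "norm (v - w)" s]
          by (intro mult_left_mono add_mono) (auto simp flip: scaleR_diff_right)
        finally have 1: "norm ((?a - ?b) v) \<le> (c * (norm (x - y) * norm v + norm (v - w))) * norm v"
          using order.trans[OF norm_blinfun mult_right_mono] norm_ge_zero by blast
        have "norm ?b \<le> c * norm (s *\<^sub>R w)" using c(2)[of "y + s *\<^sub>R w" y] by simp
        also have "\<dots> \<le> c * norm w"
          using s c(1) mult_left_le_one_le[of "norm w" s] by (intro mult_left_mono) auto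
        finally have 2: "norm (?b (v - w)) \<le> c * norm w * norm (v - w)"
          using order.trans[OF norm_blinfun mult_right_mono] norm_ge_zero by blast
        have "\<psi>' s = (?a - ?b) v + ?b (v - w)"
          unfolding \<psi>'_def by (simp add: blinfun.bilinear_simps)
        then have "norm (\<psi>' s) \<le> (c * (norm (x - y) * norm v + norm (v - w))) * norm v
            + c * norm w * norm (v - w)"
          using norm_triangle_mono[OF 1 2] by simp
        then show ?thesis by (simp add: algebra_simps power2_eq_square)
      qed
      then show "onorm (\<lambda>h. h *\<^sub>R \<psi>' s) \<le> c * ?m"
        by (simp add: onorm_scaleR_left bounded_linear_ident onorm_id)
    qed auto
    then show "norm ((g (x + v) - g x - D1 x v) - (g (y + w) - g y - D1 y w)) \<le> c * ?m"
      by (simp add: \<psi>_def algebra_simps)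
  qed
qed

section \<open>Matrix fields as operator-valued fields\<close>

definition matrix_op :: "real ^ 'd ^ 'm \<Rightarrow> ((real ^ 'd) \<Rightarrow>\<^sub>L (real ^ 'm))"
  where "matrix_op M = Blinfun ((*v) M)"

lemma matrix_op_apply [simp]: "matrix_op M v = M *v v"
  unfolding matrix_op_def by (simp add: bounded_linear_Blinfun_apply)

lemma bounded_linear_matrix_op: "bounded_linear (matrix_op :: real ^ 'd ^ 'm \<Rightarrow> _)"
  by (rule linear_conv_bounded_linear[THEN iffD1], rule linearI)
     (auto intro!: blinfun_eqI simp: blinfun.bilinear_simps matrix_vector_mult_add_rdistrib
       scaleR_matrix_vector_assoc)

text \<open>This is \<open>Dg_g\<close> as an operator on matrices, with the derivative and the
  value of \<open>g\<close> as independent arguments. It is bilinear in them, so the regularity of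
  the second order field follows from the product rule for \<open>c11\<close>.\<close>

definition contraction ::
  "((real ^ 'm) \<Rightarrow>\<^sub>L (real ^ 'd ^ 'm)) \<Rightarrow> real ^ 'd ^ 'm \<Rightarrow> ((real ^ 'd ^ 'd) \<Rightarrow>\<^sub>L (real ^ 'm))"
  where "contraction D G =
    Blinfun (\<lambda>MM. \<Sum>j\<in>UNIV. \<Sum>k\<in>UNIV. (MM $ j $ k) *\<^sub>R (D (G *v axis j 1) *v axis k 1))"

lemma contraction_apply:
  "contraction D G MM = (\<Sum>j\<in>UNIV. \<Sum>k\<in>UNIV. (MM $ j $ k) *\<^sub>R (D (G *v axis j 1) *v axis k 1))"
  unfolding contraction_def
  by (subst bounded_linear_Blinfun_apply, rule linear_conv_bounded_linear[THEN iffD1], rule linearI)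
     (simp_all add: scaleR_add_left sum.distrib scaleR_sum_right)

lemma bounded_bilinear_contraction:
  "bounded_bilinear (contraction :: ((real ^ 'm) \<Rightarrow>\<^sub>L (real ^ 'd ^ 'm)) \<Rightarrow> _)"
proof
  obtain K where K: "\<And>M. norm (matrix_op M :: (real ^ 'd) \<Rightarrow>\<^sub>L (real ^ 'm)) \<le> norm M * K" "0 < K"
    using bounded_linear.pos_bounded[OF bounded_linear_matrix_op] by blast
  have op: "norm (M *v v) \<le> K * norm M * norm v" for M :: "real ^ 'd ^ 'm" and v
  proof -
    have "norm (matrix_op M v) \<le> norm (matrix_op M) * norm v" by (rule norm_blinfun)
    also have "\<dots> \<le> (norm M * K) * norm v" using K by (intro mult_right_mono) auto
    finally show ?thesis by (simp add: mult.commute)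
  qed
  have "norm (contraction D G) \<le> norm D * norm G * (real CARD('d) * (real CARD('d) * (K * K)))"
    for D :: "(real ^ 'm) \<Rightarrow>\<^sub>L (real ^ 'd ^ 'm)" and G :: "real ^ 'd ^ 'm"
  proof (rule norm_blinfun_bound)
    show "0 \<le> norm D * norm G * (real CARD('d) * (real CARD('d) * (K * K)))" using K by simp
    fix MM :: "real ^ 'd ^ 'd"
    have "norm ((MM $ j $ k) *\<^sub>R (D (G *v axis j 1) *v axis k 1))
        \<le> norm MM * (norm D * norm G * (K * K))" for j k
    proof -
      have "\<bar>MM $ j $ k\<bar> \<le> norm MM"
        using order.trans[OF component_le_norm_cart[of "MM $ j" k]] Finite_Cartesian_Product.norm_nth_le[of MM j] by simp
      moreover have "norm (D (G *v axis j 1) *v axis k 1) \<le> norm D * norm G * (K * K)"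
      proof -
        have "norm (D (G *v axis j 1)) \<le> norm D * norm (G *v axis j 1)" by (rule norm_blinfun)
        also have "\<dots> \<le> norm D * (K * norm G)"
          using op[of G "axis j 1"] by (intro mult_left_mono) auto
        finally have "K * norm (D (G *v axis j 1)) \<le> K * (norm D * (K * norm G))"
          using K(2) by (intro mult_left_mono) auto
        then show ?thesis
          using op[of "D (G *v axis j 1)" "axis k 1"] by (simp add: algebra_simps)
      qed
      ultimately show ?thesis by (simp add: mult_mono)
    qed
    then have "norm (contraction D G MM)
        \<le> (\<Sum>j\<in>(UNIV::'d set). \<Sum>k\<in>(UNIV::'d set). norm MM * (norm D * norm G * (K * K)))"
      unfolding contraction_apply by (intro sum_norm_le)
    then show "norm (contraction D G MM)
        \<le> norm D * norm G * (real CARD('d) * (real CARD('d) * (K * K))) * norm MM"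
      by (simp add: algebra_simps)
  qed
  then show "\<exists>K. \<forall>(D :: (real ^ 'm) \<Rightarrow>\<^sub>L (real ^ 'd ^ 'm)) G. norm (contraction D G) \<le> norm D * norm G * K"
    by blast
qed (auto intro!: blinfun_eqI simp: contraction_apply blinfun.bilinear_simps
    matrix_vector_mult_add_rdistrib scaleR_matrix_vector_assoc[symmetric]
    scaleR_add_right sum.distrib scaleR_sum_right ac_simps)

lemma linear_axis_expansion:
  fixes L :: "real ^ 'n \<Rightarrow> 'b::real_vector"
  assumes "linear L"
  shows "L v = (\<Sum>i\<in>UNIV. (v $ i) *\<^sub>R L (axis i 1))"
proof -
  have "L v = L (\<Sum>i\<in>UNIV. (v $ i) *\<^sub>R axis i 1)"
    using basis_expansion[of v] by (simp add: scalar_mult_eq_scaleR)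
  also have "\<dots> = (\<Sum>i\<in>UNIV. (v $ i) *\<^sub>R L (axis i 1))"
    by (simp add: linear_sum[OF assms] linear_scale[OF assms])
  finally show ?thesis .
qed

text \<open>This identity converts the tensor in Chen's relation for matrices into the mixed term
  that \<open>rough_rde\<close> expects.\<close>

lemma contraction_tensor: "contraction D G (tensor u v) = D (G *v u) *v v"
proof -
  have lin: "linear (\<lambda>u. D (G *v u) *v v)"
    by (rule linearI) (auto simp: matrix_vector_right_distrib matrix_vector_mult_scaleR
      blinfun.bilinear_simps matrix_vector_mult_add_rdistrib scaleR_matrix_vector_assoc[symmetric])
  have "contraction D G (tensor u v)
      = (\<Sum>j\<in>UNIV. (u $ j) *\<^sub>R (\<Sum>k\<in>UNIV. (v $ k) *\<^sub>R (D (G *v axis j 1) *v axis k 1)))"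
    by (simp add: contraction_apply tensor_def scaleR_sum_right)
  also have "\<dots> = (\<Sum>j\<in>UNIV. (u $ j) *\<^sub>R (D (G *v axis j 1) *v v))"
    by (simp add: linear_axis_expansion[OF matrix_vector_mul_linear, symmetric])
  also have "\<dots> = D (G *v u) *v v" by (rule linear_axis_expansion[OF lin, symmetric])
  finally show ?thesis .
qed

lemma bounded_range_le:
  assumes "bounded (range f)"
  shows "\<exists>c\<ge>0. \<forall>x. norm (f x) \<le> c"
proof -
  from assms obtain c where c: "\<And>x. norm (f x) \<le> c" by (auto simp: bounded_iff)
  then have "0 \<le> c" using norm_ge_zero order.trans by blast
  with c show ?thesis by blast
qed

text \<open>The bound on the third derivative enters through \<open>c11 D1\<close>, from which both
  the regularity of the second order field and the Taylor comparison follow. The claim holds for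
  every large \<open>C\<close> because the constant must later dominate the Hoelder constants of a
  path, whereas \<open>D\<close> and \<open>C0\<close> are common to all paths.\<close>

lemma rough_field_of_Cb3:
  fixes A :: "real ^ 'm ^ 'm" and f :: "real ^ 'm \<Rightarrow> real ^ 'm" and g :: "real ^ 'm \<Rightarrow> real ^ 'd ^ 'm"
  assumes f: "L-lipschitz_on UNIV f" and g: "Cb3 g"
  shows "\<exists>D C0. (\<forall>x. Dg_g g x = contraction (D x) (g x)) \<and>
    (\<forall>C\<ge>C0. rough_field (\<lambda>x. A *v x + f x) (\<lambda>x. matrix_op (g x)) (\<lambda>x. contraction (D x) (g x))
      (\<lambda>x. Blinfun matrix_op o\<^sub>L D x) C)"
proof -
  obtain D1 :: "real ^ 'm \<Rightarrow> (real ^ 'm) \<Rightarrow>\<^sub>L (real ^ 'd ^ 'm)" and D2 D3 where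
    D1: "\<And>x. (g has_derivative blinfun_apply (D1 x)) (at x)" and
    D2: "\<And>x. (D1 has_derivative blinfun_apply (D2 x)) (at x)" and
    D3: "\<And>x. (D2 has_derivative blinfun_apply (D3 x)) (at x)" and
    bounded: "bounded (range g)" "bounded (range D1)" "bounded (range D2)" "bounded (range D3)"
    using g unfolding Cb3_def by blast
  obtain a0 a1 a2 a3 where a: "\<And>x. norm (g x) \<le> a0" "\<And>x. norm (D1 x) \<le> a1"
    "\<And>x. norm (D2 x) \<le> a2" "\<And>x. norm (D3 x) \<le> a3" "0 \<le> a0" "0 \<le> a1" "0 \<le> a2" "0 \<le> a3"
    using bounded[THEN bounded_range_le] by metis
  define a where "a = a0 + a1 + a2 + a3"
  have le_a: "norm (g x) \<le> a" "norm (D1 x) \<le> a" "norm (D2 x) \<le> a" "norm (D3 x) \<le> a" for x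
    using a(1-4)[of x] a(5-8) unfolding a_def by linarith+
  have c11_g: "c11 g"
    by (rule c11_of_derivative[OF D1 le_a(1,2) lipschitz_of_derivative[OF D2 le_a(3)]])
  have c11_D1: "c11 D1"
    by (rule c11_of_derivative[OF D2 le_a(2,3) lipschitz_of_derivative[OF D3 le_a(4)]])
  let ?g = "\<lambda>x. matrix_op (g x)" and ?F = "\<lambda>x. contraction (D1 x) (g x)"
    and ?D = "\<lambda>x. Blinfun matrix_op o\<^sub>L D1 x" and ?b = "\<lambda>x. A *v x + f x"
  have Dg: "Dg_g g x = ?F x" for x
    using frechet_derivative_at[OF D1[of x]] by (auto simp: fun_eq_iff Dg_g_def contraction_apply)
  have g11: "c11 ?g" by (rule c11_linear[OF bounded_linear_matrix_op c11_g])
  have F11: "c11 ?F" by (rule c11_bilinear[OF bounded_bilinear_contraction c11_D1 c11_g])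
  have D11: "c11 ?D"
    by (rule c11_linear[OF bounded_bilinear.bounded_linear_right[OF bounded_bilinear_blinfun_compose] c11_D1])
  have D_apply: "blinfun_apply (?D x) = (\<lambda>v. matrix_op (D1 x v))" for x
    by (simp add: fun_eq_iff blinfun_compose.rep_eq bounded_linear_Blinfun_apply[OF bounded_linear_matrix_op])
  have "(?g has_derivative blinfun_apply (?D x)) (at x)" for x
    unfolding D_apply by (rule bounded_linear.has_derivative[OF bounded_linear_matrix_op D1])
  from taylor_difference[OF this D11] obtain ct where ct: "0 \<le> ct"
    "\<And>x y v w. norm ((?g (x + v) - ?g x - ?D x v) - (?g (y + w) - ?g y - ?D y w))
      \<le> ct * (norm (x - y) * (norm v)\<^sup>2 + norm (v - w) * (norm v + norm w))" by blast
  from g11 obtain c1 where c1: "0 \<le> c1" "\<And>x. norm (?g x) \<le> c1" "\<And>x y. norm (?g x - ?g y) \<le> c1 * norm (x - y)"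
    unfolding c11_def by blast
  from F11 obtain c2 where c2: "0 \<le> c2" "\<And>x. norm (?F x) \<le> c2"
    "\<And>x y v w. norm ((?F (x + v) - ?F x) - (?F (y + w) - ?F y))
      \<le> c2 * (norm (x - y) * norm v + norm (v - w))"
    unfolding c11_def by blast
  from D11 obtain c3 where c3: "0 \<le> c3" "\<And>x. norm (?D x) \<le> c3" "\<And>x y. norm (?D x - ?D y) \<le> c3 * norm (x - y)"
    unfolding c11_def by blast
  obtain k where k: "0 < k" "\<And>x. norm (A *v x) \<le> norm x * k"
    using bounded_linear.pos_bounded[OF matrix_vector_mul_bounded_linear[of A]] by blast
  have L: "0 \<le> L" "\<And>x y. norm (f x - f y) \<le> L * norm (x - y)"
    using lipschitz_on_nonneg[OF f] lipschitz_onD[OF f] by (auto simp: dist_norm)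
  have b_lip: "norm (?b x - ?b y) \<le> (k + L) * norm (x - y)" for x y
  proof -
    have "?b x - ?b y = A *v (x - y) + (f x - f y)" by (simp add: matrix_vector_mult_diff_distrib)
    then show ?thesis
      using norm_triangle_mono[OF k(2)[of "x - y"] L(2)[of x y]] by (simp add: algebra_simps)
  qed
  have b_growth: "norm (?b x) \<le> (norm (f 0) + k + L) * (1 + norm x)" for x
  proof -
    have "norm (?b x) \<le> norm (f 0) + (k + L) * norm x"
      using b_lip[of x 0] norm_triangle_sub[of "?b x" "f 0"] by simp
    also have "\<dots> \<le> norm (f 0) + (k + L) * norm x + (k + L + norm (f 0) * norm x)"
      using k(1) L(1) by simp
    also have "\<dots> = (norm (f 0) + k + L) * (1 + norm x)" by (simp add: algebra_simps)
    finally show ?thesis .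
  qed
  define C0 where "C0 = 1 + c1 + c2 + c3 + ct + (norm (f 0) + k + L)"
  have "rough_field ?b ?g ?F ?D C" if "C0 \<le> C" for C
  proof
    have le: "1 \<le> C" "c1 \<le> C" "c2 \<le> C" "c3 \<le> C" "ct \<le> C" "k + L \<le> C" "norm (f 0) + k + L \<le> C"
      using that c1(1) c2(1) c3(1) ct(1) k(1) L(1) norm_ge_zero[of "f 0"] unfolding C0_def by linarith+
    have up: "p \<le> C * q" if "p \<le> c * q" "c \<le> C" "0 \<le> q" for p q c
      using that mult_right_mono[OF that(2,3)] by linarith
    show "1 \<le> C" by (rule le)
    fix x y v w
    show "norm (?b x - ?b y) \<le> C * norm (x - y)" by (rule up[OF b_lip le(6)]) simp
    show "norm (?b x) \<le> C * (1 + norm x)" by (rule up[OF b_growth le(7)]) simp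
    show "norm (?g x) \<le> C" "norm (?D x) \<le> C" "norm (?F x) \<le> C"
      using c1(2)[of x] c2(2)[of x] c3(2)[of x] le by linarith+
    show "norm (?g x - ?g y) \<le> C * norm (x - y)" by (rule up[OF c1(3) le(2)]) simp
    show "norm (?D x - ?D y) \<le> C * norm (x - y)" by (rule up[OF c3(3) le(4)]) simp
    show "norm ((?g (x + v) - ?g x - ?D x v) - (?g (y + w) - ?g y - ?D y w))
      \<le> C * (norm (x - y) * (norm v)\<^sup>2 + norm (v - w) * (norm v + norm w))"
      by (rule up[OF ct(2) le(5)]) simp
    show "norm ((?F (x + v) - ?F x) - (?F (y + w) - ?F y))
      \<le> C * (norm (x - y) * norm v + norm (v - w))"
      by (rule up[OF c2(3) le(3)]) simp
  qed
  with Dg show ?thesis by blast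
qed

subsection \<open>The rough path lift\<close>

lemma bounded_bilinear_tensor: "bounded_bilinear (tensor :: real ^ 'd \<Rightarrow> _)"
proof
  have "norm (tensor x y) \<le> norm x * norm y * (real CARD('d) * real CARD('d))" for x y :: "real ^ 'd"
  proof -
    have "norm (tensor x y) \<le> (\<Sum>j\<in>(UNIV::'d set). norm (tensor x y $ j))"
      unfolding norm_vec_def[of "tensor x y"] by (rule L2_set_le_sum) simp
    also have "\<dots> \<le> (\<Sum>j\<in>(UNIV::'d set). \<Sum>k\<in>(UNIV::'d set). norm x * norm y)"
    proof (intro sum_mono)
      fix j :: 'd
      have "norm (tensor x y $ j) \<le> (\<Sum>k\<in>(UNIV::'d set). \<bar>tensor x y $ j $ k\<bar>)"
        by (rule norm_le_l1_cart)
      also have "\<dots> \<le> (\<Sum>k\<in>(UNIV::'d set). norm x * norm y)"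
        by (intro sum_mono) (auto simp: tensor_def abs_mult intro!: mult_mono component_le_norm_cart)
      finally show "norm (tensor x y $ j) \<le> (\<Sum>k\<in>(UNIV::'d set). norm x * norm y)" .
    qed
    finally show ?thesis by (simp add: algebra_simps)
  qed
  then show "\<exists>K. \<forall>x y :: real ^ 'd. norm (tensor x y) \<le> norm x * norm y * K" by blast
qed (auto simp: tensor_def vec_eq_iff algebra_simps)

interpretation tensor: bounded_bilinear "tensor :: real ^ 'd \<Rightarrow> _"
  by (rule bounded_bilinear_tensor)

lemma interval_integral_continuous:
  fixes f :: "real \<Rightarrow> 'a::euclidean_space"
  assumes "s \<le> t" "continuous_on {s..t} f"
  shows "(LBINT r=s..t. f r) = integral {s..t} f"
  using assms by (intro interval_integral_eq_integral borel_integrable_atLeastAtMost')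

lemma interval_integral_combine:
  fixes f :: "real \<Rightarrow> 'a::euclidean_space" and s u t :: real
  assumes "s \<le> u" "u \<le> t" "continuous_on {s..t} f"
  shows "(LBINT r=s..u. f r) + (LBINT r=u..t. f r) = (LBINT r=s..t. f r)"
  using assms
  by (intro interval_integral_sum) (simp add: min_absorb1 max_absorb2 interval_integrable_continuous_on)

lemma norm_interval_integral_le:
  fixes f :: "real \<Rightarrow> 'a::euclidean_space" and s t :: real
  assumes "s \<le> t" "continuous_on {s..t} f" "\<And>r. s \<le> r \<Longrightarrow> r \<le> t \<Longrightarrow> norm (f r) \<le> B"
  shows "norm (LBINT r=s..t. f r) \<le> B * (t - s)"
  using integral_bound[OF assms(1,2)] assms by (simp add: interval_integral_continuous)

definition increment_quotient :: "real \<Rightarrow> (real \<Rightarrow> 'a::real_normed_vector) \<Rightarrow> real \<Rightarrow> 'a"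
  where "increment_quotient \<delta> \<omega> r = (1 / \<delta>) *\<^sub>R (\<omega> (r + \<delta>) - \<omega> r)"

lemma continuous_increment_quotient:
  assumes "continuous_on UNIV \<omega>"
  shows "continuous_on S (increment_quotient \<delta> \<omega>)"
proof -
  have "continuous_on S (\<lambda>r. \<omega> (r + \<delta>))"
    by (rule continuous_on_compose2[OF assms]) (auto intro!: continuous_intros)
  then show ?thesis
    unfolding increment_quotient_def[abs_def]
    by (intro continuous_intros continuous_on_subset[OF assms]) auto
qed

lemma W_approx_derivative:
  fixes \<omega> :: "real \<Rightarrow> real ^ 'd"
  assumes "continuous_on UNIV \<omega>"
  shows "(W_approx \<delta> \<omega> has_vector_derivative increment_quotient \<delta> \<omega> r) (at r)"
proof -
  \<comment> \<open>The interval contains 0, where the integral starts, and has \<open>r\<close> in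
    its interior, so the derivative within it is a full derivative.\<close>
  let ?I = "{- (\<bar>r\<bar> + 1)..\<bar>r\<bar> + 1}"
  have "((\<lambda>u. LBINT y=0..u. increment_quotient \<delta> \<omega> y) has_vector_derivative increment_quotient \<delta> \<omega> r)
      (at r within ?I)"
    using continuous_increment_quotient[OF assms]
    by (intro interval_integral_FTC2[of _ 0, unfolded zero_ereal_def[symmetric]]) auto
  then show ?thesis
    by (simp add: at_within_Icc_at W_approx_def[abs_def] increment_quotient_def)
qed

lemma continuous_W_approx:
  fixes \<omega> :: "real \<Rightarrow> real ^ 'd"
  assumes "continuous_on UNIV \<omega>"
  shows "continuous_on S (W_approx \<delta> \<omega>)"
  using W_approx_derivative[OF assms]
  by (meson continuous_at_imp_continuous_on has_vector_derivative_continuous)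

lemma WW_approx_eq:
  fixes \<omega> :: "real \<Rightarrow> real ^ 'd"
  assumes "continuous_on UNIV \<omega>"
  shows "WW_approx \<delta> \<omega> s t
    = (LBINT r=s..t. tensor (W_approx \<delta> \<omega> r - W_approx \<delta> \<omega> s) (increment_quotient \<delta> \<omega> r))"
  by (simp add: WW_approx_def vector_derivative_at[OF W_approx_derivative[OF assms]])

lemma continuous_WW_integrand:
  fixes \<omega> :: "real \<Rightarrow> real ^ 'd"
  assumes "continuous_on UNIV \<omega>"
  shows "continuous_on S (\<lambda>r. tensor (W_approx \<delta> \<omega> r - c) (increment_quotient \<delta> \<omega> r))"
  by (intro tensor.continuous_on continuous_intros continuous_W_approx continuous_increment_quotient assms)

text \<open>The approximations are continuously differentiable, so Chen's relation is the additivity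
  of the integral: on the second interval the increment from \<open>s\<close> is split at
  \<open>u\<close>, and its constant part integrates to the tensor.\<close>

lemma WW_approx_chen:
  fixes \<omega> :: "real \<Rightarrow> real ^ 'd"
  assumes \<omega>: "continuous_on UNIV \<omega>" and "s \<le> u" "u \<le> t"
  shows "WW_approx \<delta> \<omega> s t = WW_approx \<delta> \<omega> s u + WW_approx \<delta> \<omega> u t
    + tensor (W_approx \<delta> \<omega> u - W_approx \<delta> \<omega> s) (W_approx \<delta> \<omega> t - W_approx \<delta> \<omega> u)"
proof -
  let ?W = "W_approx \<delta> \<omega>" and ?v = "increment_quotient \<delta> \<omega>"
  have "(LBINT r=u..t. tensor (?W u - ?W s) (?v r))
      = tensor (?W u - ?W s) (?W t) - tensor (?W u - ?W s) (?W u)"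
  proof (rule interval_integral_FTC_finite)
    show "continuous_on {min u t..max u t} (\<lambda>r. tensor (?W u - ?W s) (?v r))"
      by (intro tensor.continuous_on continuous_intros continuous_increment_quotient \<omega>)
    show "((\<lambda>r. tensor (?W u - ?W s) (?W r)) has_vector_derivative tensor (?W u - ?W s) (?v x))
      (at x within {min u t..max u t})" for x
      by (rule bounded_linear.has_vector_derivative[OF tensor.bounded_linear_right
            has_vector_derivative_at_within[OF W_approx_derivative[OF \<omega>]]])
  qed
  then have 1: "(LBINT r=u..t. tensor (?W u - ?W s) (?v r)) = tensor (?W u - ?W s) (?W t - ?W u)"
    by (simp add: tensor.diff_right)
  have "(LBINT r=u..t. tensor (?W r - ?W s) (?v r))
      = (LBINT r=u..t. tensor (?W r - ?W u) (?v r) + tensor (?W u - ?W s) (?v r))"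
    by (simp add: tensor.add_left[symmetric])
  also have "\<dots> = (LBINT r=u..t. tensor (?W r - ?W u) (?v r)) + (LBINT r=u..t. tensor (?W u - ?W s) (?v r))"
    using assms(3)
    by (intro interval_lebesgue_integral_add interval_integrable_continuous_on continuous_WW_integrand
        tensor.continuous_on continuous_on_const continuous_increment_quotient \<omega>)
  finally show ?thesis
    using interval_integral_combine[OF assms(2,3) continuous_WW_integrand[OF \<omega>, of _ \<delta> "?W s"]]
    unfolding WW_approx_eq[OF \<omega>] 1 by (simp only: add.assoc)
qed

lemma W_approx_lipschitz:
  fixes \<omega> :: "real \<Rightarrow> real ^ 'd"
  assumes \<omega>: "continuous_on UNIV \<omega>" and "s \<le> t"
    and B: "\<And>r. s \<le> r \<Longrightarrow> r \<le> t \<Longrightarrow> norm (increment_quotient \<delta> \<omega> r) \<le> B"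
  shows "norm (W_approx \<delta> \<omega> t - W_approx \<delta> \<omega> s) \<le> B * (t - s)"
proof -
  have "(LBINT r=s..t. increment_quotient \<delta> \<omega> r) = W_approx \<delta> \<omega> t - W_approx \<delta> \<omega> s"
    by (rule interval_integral_FTC_finite[OF continuous_increment_quotient[OF \<omega>]
          has_vector_derivative_at_within[OF W_approx_derivative[OF \<omega>]]])
  then show ?thesis
    using norm_interval_integral_le[OF \<open>s \<le> t\<close> continuous_increment_quotient[OF \<omega>] B] by simp
qed

text \<open>For fixed \<open>\<delta>\<close> the approximation is Lipschitz on compact intervals,
  so its iterated integral is quadratic in the length. The constant may blow up with
  \<open>\<delta>\<close>, but a single \<open>\<delta>\<close> will be enough.\<close>

lemma WW_approx_bound:
  fixes \<omega> :: "real \<Rightarrow> real ^ 'd"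
  assumes \<omega>: "continuous_on UNIV \<omega>"
  shows "\<exists>B. \<forall>s t. a \<le> s \<longrightarrow> s \<le> t \<longrightarrow> t \<le> b \<longrightarrow> norm (WW_approx \<delta> \<omega> s t) \<le> B * (t - s)\<^sup>2"
proof -
  obtain K where K: "0 < K" "\<And>x y :: real ^ 'd. norm (tensor x y) \<le> norm x * norm y * K"
    using tensor.pos_bounded by blast
  have "bounded (increment_quotient \<delta> \<omega> ` {a..b})"
    by (intro compact_imp_bounded compact_continuous_image continuous_increment_quotient \<omega>) simp
  then obtain B where B: "0 < B" "\<And>r. a \<le> r \<Longrightarrow> r \<le> b \<Longrightarrow> norm (increment_quotient \<delta> \<omega> r) \<le> B"
    unfolding bounded_pos by auto
  have "norm (WW_approx \<delta> \<omega> s t) \<le> (B * B * K) * (t - s)\<^sup>2" if st: "a \<le> s" "s \<le> t" "t \<le> b" for s t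
  proof -
    have "norm (WW_approx \<delta> \<omega> s t) \<le> ((B * (t - s)) * B * K) * (t - s)"
      unfolding WW_approx_eq[OF \<omega>]
    proof (intro norm_interval_integral_le st continuous_WW_integrand \<omega>)
      fix r assume r: "s \<le> r" "r \<le> t"
      have "norm (W_approx \<delta> \<omega> r - W_approx \<delta> \<omega> s) \<le> B * (r - s)"
        using r st by (intro W_approx_lipschitz \<omega> B) auto
      also have "\<dots> \<le> B * (t - s)" using r B by (intro mult_left_mono) auto
      finally have "norm (W_approx \<delta> \<omega> r - W_approx \<delta> \<omega> s) * norm (increment_quotient \<delta> \<omega> r) * K
          \<le> (B * (t - s)) * B * K"
        using r st B K by (intro mult_right_mono mult_mono) auto
      then show "norm (tensor (W_approx \<delta> \<omega> r - W_approx \<delta> \<omega> s) (increment_quotient \<delta> \<omega> r))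
          \<le> (B * (t - s)) * B * K"
        using K(2) order.trans by blast
    qed
    then show ?thesis by (simp add: power2_eq_square algebra_simps)
  qed
  then show ?thesis by blast
qed

lemma increment_quotient_shift:
  "increment_quotient \<delta> (wiener_shift \<tau> \<omega>) r = increment_quotient \<delta> \<omega> (r + \<tau>)"
  by (simp add: increment_quotient_def wiener_shift_def algebra_simps)

lemma continuous_wiener_shift:
  assumes "continuous_on UNIV \<omega>"
  shows "continuous_on UNIV (wiener_shift \<tau> \<omega>)"
  unfolding wiener_shift_def[abs_def]
  by (intro continuous_intros continuous_on_compose2[OF assms]) auto

lemma W_approx_shift:
  fixes \<omega> :: "real \<Rightarrow> real ^ 'd"
  assumes \<omega>: "continuous_on UNIV \<omega>"
  shows "W_approx \<delta> (wiener_shift \<tau> \<omega>) t = W_approx \<delta> \<omega> (t + \<tau>) - W_approx \<delta> \<omega> \<tau>"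
proof -
  have "W_approx \<delta> (wiener_shift \<tau> \<omega>) t = (LBINT r=0..t. increment_quotient \<delta> \<omega> (r + \<tau>))"
    unfolding increment_quotient_shift[symmetric] by (simp add: W_approx_def increment_quotient_def)
  also have "\<dots> = (LBINT r=ereal 0..t. increment_quotient \<delta> \<omega> (r + \<tau>))" by (simp add: zero_ereal_def)
  also have "\<dots> = W_approx \<delta> \<omega> (t + \<tau>) - W_approx \<delta> \<omega> (0 + \<tau>)"
  proof (rule interval_integral_FTC_finite)
    show "continuous_on {min 0 t..max 0 t} (\<lambda>r. increment_quotient \<delta> \<omega> (r + \<tau>))"
      by (rule continuous_on_compose2[OF continuous_increment_quotient[OF \<omega>, of UNIV]])
         (auto intro!: continuous_intros)
    fix x
    have "((\<lambda>r. r + \<tau>) has_vector_derivative 1) (at x)"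
      by (auto intro!: derivative_eq_intros)
    from vector_diff_chain_at[OF this W_approx_derivative[OF \<omega>]]
    have "((\<lambda>r. W_approx \<delta> \<omega> (r + \<tau>)) has_vector_derivative increment_quotient \<delta> \<omega> (x + \<tau>)) (at x)"
      by (simp add: o_def)
    then show "((\<lambda>r. W_approx \<delta> \<omega> (r + \<tau>)) has_vector_derivative increment_quotient \<delta> \<omega> (x + \<tau>))
        (at x within {min 0 t..max 0 t})"
      by (rule has_vector_derivative_at_within)
  qed
  finally show ?thesis by simp
qed

lemma WW_approx_shift:
  fixes \<omega> :: "real \<Rightarrow> real ^ 'd" and s t :: real
  assumes \<omega>: "continuous_on UNIV \<omega>" and "s \<le> t"
  shows "WW_approx \<delta> (wiener_shift \<tau> \<omega>) s t = WW_approx \<delta> \<omega> (s + \<tau>) (t + \<tau>)"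
proof -
  let ?f = "\<lambda>r. tensor (W_approx \<delta> \<omega> r - W_approx \<delta> \<omega> (s + \<tau>)) (increment_quotient \<delta> \<omega> r)"
  have "WW_approx \<delta> (wiener_shift \<tau> \<omega>) s t = (LBINT r=s..t. 1 *\<^sub>R ?f (r + \<tau>))"
    by (simp add: WW_approx_eq continuous_wiener_shift \<omega> W_approx_shift increment_quotient_shift)
  also have "\<dots> = (LBINT r=(s + \<tau>)..(t + \<tau>). ?f r)"
    using \<open>s \<le> t\<close>
    by (intro interval_integral_substitution_finite continuous_WW_integrand \<omega>)
       (auto intro!: derivative_eq_intros)
  finally show ?thesis by (simp add: WW_approx_eq[OF \<omega>])
qed

text \<open>The two approximations agree for each \<open>\<delta>\<close>, so the limits agree
  whether or not they exist.\<close>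

lemma second_order_shift:
  fixes \<omega> :: "real \<Rightarrow> real ^ 'd" and s t :: real
  assumes "continuous_on UNIV \<omega>" "s \<le> t"
  shows "second_order (wiener_shift \<tau> \<omega>) s t = second_order \<omega> (s + \<tau>) (t + \<tau>)"
  unfolding second_order_def WW_approx_shift[OF assms] ..

section \<open>What the second order process inherits from its approximations\<close>

context
  fixes \<omega> :: "real \<Rightarrow> real ^ 'd" and \<beta> T :: real
  assumes conv: "((\<lambda>\<delta>. rough_dist \<beta> T (W_approx \<delta> \<omega>) (WW_approx \<delta> \<omega>) \<omega> (second_order \<omega>)) \<longlongrightarrow> 0) (at_right 0)"
begin

lemma rough_dist_ge:
  assumes "-T \<le> s" "s < t" "t \<le> T"
  shows "ennreal (norm ((W_approx \<delta> \<omega> t - W_approx \<delta> \<omega> s) - (\<omega> t - \<omega> s)) / \<bar>t - s\<bar> powr \<beta>)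
      \<le> rough_dist \<beta> T (W_approx \<delta> \<omega>) (WW_approx \<delta> \<omega>) \<omega> (second_order \<omega>)"
    and "ennreal (norm (WW_approx \<delta> \<omega> s t - second_order \<omega> s t) / \<bar>t - s\<bar> powr (2 * \<beta>))
      \<le> rough_dist \<beta> T (W_approx \<delta> \<omega>) (WW_approx \<delta> \<omega>) \<omega> (second_order \<omega>)"
proof -
  have st: "(s, t) \<in> {(s, t). -T \<le> s \<and> s < t \<and> t \<le> T}" using assms by simp
  show "ennreal (norm ((W_approx \<delta> \<omega> t - W_approx \<delta> \<omega> s) - (\<omega> t - \<omega> s)) / \<bar>t - s\<bar> powr \<beta>)
      \<le> rough_dist \<beta> T (W_approx \<delta> \<omega>) (WW_approx \<delta> \<omega>) \<omega> (second_order \<omega>)"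
    unfolding rough_dist_def by (rule add_increasing2[OF zero_le], rule SUP_upper2[OF st]) simp
  show "ennreal (norm (WW_approx \<delta> \<omega> s t - second_order \<omega> s t) / \<bar>t - s\<bar> powr (2 * \<beta>))
      \<le> rough_dist \<beta> T (W_approx \<delta> \<omega>) (WW_approx \<delta> \<omega>) \<omega> (second_order \<omega>)"
    unfolding rough_dist_def by (rule add_increasing[OF zero_le], rule SUP_upper2[OF st]) simp
qed

lemma tendsto_of_ennreal_quotient:
  assumes "0 < c" and "\<And>\<delta>. ennreal (norm (Y \<delta>) / c)
    \<le> rough_dist \<beta> T (W_approx \<delta> \<omega>) (WW_approx \<delta> \<omega>) \<omega> (second_order \<omega>)"
  shows "(Y \<longlongrightarrow> 0) (at_right 0)"
proof -
  have "((\<lambda>\<delta>. ennreal (norm (Y \<delta>) / c)) \<longlongrightarrow> 0) (at_right 0)"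
    by (rule tendsto_sandwich[OF _ _ tendsto_const conv]) (simp_all add: assms)
  then have "((\<lambda>\<delta>. norm (Y \<delta>) / c) \<longlongrightarrow> 0) (at_right 0)"
    using assms(1) by (subst (asm) tendsto_ennreal_iff[of _ _ 0, unfolded ennreal_0]) auto
  from tendsto_mult_right[OF this, of c] show ?thesis
    using assms(1) by (simp add: tendsto_norm_zero_iff)
qed

lemma tendsto_W_approx:
  assumes "-T \<le> s" "s < t" "t \<le> T"
  shows "((\<lambda>\<delta>. W_approx \<delta> \<omega> t - W_approx \<delta> \<omega> s) \<longlongrightarrow> \<omega> t - \<omega> s) (at_right 0)"
  by (rule LIM_zero_cancel, rule tendsto_of_ennreal_quotient[OF _ rough_dist_ge(1)[OF assms]])
     (use assms in auto)

lemma tendsto_WW_approx: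
  assumes "-T \<le> s" "s < t" "t \<le> T"
  shows "((\<lambda>\<delta>. WW_approx \<delta> \<omega> s t) \<longlongrightarrow> second_order \<omega> s t) (at_right 0)"
  by (rule LIM_zero_cancel, rule tendsto_of_ennreal_quotient[OF _ rough_dist_ge(2)[OF assms]])
     (use assms in auto)

lemma second_order_chen:
  assumes \<omega>: "continuous_on UNIV \<omega>" and st: "-T \<le> s" "s < u" "u < t" "t \<le> T"
  shows "second_order \<omega> s t = second_order \<omega> s u + second_order \<omega> u t + tensor (\<omega> u - \<omega> s) (\<omega> t - \<omega> u)"
proof (rule tendsto_unique[OF trivial_limit_at_right_real])
  show "((\<lambda>\<delta>. WW_approx \<delta> \<omega> s t) \<longlongrightarrow> second_order \<omega> s t) (at_right 0)"
    using st by (intro tendsto_WW_approx) auto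
  have "((\<lambda>\<delta>. WW_approx \<delta> \<omega> s u + WW_approx \<delta> \<omega> u t
      + tensor (W_approx \<delta> \<omega> u - W_approx \<delta> \<omega> s) (W_approx \<delta> \<omega> t - W_approx \<delta> \<omega> u))
    \<longlongrightarrow> second_order \<omega> s u + second_order \<omega> u t + tensor (\<omega> u - \<omega> s) (\<omega> t - \<omega> u)) (at_right 0)"
    using st by (intro tendsto_add tensor.tendsto tendsto_WW_approx tendsto_W_approx) auto
  then show "((\<lambda>\<delta>. WW_approx \<delta> \<omega> s t)
    \<longlongrightarrow> second_order \<omega> s u + second_order \<omega> u t + tensor (\<omega> u - \<omega> s) (\<omega> t - \<omega> u)) (at_right 0)"
    using st WW_approx_chen[OF \<omega>, of s u t] by simp
qed

text \<open>It suffices to fix one \<open>\<delta>\<close> for which the rough distance is below 1.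
  The difference to that approximation then satisfies the bound with constant 1, and the
  approximation itself is quadratic in the length.\<close>

lemma second_order_hoelder:
  assumes \<omega>: "continuous_on UNIV \<omega>" and \<beta>: "0 < \<beta>" "\<beta> \<le> 1"
  shows "\<exists>K. \<forall>s t. -T \<le> s \<longrightarrow> s < t \<longrightarrow> t \<le> T \<longrightarrow>
    norm (second_order \<omega> s t) \<le> K * \<bar>t - s\<bar> powr (2 * \<beta>)"
proof -
  have "\<forall>\<^sub>F \<delta> in at_right 0. rough_dist \<beta> T (W_approx \<delta> \<omega>) (WW_approx \<delta> \<omega>) \<omega> (second_order \<omega>) < 1"
    by (rule order_tendstoD[OF conv]) simp
  then obtain \<delta> where \<delta>: "rough_dist \<beta> T (W_approx \<delta> \<omega>) (WW_approx \<delta> \<omega>) \<omega> (second_order \<omega>) < 1"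
    using eventually_happens'[OF trivial_limit_at_right_real] by blast
  obtain B where B: "\<And>s t. -T \<le> s \<Longrightarrow> s \<le> t \<Longrightarrow> t \<le> T \<Longrightarrow> norm (WW_approx \<delta> \<omega> s t) \<le> B * (t - s)\<^sup>2"
    using WW_approx_bound[OF \<omega>] by metis
  \<comment> \<open>The length is at most \<open>2 * T\<close>, which absorbs the surplus exponent
    \<open>2 - 2 * \<beta>\<close> of the quadratic bound; the 1 accounts for the rough
    distance.\<close>
  define K where "K = \<bar>B\<bar> * (2 * T) powr (2 - 2 * \<beta>) + 1"
  have "norm (second_order \<omega> s t) \<le> K * \<bar>t - s\<bar> powr (2 * \<beta>)" if st: "-T \<le> s" "s < t" "t \<le> T" for s t
  proof -
    let ?p = "\<bar>t - s\<bar> powr (2 * \<beta>)"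
    have p: "0 < ?p" using st by simp
    have "ennreal (norm (WW_approx \<delta> \<omega> s t - second_order \<omega> s t) / ?p) < ennreal 1"
      unfolding ennreal_1 by (rule le_less_trans[OF rough_dist_ge(2)[OF st] \<delta>])
    then have "norm (WW_approx \<delta> \<omega> s t - second_order \<omega> s t) / ?p < 1"
      by (subst (asm) ennreal_less_iff) auto
    then have 1: "norm (second_order \<omega> s t - WW_approx \<delta> \<omega> s t) \<le> ?p"
      using p by (simp add: norm_minus_commute divide_simps)
    have "norm (WW_approx \<delta> \<omega> s t) \<le> \<bar>B\<bar> * (t - s)\<^sup>2"
      using order.trans[OF B[of s t] mult_right_mono[of B "\<bar>B\<bar>" "(t - s)\<^sup>2"]] st by simp
    also have "(t - s)\<^sup>2 = (t - s) powr (2 - 2 * \<beta>) * (t - s) powr (2 * \<beta>)"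
      using st by (simp flip: powr_add)
    also have "\<bar>B\<bar> * \<dots> \<le> \<bar>B\<bar> * ((2 * T) powr (2 - 2 * \<beta>) * (t - s) powr (2 * \<beta>))"
      using st \<beta> by (intro mult_left_mono mult_right_mono powr_mono2) auto
    finally have "norm (WW_approx \<delta> \<omega> s t) \<le> (\<bar>B\<bar> * (2 * T) powr (2 - 2 * \<beta>)) * ?p"
      using st by (simp add: mult.assoc)
    then have "norm (second_order \<omega> s t) \<le> (\<bar>B\<bar> * (2 * T) powr (2 - 2 * \<beta>)) * ?p + ?p"
      using 1 norm_triangle_sub[of "second_order \<omega> s t" "WW_approx \<delta> \<omega> s t"] by linarith
    then show ?thesis by (simp add: K_def distrib_right)
  qed
  then show ?thesis by blast
qed

end

subsection \<open>Davie solutions and rough integral equations\<close>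

text \<open>Above the scale \<open>\<sigma>\<close> the crude bound \<open>B\<close> suffices, since
  the power of the length is then at least \<open>\<sigma> powr a\<close>.\<close>

lemma powr_local_to_global:
  fixes N :: real
  assumes "t - s \<le> \<sigma> \<Longrightarrow> N \<le> K * (t - s) powr a" and "N \<le> B" and "s < t"
    and "0 < \<sigma>" "0 \<le> K" "0 \<le> B" "0 \<le> a"
  shows "N \<le> (K + B / \<sigma> powr a) * (t - s) powr a"
proof (cases "t - s \<le> \<sigma>")
  case True
  have "N \<le> K * (t - s) powr a" by (rule assms(1)[OF True])
  also have "\<dots> \<le> (K + B / \<sigma> powr a) * (t - s) powr a"
    using assms(4-6) by (intro mult_right_mono) auto
  finally show ?thesis .
next
  case False
  have "B = B / \<sigma> powr a * \<sigma> powr a" using assms(4) by simp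
  also have "\<dots> \<le> B / \<sigma> powr a * (t - s) powr a"
    using assms(4-7) False by (intro mult_left_mono powr_mono2) auto
  also have "\<dots> \<le> (K + B / \<sigma> powr a) * (t - s) powr a"
    using assms(5) by (intro mult_right_mono) auto
  finally show ?thesis using assms(2) by linarith
qed

context rough_rde
begin

text \<open>On an equidistant partition the sewing bound for the Riemann sum does not see the mesh,
  and a fine enough partition has its sum within \<open>\<epsilon>\<close> of the integral.\<close>

lemma partition_limit_bound:
  fixes y :: "real \<Rightarrow> 'e"
  assumes P: "1 \<le> P"
    and y: "\<And>s t. 0 \<le> s \<Longrightarrow> s < t \<Longrightarrow> t \<le> T \<Longrightarrow> norm (y t - y s) \<le> P * wt s t"
    and r: "\<And>s t. 0 \<le> s \<Longrightarrow> s < t \<Longrightarrow> t \<le> T \<Longrightarrow>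
      norm (y t - y s - g (y s) (X t - X s)) \<le> P * (wt s t)\<^sup>2"
    and st: "0 \<le> s" "s < t" "t \<le> T"
    and I: "has_partition_limit (\<lambda>u v. germ u v (y u)) s t I"
  shows "norm (I - germ s t (y s)) \<le> 3 * C ^ 6 * P / gap * (t - s) powr (3 * \<beta>)"
proof (rule field_le_epsilon)
  fix \<epsilon> :: real assume "0 < \<epsilon>"
  from I[unfolded has_partition_limit_def, rule_format, OF this]
  obtain \<eta> where \<eta>: "0 < \<eta>"
    "\<forall>n p. p 0 = s \<and> p n = t \<and> (\<forall>i<n. p i < p (Suc i) \<and> p (Suc i) - p i < \<eta>) \<longrightarrow>
      norm ((\<Sum>i<n. germ (p i) (p (Suc i)) (y (p i))) - I) < \<epsilon>"
    by blast
  obtain n :: nat where n: "(t - s) / \<eta> < real n" using reals_Archimedean2 by blast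
  then have n0: "0 < n" using \<eta>(1) st by (auto intro!: gr0I simp: divide_simps split: if_splits)
  define h where "h = (t - s) / n"
  have h: "0 < h" "h < \<eta>" using n n0 \<eta>(1) st by (auto simp: h_def field_simps)
  define p where "p i = s + real i * h" for i
  have pn: "p 0 = s" "p n = t" using n0 by (auto simp: p_def h_def)
  have p_mono: "p i < p j" if "i < j" for i j using that h by (simp add: p_def)
  have p_range: "0 \<le> p i" "p i \<le> T" if "i \<le> n" for i
  proof -
    have "real i * h \<le> real n * h" using that h by (intro mult_right_mono) auto
    moreover have "real n * h = t - s" using n0 by (simp add: h_def)
    ultimately show "0 \<le> p i" "p i \<le> T" using st h by (auto simp: p_def)
  qed
  define R where "R i j = (\<Sum>l=i..<j. germ (p l) (p (Suc l)) (y (p l))) - germ (p i) (p j) (y (p i))" for i j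
  have "norm (R 0 n) \<le> 3 * C ^ 6 * P / gap * (real n * h - real 0 * h) powr (3 * \<beta>)"
  proof (rule discrete_sewing[where a = 0 and b = n])
    show "1 < 3 * \<beta>" "0 < h" "0 \<le> (0::nat)" "0 < n" "n \<le> n" using \<beta> h n0 by auto
    show "0 \<le> 3 * C ^ 6 * P / gap" using C P gap_pos by simp
    show "R i (Suc i) = 0" for i by (simp add: R_def)
    fix i k j assume ikj: "i < k" "k < j" "j \<le> n"
    have "R i j - R i k - R k j = germ (p i) (p k) (y (p i)) + germ (p k) (p j) (y (p k))
        - germ (p i) (p j) (y (p i))"
      using sum.atLeastLessThan_concat[of i k j "\<lambda>l. germ (p l) (p (Suc l)) (y (p l))"] ikj
      by (simp add: R_def algebra_simps)
    also have "norm \<dots> \<le> 3 * C ^ 6 * P * (wt (p i) (p j)) ^ 3"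
    proof (rule germ_delta_bound)
      show "0 \<le> p i" "p i < p k" "p k < p j" "p j \<le> T" "1 \<le> P"
        using ikj p_range p_mono P by auto
      have ww: "wt (p i) (p k) \<le> wt (p i) (p j)"
        using p_mono[of i k] p_mono[of k j] ikj by (intro wt_mono) auto
      have P0: "0 \<le> P" using P by simp
      show "norm (y (p k) - y (p i)) \<le> P * wt (p i) (p j)"
        using order.trans[OF y[of "p i" "p k"] mult_left_mono[OF ww P0]] ikj p_range p_mono by auto
      show "norm (y (p k) - y (p i) - g (y (p i)) (X (p k) - X (p i))) \<le> P * (wt (p i) (p j))\<^sup>2"
        using order.trans[OF r[of "p i" "p k"] mult_left_mono[OF power_mono[OF ww wt_nonneg] P0]]
          ikj p_range p_mono by auto
    qed
    also have "(wt (p i) (p j)) ^ 3 = (real j * h - real i * h) powr (3 * \<beta>)"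
      using p_mono[of i j] ikj by (simp add: wt_cube p_def)
    also have "3 * C ^ 6 * P = (1 - (2/3) powr (3 * \<beta> - 1)) * (3 * C ^ 6 * P / gap)"
      using gap_pos by (simp flip: gap_def)
    finally show "norm (R i j - R i k - R k j)
      \<le> (1 - (2/3) powr (3 * \<beta> - 1)) * (3 * C ^ 6 * P / gap) * (real j * h - real i * h) powr (3 * \<beta>)" .
  qed
  also have "real n * h - real 0 * h = t - s" using n0 by (simp add: h_def)
  finally have 1: "norm (R 0 n) \<le> 3 * C ^ 6 * P / gap * (t - s) powr (3 * \<beta>)" .
  have "norm ((\<Sum>i<n. germ (p i) (p (Suc i)) (y (p i))) - I) < \<epsilon>"
    using p_mono h pn by (intro \<eta>(2)[rule_format]) (auto simp: p_def algebra_simps)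
  then have 2: "norm (I - (\<Sum>i<n. germ (p i) (p (Suc i)) (y (p i)))) \<le> \<epsilon>"
    by (simp add: norm_minus_commute)
  have "I - germ s t (y s) = R 0 n + (I - (\<Sum>i<n. germ (p i) (p (Suc i)) (y (p i))))"
    by (simp add: R_def pn lessThan_atLeast0)
  then show "norm (I - germ s t (y s)) \<le> 3 * C ^ 6 * P / gap * (t - s) powr (3 * \<beta>) + \<epsilon>"
    using norm_triangle_mono[OF 1 2] by (simp only:)
qed

text \<open>The error per cell has an order above 1, so the total error is at most the length of the
  interval times a positive power of the mesh.\<close>

lemma partition_limit_of_additive:
  fixes y J :: "real \<Rightarrow> 'e"
  assumes st: "s \<le> t" and \<sigma>: "0 < \<sigma>" and K: "0 \<le> K"
    and J: "\<And>u v. s \<le> u \<Longrightarrow> u < v \<Longrightarrow> v \<le> t \<Longrightarrow> v - u \<le> \<sigma> \<Longrightarrow>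
      norm (germ u v (y u) - (J v - J u)) \<le> K * (v - u) powr (3 * \<beta>)"
  shows "has_partition_limit (\<lambda>u v. germ u v (y u)) s t (J t - J s)"
  unfolding has_partition_limit_def
proof (intro allI impI)
  fix \<epsilon> :: real assume \<epsilon>: "0 < \<epsilon>"
  \<comment> \<open>The mesh will satisfy \<open>r powr (3 * \<beta> - 1) \<le> 1 / c\<close>, and
    the added 1 makes the total error \<open>K * (t - s) / c\<close> strictly smaller than
    \<open>\<epsilon>\<close>.\<close>
  define c where "c = (K * (t - s) + 1) / \<epsilon>"
  have Kts: "0 \<le> K * (t - s)" using K st by simp
  have c: "0 < c" using Kts \<epsilon> by (simp add: c_def)
  obtain q :: nat where q: "1 / 2 ^ q \<le> \<sigma>"
    "\<And>r. 0 \<le> r \<Longrightarrow> r \<le> 1 / 2 ^ q \<Longrightarrow> c * r powr (3 * \<beta> - 1) \<le> 1"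
    using small_dyadic_scale[of "3 * \<beta> - 1" c \<sigma>] \<beta> c \<sigma> by auto
  show "\<exists>\<eta>>0. \<forall>n p. p 0 = s \<and> p n = t \<and> (\<forall>i<n. p i < p (Suc i) \<and> p (Suc i) - p i < \<eta>) \<longrightarrow>
      norm ((\<Sum>i<n. germ (p i) (p (Suc i)) (y (p i))) - (J t - J s)) < \<epsilon>"
  proof (intro exI[of _ "1 / 2 ^ q"] conjI allI impI)
    show "0 < 1 / (2::real) ^ q" by simp
    fix n :: nat and p :: "nat \<Rightarrow> real"
    assume "p 0 = s \<and> p n = t \<and> (\<forall>i<n. p i < p (Suc i) \<and> p (Suc i) - p i < 1 / 2 ^ q)"
    then have p: "p 0 = s" "p n = t" and inc: "\<And>i. i < n \<Longrightarrow> p i < p (Suc i) \<and> p (Suc i) - p i < 1 / 2 ^ q"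
      by auto
    have p_mono: "p i \<le> p j" if "i \<le> j" "j \<le> n" for i j
      using that
    proof (induction j rule: dec_induct)
      case (step j)
      then show ?case using inc[of j] by simp
    qed simp
    have sum_inc: "(\<Sum>i<n. p (Suc i) - p i) = t - s"
      using sum_lessThan_telescope[of p n] p by simp
    have "(\<Sum>i<n. germ (p i) (p (Suc i)) (y (p i))) - (J t - J s)
        = (\<Sum>i<n. germ (p i) (p (Suc i)) (y (p i)) - (J (p (Suc i)) - J (p i)))"
      using sum_lessThan_telescope[of "\<lambda>i. J (p i)" n] p by (simp add: sum_subtractf)
    also have "norm \<dots> \<le> (\<Sum>i<n. (K / c) * (p (Suc i) - p i))"
    proof (rule sum_norm_le)
      fix i assume "i \<in> {..<n}"
      then have i: "i < n" by simp
      let ?d = "p (Suc i) - p i"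
      have d: "0 < ?d" "?d \<le> 1 / 2 ^ q" using inc[OF i] by auto
      have "norm (germ (p i) (p (Suc i)) (y (p i)) - (J (p (Suc i)) - J (p i))) \<le> K * ?d powr (3 * \<beta>)"
        using inc[OF i] p p_mono[of 0 i] p_mono[of "Suc i" n] i q(1) by (intro J) auto
      also have "?d powr (3 * \<beta>) = ?d powr (3 * \<beta> - 1) * ?d"
        using d by (simp add: powr_diff)
      also have "?d powr (3 * \<beta> - 1) \<le> 1 / c"
        using q(2)[of ?d] d c by (simp add: field_simps)
      finally show "norm (germ (p i) (p (Suc i)) (y (p i)) - (J (p (Suc i)) - J (p i))) \<le> (K / c) * ?d"
        using d K by (simp add: mult_left_mono mult_right_mono)
    qed
    also have "\<dots> = (K * (t - s)) / (K * (t - s) + 1) * \<epsilon>"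
      unfolding sum_distrib_left[symmetric] sum_inc by (simp add: c_def)
    also have "\<dots> < 1 * \<epsilon>"
      using \<epsilon> Kts by (intro mult_strict_right_mono) auto
    finally show "norm ((\<Sum>i<n. germ (p i) (p (Suc i)) (y (p i))) - (J t - J s)) < \<epsilon>" by simp
  qed
qed

end

section \<open>Davie paths are exactly the solutions of the integral equation\<close>

locale euclidean_rough_rde = rough_rde b g F X X2 Dg C \<beta> T
  for b :: "'e::euclidean_space \<Rightarrow> 'e"
    and g :: "'e \<Rightarrow> 'v::real_normed_vector \<Rightarrow>\<^sub>L 'e"
    and F :: "'e \<Rightarrow> 'w::real_normed_vector \<Rightarrow>\<^sub>L 'e"
    and X :: "real \<Rightarrow> 'v" and X2 :: "real \<Rightarrow> real \<Rightarrow> 'w"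
    and Dg :: "'e \<Rightarrow> 'e \<Rightarrow>\<^sub>L 'v \<Rightarrow>\<^sub>L 'e" and C \<beta> T :: real
begin

text \<open>The operator form of \<open>rde_solution\<close> without the initial condition, arranged
  so that the two agree by unfolding once \<open>Dg_g\<close> is written as a contraction.\<close>

definition solution :: "(real \<Rightarrow> 'e) \<Rightarrow> bool"
  where "solution y \<longleftrightarrow> hoelder_on \<beta> {0..T} y \<and>
    (\<exists>K. \<forall>s t. 0 \<le> s \<and> s \<le> t \<and> t \<le> T \<longrightarrow>
      norm ((y t - y s) - g (y s) (X t - X s)) \<le> K * \<bar>t - s\<bar> powr (2 * \<beta>)) \<and>
    (\<forall>s t. 0 \<le> s \<and> s \<le> t \<and> t \<le> T \<longrightarrow>
      (\<exists>I. has_partition_limit (\<lambda>u v. germ u v (y u)) s t I \<and> y t - y s = (LBINT r=s..t. b (y r)) + I))"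

lemma continuous_b: "continuous_on S b"
  by (rule lipschitz_on_continuous_on[of C])
     (use b_lip C in \<open>auto simp: lipschitz_on_def dist_norm\<close>)

lemma continuous_of_increments:
  assumes "\<And>s t. 0 \<le> s \<Longrightarrow> s < t \<Longrightarrow> t \<le> T \<Longrightarrow> norm (y t - y s) \<le> P * wt s t"
  shows "continuous_on {0..T} y"
  unfolding continuous_on_iff
proof (intro ballI allI impI)
  fix s and e :: real assume s: "s \<in> {0..T}" and e: "0 < e"
  obtain q :: nat where q: "\<And>r. 0 \<le> r \<Longrightarrow> r \<le> 1 / 2 ^ q \<Longrightarrow> (2 * \<bar>P\<bar> / e) * r powr \<beta> \<le> 1"
    using small_dyadic_scale[of \<beta> "2 * \<bar>P\<bar> / e" 1] \<beta> e by auto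
  have *: "dist (y v) (y u) < e" if "0 \<le> u" "u < v" "v \<le> T" "v - u < 1 / 2 ^ q" for u v
  proof -
    have "dist (y v) (y u) \<le> P * wt u v" using assms that by (simp add: dist_norm)
    also have "\<dots> \<le> \<bar>P\<bar> * wt u v" by (intro mult_right_mono) auto
    also have "\<dots> \<le> e / 2" using q[of "v - u"] that e by (simp add: wt_def field_simps)
    finally show ?thesis using e by simp
  qed
  show "\<exists>d>0. \<forall>t\<in>{0..T}. dist t s < d \<longrightarrow> dist (y t) (y s) < e"
  proof (intro exI[of _ "1 / 2 ^ q"] conjI ballI impI)
    fix t assume t: "t \<in> {0..T}" "dist t s < 1 / 2 ^ q"
    show "dist (y t) (y s) < e"
      using *[of s t] *[of t s] s t e
      by (cases s t rule: linorder_cases) (auto simp: dist_real_def dist_commute)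
  qed simp
qed

lemma drift_bound:
  assumes y: "continuous_on {0..T} y" and P: "0 \<le> P"
    and inc: "\<And>r. s < r \<Longrightarrow> r \<le> t \<Longrightarrow> norm (y r - y s) \<le> P * wt s r"
    and st: "0 \<le> s" "s < t" "t \<le> T" "t - s \<le> 1"
  shows "norm ((LBINT r=s..t. b (y r)) - (t - s) *\<^sub>R b (y s)) \<le> C * P * (t - s) powr (3 * \<beta>)"
proof -
  have cont: "continuous_on {s..t} (\<lambda>r. b (y r))"
    by (rule continuous_on_compose2[OF continuous_b[of UNIV] continuous_on_subset[OF y]])
       (use st in auto)
  have "(LBINT r=s..t. b (y r)) - (t - s) *\<^sub>R b (y s) = (LBINT r=s..t. b (y r) - b (y s))"
    using st cont by (simp add: interval_integral_continuous continuous_on_diff integral_diff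
        integrable_continuous_interval)
  also have "norm \<dots> \<le> (C * (P * wt s t)) * (t - s)"
  proof (rule norm_interval_integral_le)
    fix r assume r: "s \<le> r" "r \<le> t"
    have "norm (y r - y s) \<le> P * wt s t"
    proof (cases "r = s")
      case False
      then show ?thesis
        using order.trans[OF inc[of r] mult_left_mono[OF wt_mono P]] r by simp
    qed (use P in simp)
    then show "norm (b (y r) - b (y s)) \<le> C * (P * wt s t)"
      using order.trans[OF b_lip mult_left_mono] C by simp
  qed (use st cont in \<open>auto intro!: continuous_intros\<close>)
  also have "\<dots> \<le> (C * (P * wt s t)) * (wt s t)\<^sup>2"
    using le_wt_square[of s t] st C P by (intro mult_left_mono) auto
  also have "\<dots> = C * P * (t - s) powr (3 * \<beta>)"
    unfolding wt_cube[OF st(2), symmetric] by (simp add: power2_eq_square power3_eq_cube)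
  finally show ?thesis .
qed

text \<open>The defect of the one-step map splits into the drift integral against its left end value
  and the rough integral against its germ; each is of order \<open>3 * \<beta>\<close>.\<close>

lemma solution_davie:
  assumes "solution y"
  shows "\<exists>K\<ge>0. davie K 1 {0..T} y"
proof -
  from assms[unfolded solution_def hoelder_on_def] obtain c1 c2 where
    c1: "\<forall>s\<in>{0..T}. \<forall>t\<in>{0..T}. norm (y t - y s) \<le> c1 * \<bar>t - s\<bar> powr \<beta>" and
    c2: "\<forall>s t. 0 \<le> s \<and> s \<le> t \<and> t \<le> T \<longrightarrow>
      norm ((y t - y s) - g (y s) (X t - X s)) \<le> c2 * \<bar>t - s\<bar> powr (2 * \<beta>)" and
    int: "\<forall>s t. 0 \<le> s \<and> s \<le> t \<and> t \<le> T \<longrightarrow>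
      (\<exists>I. has_partition_limit (\<lambda>u v. germ u v (y u)) s t I \<and> y t - y s = (LBINT r=s..t. b (y r)) + I)"
    by blast
  define P where "P = 1 + \<bar>c1\<bar> + \<bar>c2\<bar>"
  have P: "1 \<le> P" "c1 \<le> P" "c2 \<le> P" by (auto simp: P_def)
  have inc: "norm (y t - y s) \<le> P * wt s t" if "0 \<le> s" "s < t" "t \<le> T" for s t
  proof -
    have "norm (y t - y s) \<le> c1 * wt s t" using c1[rule_format, of s t] that by (simp add: wt_def)
    also have "\<dots> \<le> P * wt s t" using P by (intro mult_right_mono) auto
    finally show ?thesis .
  qed
  have r: "norm (y t - y s - g (y s) (X t - X s)) \<le> P * (wt s t)\<^sup>2" if "0 \<le> s" "s < t" "t \<le> T" for s t
  proof -
    have "norm (y t - y s - g (y s) (X t - X s)) \<le> c2 * (wt s t)\<^sup>2"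
      using c2[rule_format, of s t] that by (simp add: wt_square)
    also have "\<dots> \<le> P * (wt s t)\<^sup>2" using P by (intro mult_right_mono) auto
    finally show ?thesis .
  qed
  have cont: "continuous_on {0..T} y" by (rule continuous_of_increments[OF inc])
  then have "bounded (y ` {0..T})"
    by (intro compact_imp_bounded compact_continuous_image) auto
  then obtain B where B: "0 < B" "\<And>t. t \<in> {0..T} \<Longrightarrow> norm (y t) \<le> B"
    unfolding bounded_pos by auto
  define K where "K = B + (C * P + 3 * C ^ 6 * P / gap)"
  have K1: "0 \<le> C * P + 3 * C ^ 6 * P / gap" using C P gap_pos by simp
  have "davie K 1 {0..T} y"
    unfolding davie_def
  proof (intro conjI ballI impI)
    fix s assume "s \<in> {0..T}"
    then show "norm (y s) \<le> K" using B(2)[of s] K1 by (simp add: K_def)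
  next
    fix s t assume "s \<in> {0..T}" "t \<in> {0..T}" "s < t \<and> t - s \<le> 1"
    then have st: "0 \<le> s" "s < t" "t \<le> T" "t - s \<le> 1" by auto
    obtain I where I: "has_partition_limit (\<lambda>u v. germ u v (y u)) s t I"
      "y t - y s = (LBINT r=s..t. b (y r)) + I"
      using int[rule_format, of s t] st by auto
    have "y t - step s t (y s) = (y t - y s) - (t - s) *\<^sub>R b (y s) - germ s t (y s)"
      by (simp add: step_def)
    also have "\<dots> = ((LBINT r=s..t. b (y r)) - (t - s) *\<^sub>R b (y s)) + (I - germ s t (y s))"
      unfolding I(2) by simp
    also have "norm \<dots> \<le> C * P * (t - s) powr (3 * \<beta>) + 3 * C ^ 6 * P / gap * (t - s) powr (3 * \<beta>)"
      using inc st P(1)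
      by (intro norm_triangle_mono drift_bound[OF cont] partition_limit_bound[OF P(1) inc r st(1-3) I(1)]) auto
    also have "\<dots> = (C * P + 3 * C ^ 6 * P / gap) * (t - s) powr (3 * \<beta>)" by (simp add: distrib_right)
    also have "\<dots> \<le> K * (t - s) powr (3 * \<beta>)"
      using B(1) by (intro mult_right_mono) (auto simp: K_def)
    finally show "norm (y t - step s t (y s)) \<le> K * (t - s) powr (3 * \<beta>)" .
  qed
  moreover have "0 \<le> K" using B(1) K1 by (simp add: K_def)
  ultimately show ?thesis by blast
qed

lemma davie_solution:
  assumes K: "0 \<le> K" and \<tau>: "0 < \<tau>" and d: "davie K \<tau> {0..T} y"
  shows "solution y"
proof -
  define \<sigma> where "\<sigma> = min \<tau> 1"
  have \<sigma>: "0 < \<sigma>" "\<sigma> \<le> \<tau>" "\<sigma> \<le> 1" using \<tau> by (auto simp: \<sigma>_def)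
  define P where "P = K_inc K"
  have P: "0 \<le> P" using K C by (simp add: P_def K_inc_def)
  have bound: "norm (y t) \<le> K" if "0 \<le> t" "t \<le> T" for t
    using d that by (simp add: davie_def)
  have local: "norm (y t - y s) \<le> P * wt s t"
      "norm (y t - y s - g (y s) (X t - X s)) \<le> P * (wt s t)\<^sup>2"
    if "0 \<le> s" "s < t" "t \<le> T" "t - s \<le> \<sigma>" for s t
    unfolding P_def using that \<sigma> davie_increments[OF d order.refl, of s t] by auto
  \<comment> \<open>The Davie condition speaks of times at most \<open>\<tau>\<close> apart, while
    \<open>solution\<close> asks for bounds on all of \<open>{0..T}\<close>; boundedness of the path
    covers the distant pairs.\<close>
  define P1 where "P1 = P + (K + K) / \<sigma> powr \<beta>"
  have inc: "norm (y t - y s) \<le> P1 * wt s t" if st: "0 \<le> s" "s < t" "t \<le> T" for s t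
    unfolding P1_def wt_def
  proof (rule powr_local_to_global)
    show "norm (y t - y s) \<le> K + K"
      using norm_triangle_le_diff[OF add_mono[OF bound[of t] bound[of s]]] st by simp
  qed (use st local(1)[of s t] \<sigma> P K \<beta> in \<open>auto simp: wt_def\<close>)
  define B where "B = (K + K) + C * (C * wt 0 T)"
  define P2 where "P2 = P + B / \<sigma> powr (2 * \<beta>)"
  have B0: "0 \<le> B" using K C by (simp add: B_def)
  have r: "norm ((y t - y s) - g (y s) (X t - X s)) \<le> P2 * (t - s) powr (2 * \<beta>)"
    if st: "0 \<le> s" "s < t" "t \<le> T" for s t
    unfolding P2_def
  proof (rule powr_local_to_global)
    have "norm (g (y s) (X t - X s)) \<le> C * (C * wt s t)"
      using st by (intro blinfun_le g_bound X_wt) auto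
    also have "\<dots> \<le> C * (C * wt 0 T)"
      using st C by (intro mult_left_mono wt_le_T) auto
    finally have "norm (g (y s) (X t - X s)) \<le> C * (C * wt 0 T)" .
    moreover have "norm (y t - y s) \<le> K + K"
      using norm_triangle_le_diff[OF add_mono[OF bound[of t] bound[of s]]] st by simp
    ultimately show "norm ((y t - y s) - g (y s) (X t - X s)) \<le> B"
      unfolding B_def by (rule order.trans[OF norm_triangle_ineq4 add_mono, rotated])
  qed (use st local(2)[of s t] \<sigma> P B0 \<beta> in \<open>auto simp: wt_square\<close>)
  have cont: "continuous_on {0..T} y" by (rule continuous_of_increments[OF inc])
  have by_cont: "continuous_on {0..T} (\<lambda>r. b (y r))"
    by (rule continuous_on_compose2[OF continuous_b[of UNIV] cont]) auto
  \<comment> \<open>The equation itself dictates the candidate for the rough integral, namely the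
    path minus its drift integral. Its increments are additive, and the Davie bound says that the
    germ approximates them.\<close>
  define J where "J t = y t - (LBINT r=ereal 0..t. b (y r))" for t
  have J_diff: "J t - J s = y t - y s - (LBINT r=s..t. b (y r))" if "0 \<le> s" "s \<le> t" "t \<le> T" for s t
    using interval_integral_combine[of 0 s t "\<lambda>r. b (y r)"] continuous_on_subset[OF by_cont] that
    by (simp add: J_def algebra_simps)
  show ?thesis
    unfolding solution_def
  proof (intro conjI allI impI)
    show "hoelder_on \<beta> {0..T} y"
      unfolding hoelder_on_def
    proof (intro exI[of _ P1] ballI)
      fix s t assume "s \<in> {0..T}" "t \<in> {0..T}"
      then show "norm (y t - y s) \<le> P1 * \<bar>t - s\<bar> powr \<beta>"
        using inc[of s t] inc[of t s]
        by (cases s t rule: linorder_cases) (auto simp: wt_def norm_minus_commute)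
    qed
    show "\<exists>K. \<forall>s t. 0 \<le> s \<and> s \<le> t \<and> t \<le> T \<longrightarrow>
      norm ((y t - y s) - g (y s) (X t - X s)) \<le> K * \<bar>t - s\<bar> powr (2 * \<beta>)"
    proof (intro exI[of _ P2] allI impI)
      fix s t assume "0 \<le> s \<and> s \<le> t \<and> t \<le> T"
      then show "norm ((y t - y s) - g (y s) (X t - X s)) \<le> P2 * \<bar>t - s\<bar> powr (2 * \<beta>)"
        using r[of s t] by (cases "s = t") (auto simp: blinfun.zero_right)
    qed
    fix s t assume st: "0 \<le> s \<and> s \<le> t \<and> t \<le> T"
    have "has_partition_limit (\<lambda>u v. germ u v (y u)) s t (J t - J s)"
    proof (rule partition_limit_of_additive[OF _ \<sigma>(1), of _ _ "K + C * P"])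
      fix u v assume uv: "s \<le> u" "u < v" "v \<le> t" "v - u \<le> \<sigma>"
      have "germ u v (y u) - (J v - J u)
          = ((LBINT r=u..v. b (y r)) - (v - u) *\<^sub>R b (y u)) - (y v - step u v (y u))"
        using J_diff[of u v] uv st by (simp add: step_def)
      also have "norm \<dots> \<le> C * P * (v - u) powr (3 * \<beta>) + K * (v - u) powr (3 * \<beta>)"
      proof (rule order.trans[OF norm_triangle_ineq4 add_mono])
        show "norm ((LBINT r=u..v. b (y r)) - (v - u) *\<^sub>R b (y u)) \<le> C * P * (v - u) powr (3 * \<beta>)"
          using uv st \<sigma> by (intro drift_bound[OF cont P] local(1)) auto
        show "norm (y v - step u v (y u)) \<le> K * (v - u) powr (3 * \<beta>)"
          using d uv st \<sigma> by (auto simp: davie_def)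
      qed
      finally show "norm (germ u v (y u) - (J v - J u)) \<le> (K + C * P) * (v - u) powr (3 * \<beta>)"
        by (simp add: algebra_simps)
    qed (use st K C P in auto)
    then show "\<exists>I. has_partition_limit (\<lambda>u v. germ u v (y u)) s t I \<and> y t - y s = (LBINT r=s..t. b (y r)) + I"
      using J_diff[of s t] st by (intro exI[of _ "J t - J s"]) auto
  qed
qed

end

subsection \<open>Measurability\<close>

lemma measurable_C0_borel_eval: "(\<lambda>\<omega>. \<omega> t) \<in> borel_measurable C0_borel"
proof (rule borel_measurableI)
  fix S :: "'a set" assume S: "open S"
  have sub: "{U. openin (C0_compact_open :: (real \<Rightarrow> 'a) topology) U} \<subseteq> Pow C0_paths"
    using openin_subset topspace_C0_compact_open by (metis (mono_tags) Pow_iff mem_Collect_eq subsetI)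
  have space: "space (C0_borel :: (real \<Rightarrow> 'a) measure) = C0_paths"
    unfolding C0_borel_def by (rule space_measure_of[OF sub])
  have "openin C0_compact_open {\<omega> \<in> C0_paths. \<omega> ` {t} \<subseteq> S}"
    unfolding C0_compact_open_def
    by (intro topology_generated_by_Basis CollectI exI[of _ "{t}"] exI[of _ S] conjI refl) (simp_all add: S)
  then have "{\<omega> \<in> C0_paths. \<omega> ` {t} \<subseteq> S} \<in> sets C0_borel"
    unfolding C0_borel_def sets_measure_of[OF sub] by (intro sigma_sets.Basic) simp
  moreover have "(\<lambda>\<omega>. \<omega> t) -` S \<inter> space C0_borel = {\<omega> \<in> C0_paths. \<omega> ` {t} \<subseteq> S}"
    unfolding space by auto
  ultimately show "(\<lambda>\<omega>. \<omega> t) -` S \<inter> space C0_borel \<in> sets C0_borel" by simp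
qed

locale measurable_shift =
  fixes M :: "(real \<Rightarrow> real ^ 'd) measure"
  assumes eval [measurable]: "\<And>t. (\<lambda>\<omega>. \<omega> t) \<in> borel_measurable M"
    and shift: "(\<lambda>(t, \<omega>). wiener_shift t \<omega>) \<in> borel \<Otimes>\<^sub>M M \<rightarrow>\<^sub>M M"
    and continuous: "\<And>\<omega>. \<omega> \<in> space M \<Longrightarrow> continuous_on UNIV \<omega>"
begin

text \<open>The difference quotient is an evaluation of the shifted path, so that joint measurability
  of the shift yields its joint measurability in time and path.\<close>

lemma measurable_increment_quotient [measurable]:
  "(\<lambda>(r, \<omega>). increment_quotient \<delta> \<omega> r) \<in> borel_measurable (borel \<Otimes>\<^sub>M M)"
proof -
  have "(\<lambda>p. (case p of (t, \<omega>) \<Rightarrow> wiener_shift t \<omega>) \<delta>) \<in> borel_measurable (borel \<Otimes>\<^sub>M M)"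
    by (rule measurable_compose[OF shift eval])
  then have "(\<lambda>p. (1 / \<delta>) *\<^sub>R (case p of (t, \<omega>) \<Rightarrow> wiener_shift t \<omega>) \<delta>) \<in> borel_measurable (borel \<Otimes>\<^sub>M M)"
    by measurable
  then show ?thesis
    unfolding increment_quotient_def wiener_shift_def split_beta' by (simp add: add.commute)
qed

text \<open>An integral over the whole line with the upper limit in the indicator, the form to which
  measurability of parameter integrals applies. It vanishes at negative times and stands for
  \<open>W_approx\<close> only at nonnegative ones.\<close>

definition W_int :: "real \<Rightarrow> real \<times> (real \<Rightarrow> real ^ 'd) \<Rightarrow> real ^ 'd"
  where "W_int \<delta> p = (\<integral>u. indicator {0<..<fst p} u *\<^sub>R increment_quotient \<delta> (snd p) u \<partial>lborel)"

lemma W_int_eq: "0 \<le> r \<Longrightarrow> W_int \<delta> (r, \<omega>) = W_approx \<delta> \<omega> r"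
proof -
  assume r: "0 \<le> r"
  have "W_approx \<delta> \<omega> r = (LBINT y=ereal 0..ereal r. increment_quotient \<delta> \<omega> y)"
    by (simp add: W_approx_def increment_quotient_def zero_ereal_def)
  then show ?thesis
    using r by (simp add: interval_lebesgue_integral_def set_lebesgue_integral_def W_int_def)
qed

lemma measurable_W_int [measurable]: "W_int \<delta> \<in> borel_measurable (borel \<Otimes>\<^sub>M M)"
proof -
  have [measurable]: "(\<lambda>q. increment_quotient \<delta> (snd (fst q)) (snd q))
      \<in> borel_measurable ((borel \<Otimes>\<^sub>M M) \<Otimes>\<^sub>M lborel)"
    using measurable_compose[of "\<lambda>q. (snd q, snd (fst q))" "(borel \<Otimes>\<^sub>M M) \<Otimes>\<^sub>M lborel" "borel \<Otimes>\<^sub>M M",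
        OF _ measurable_increment_quotient[of \<delta>]]
    by simp
  have "(\<lambda>q. indicator {0<..<fst (fst q)} (snd q) *\<^sub>R increment_quotient \<delta> (snd (fst q)) (snd q))
      \<in> borel_measurable ((borel \<Otimes>\<^sub>M M) \<Otimes>\<^sub>M lborel)"
    unfolding indicator_def greaterThanLessThan_iff by measurable
  then show ?thesis
    unfolding W_int_def[abs_def]
    by (intro lborel.borel_measurable_lebesgue_integral) (simp add: split_beta)
qed

lemma measurable_WW_approx:
  assumes "0 \<le> s" "s \<le> t"
  shows "(\<lambda>\<omega>. WW_approx \<delta> \<omega> s t) \<in> borel_measurable M"
proof -
  define H where "H q = indicator {s<..<t} (snd q) *\<^sub>R
    tensor (W_int \<delta> (snd q, fst q) - W_int \<delta> (s, fst q)) (increment_quotient \<delta> (fst q) (snd q))" for q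
  have iq: "(\<lambda>q. increment_quotient \<delta> (fst q) (snd q)) \<in> borel_measurable (M \<Otimes>\<^sub>M lborel)"
    using measurable_compose[of "\<lambda>q. (snd q, fst q)" "M \<Otimes>\<^sub>M lborel" "borel \<Otimes>\<^sub>M M",
        OF _ measurable_increment_quotient[of \<delta>]]
    by simp
  have W: "(\<lambda>q. W_int \<delta> (snd q, fst q) - W_int \<delta> (s, fst q)) \<in> borel_measurable (M \<Otimes>\<^sub>M lborel)"
    by measurable
  have tensor: "(\<lambda>q. tensor (W_int \<delta> (snd q, fst q) - W_int \<delta> (s, fst q)) (increment_quotient \<delta> (fst q) (snd q)))
      \<in> borel_measurable (M \<Otimes>\<^sub>M lborel)"
    by (rule borel_measurable_continuous_Pair[OF W iq])
       (intro tensor.continuous_on continuous_intros)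
  then have "H \<in> borel_measurable (M \<Otimes>\<^sub>M lborel)"
    unfolding H_def[abs_def] by measurable
  then have "(\<lambda>\<omega>. \<integral>r. H (\<omega>, r) \<partial>lborel) \<in> borel_measurable M"
    by (intro lborel.borel_measurable_lebesgue_integral) simp
  moreover have "WW_approx \<delta> \<omega> s t = (\<integral>r. H (\<omega>, r) \<partial>lborel)" if "\<omega> \<in> space M" for \<omega>
    unfolding WW_approx_eq[OF continuous[OF that]]
    using assms by (auto simp: interval_lebesgue_integral_def set_lebesgue_integral_def H_def W_int_eq
        intro!: Bochner_Integration.integral_cong split: split_indicator)
  ultimately show ?thesis by (simp cong: measurable_cong)
qed

lemma measurable_second_order:
  assumes st: "0 \<le> s" "s < t" "t \<le> T"
    and conv: "\<And>\<omega>. \<omega> \<in> space M \<Longrightarrow>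
      ((\<lambda>\<delta>. rough_dist \<beta> T (W_approx \<delta> \<omega>) (WW_approx \<delta> \<omega>) \<omega> (second_order \<omega>)) \<longlongrightarrow> 0) (at_right 0)"
  shows "(\<lambda>\<omega>. second_order \<omega> s t) \<in> borel_measurable M"
proof (rule borel_measurable_LIMSEQ_metric)
  show "(\<lambda>\<omega>. WW_approx (1 / real (Suc n)) \<omega> s t) \<in> borel_measurable M" for n
    using st by (intro measurable_WW_approx) auto
  fix \<omega> assume \<omega>: "\<omega> \<in> space M"
  \<comment> \<open>The limit as \<open>\<delta>\<close> decreases to 0 is realised along a
    sequence, since measurability passes only to countable limits.\<close>
  have "filterlim (\<lambda>n. 1 / real (Suc n)) (at_right 0) sequentially"
    unfolding filterlim_at using LIMSEQ_inverse_real_of_nat by (auto simp: inverse_eq_divide)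
  then show "(\<lambda>n. WW_approx (1 / real (Suc n)) \<omega> s t) \<longlonglongrightarrow> second_order \<omega> s t"
    using filterlim_compose[OF tendsto_WW_approx[OF conv[OF \<omega>], of s t]] st by auto
qed

end

lemma measurable_blinfun_apply:
  fixes F :: "'e::euclidean_space \<Rightarrow> 'w::euclidean_space \<Rightarrow>\<^sub>L 'f::euclidean_space"
  assumes "continuous_on UNIV F"
    and u: "u \<in> borel_measurable N" and v: "v \<in> borel_measurable N"
  shows "(\<lambda>p. F (u p) (v p)) \<in> borel_measurable N"
  by (rule borel_measurable_continuous_Pair[OF u v])
     (intro bounded_bilinear.continuous_on[OF bounded_bilinear_blinfun_apply] continuous_intros
       continuous_on_compose2[OF assms(1)], auto)

text \<open>A scheme value at a fixed index is measurable in path and initial value by induction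
  over the steps. Time enters \<open>euler_path\<close> only through a natural number index, so
  joint measurability is a countable case distinction and holds although the interpolation
  jumps.\<close>

lemma measurable_rde_flow:
  fixes b :: "'e::euclidean_space \<Rightarrow> 'e" and g :: "'e \<Rightarrow> 'v::euclidean_space \<Rightarrow>\<^sub>L 'e"
    and F :: "'e \<Rightarrow> 'w::euclidean_space \<Rightarrow>\<^sub>L 'e"
    and X :: "'o \<Rightarrow> real \<Rightarrow> 'v" and X2 :: "'o \<Rightarrow> real \<Rightarrow> real \<Rightarrow> 'w"
  assumes b: "continuous_on UNIV b" and g: "continuous_on UNIV g" and F: "continuous_on UNIV F"
    and X: "\<And>t. (\<lambda>\<omega>. X \<omega> t) \<in> borel_measurable M"
    and X2: "\<And>s t. 0 \<le> s \<Longrightarrow> s < t \<Longrightarrow> (\<lambda>\<omega>. X2 \<omega> s t) \<in> borel_measurable M"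
  shows "(\<lambda>(t, \<omega>, x). rde_data.flow b g F (X \<omega>) (X2 \<omega>) t x)
    \<in> restrict_space borel {0..} \<Otimes>\<^sub>M (M \<Otimes>\<^sub>M borel) \<rightarrow>\<^sub>M borel"
proof -
  have euler: "(\<lambda>p. rde_data.euler b g F (X (fst p)) (X2 (fst p)) n (snd p) k)
      \<in> borel_measurable (M \<Otimes>\<^sub>M borel)" for n k
  proof (induction k)
    case 0
    then show ?case by (simp add: rde_data.euler.simps)
  next
    case (Suc k)
    let ?y = "\<lambda>p. rde_data.euler b g F (X (fst p)) (X2 (fst p)) n (snd p) k"
    let ?s = "real k / 2 ^ n" and ?t = "real (Suc k) / 2 ^ n"
    have X': "(\<lambda>p. X (fst p) ?t - X (fst p) ?s) \<in> borel_measurable (M \<Otimes>\<^sub>M borel)"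
      using measurable_compose[OF measurable_fst X] by (intro borel_measurable_diff)
    have X2': "(\<lambda>p. X2 (fst p) ?s ?t) \<in> borel_measurable (M \<Otimes>\<^sub>M borel)"
      by (rule measurable_compose[OF measurable_fst X2]) (auto simp: divide_strict_right_mono)
    have b': "(\<lambda>p. b (?y p)) \<in> borel_measurable (M \<Otimes>\<^sub>M borel)"
      by (rule measurable_compose[OF Suc.IH borel_measurable_continuous_onI[OF b]])
    show ?case
      unfolding rde_data.euler.simps rde_data.step_def rde_data.germ_def
      by (intro borel_measurable_add borel_measurable_scaleR borel_measurable_const Suc.IH b'
          measurable_blinfun_apply[OF g Suc.IH X'] measurable_blinfun_apply[OF F Suc.IH X2'])
  qed
  let ?N = "restrict_space borel {0..} \<Otimes>\<^sub>M (M \<Otimes>\<^sub>M borel) :: (real \<times> 'o \<times> 'e) measure"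
  have "(\<lambda>q. rde_data.euler_path b g F (X (fst (snd q))) (X2 (fst (snd q))) n (snd (snd q)) (fst q))
      \<in> borel_measurable ?N" for n
  proof -
    have "(\<lambda>q. rde_data.euler b g F (X (fst (snd q))) (X2 (fst (snd q))) n (snd (snd q)) k)
        \<in> borel_measurable ?N" for k
      by (rule measurable_compose[OF measurable_snd euler[of n k]])
    moreover have "(\<lambda>q. nat \<lfloor>fst q * 2 ^ n\<rfloor>) \<in> ?N \<rightarrow>\<^sub>M count_space UNIV"
    proof -
      have "(\<lambda>t::real. nat \<lfloor>t * 2 ^ n\<rfloor>) \<in> restrict_space borel {0..} \<rightarrow>\<^sub>M count_space UNIV"
        by (rule measurable_restrict_space1) measurable
      from measurable_compose[OF measurable_fst this] show ?thesis .
    qed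
    ultimately show ?thesis
      unfolding rde_data.euler_path_def
      by (rule measurable_compose_countable)
  qed
  then have "(\<lambda>q. rde_data.flow b g F (X (fst (snd q))) (X2 (fst (snd q))) (fst q) (snd (snd q)))
      \<in> borel_measurable ?N"
    unfolding rde_data.flow_def by (rule borel_measurable_lim_metric)
  then show ?thesis by (simp add: split_beta)
qed

subsection \<open>The random dynamical system\<close>

text \<open>\<open>C\<close> depends on the path and on the horizon, whereas the fields do not;
  hence all these interpretations share the same \<open>flow\<close> for a given path.\<close>

lemma euclidean_rough_rde_of_lift:
  fixes \<omega> :: "real \<Rightarrow> real ^ 'd" and g :: "real ^ 'm \<Rightarrow> real ^ 'd ^ 'm"
  assumes field: "\<And>C. C0 \<le> C \<Longrightarrow>
      rough_field b (\<lambda>x. matrix_op (g x)) (\<lambda>x. contraction (D x) (g x)) (\<lambda>x. Blinfun matrix_op o\<^sub>L D x) C"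
    and \<beta>: "1/3 < \<beta>" "\<beta> \<le> 1/2"
    and \<omega>: "continuous_on UNIV \<omega>" "hoelder_on \<beta> {-T..T} \<omega>"
    and conv: "((\<lambda>\<delta>. rough_dist \<beta> T (W_approx \<delta> \<omega>) (WW_approx \<delta> \<omega>) \<omega> (second_order \<omega>)) \<longlongrightarrow> 0) (at_right 0)"
  shows "\<exists>C. euclidean_rough_rde b (\<lambda>x. matrix_op (g x)) (\<lambda>x. contraction (D x) (g x))
      \<omega> (second_order \<omega>) (\<lambda>x. Blinfun matrix_op o\<^sub>L D x) C \<beta> T"
proof -
  obtain c1 where c1: "\<forall>s\<in>{-T..T}. \<forall>t\<in>{-T..T}. norm (\<omega> t - \<omega> s) \<le> c1 * \<bar>t - s\<bar> powr \<beta>"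
    using \<omega>(2) unfolding hoelder_on_def by blast
  obtain c2 where c2: "\<forall>s t. -T \<le> s \<longrightarrow> s < t \<longrightarrow> t \<le> T \<longrightarrow>
      norm (second_order \<omega> s t) \<le> c2 * \<bar>t - s\<bar> powr (2 * \<beta>)"
    using second_order_hoelder[OF conv \<omega>(1)] \<beta> by auto
  define C where "C = \<bar>C0\<bar> + \<bar>c1\<bar> + \<bar>c2\<bar>"
  have le_C: "C0 \<le> C" "c1 \<le> C" "c2 \<le> C" by (auto simp: C_def)
  interpret rough_field b "\<lambda>x. matrix_op (g x)" "\<lambda>x. contraction (D x) (g x)"
    "\<lambda>x. Blinfun matrix_op o\<^sub>L D x" C
    by (rule field[OF le_C(1)])
  have "euclidean_rough_rde b (\<lambda>x. matrix_op (g x)) (\<lambda>x. contraction (D x) (g x))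
      \<omega> (second_order \<omega>) (\<lambda>x. Blinfun matrix_op o\<^sub>L D x) C \<beta> T"
  proof
    show "1/3 < \<beta>" "\<beta> \<le> 1/2" by (rule \<beta>)+
    fix s t :: real assume st: "0 \<le> s" "s < t" "t \<le> T"
    have "norm (\<omega> t - \<omega> s) \<le> c1 * (t - s) powr \<beta>"
      using c1[rule_format, of s t] st by auto
    also have "\<dots> \<le> C * (t - s) powr \<beta>" using le_C by (intro mult_right_mono) auto
    finally show "norm (\<omega> t - \<omega> s) \<le> C * (t - s) powr \<beta>" .
    have "norm (second_order \<omega> s t) \<le> c2 * ((t - s) powr \<beta>)\<^sup>2"
      using c2[rule_format, of s t] st by (simp add: powr_power mult.commute)
    also have "\<dots> \<le> C * ((t - s) powr \<beta>)\<^sup>2" using le_C by (intro mult_right_mono) auto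
    finally show "norm (second_order \<omega> s t) \<le> C * ((t - s) powr \<beta>)\<^sup>2" .
  next
    fix x s u t assume "0 \<le> s" "s < u" "u < t" "t \<le> T"
    then have "second_order \<omega> s t = second_order \<omega> s u + second_order \<omega> u t + tensor (\<omega> u - \<omega> s) (\<omega> t - \<omega> u)"
      by (intro second_order_chen[OF conv \<omega>(1)]) auto
    then show "contraction (D x) (g x) (second_order \<omega> s t)
      = contraction (D x) (g x) (second_order \<omega> s u) + contraction (D x) (g x) (second_order \<omega> u t)
        + (Blinfun matrix_op o\<^sub>L D x) (matrix_op (g x) (\<omega> u - \<omega> s)) (\<omega> t - \<omega> u)"
      by (simp add: blinfun.add_right contraction_tensor
          bounded_linear_Blinfun_apply[OF bounded_linear_matrix_op])
  qed
  then show ?thesis by blast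
qed

theorem theorem4p2:
  fixes H \<beta> :: real
    and A :: "real ^ 'm ^ 'm"
    and f :: "real ^ 'm \<Rightarrow> real ^ 'm"
    and g :: "real ^ 'm \<Rightarrow> real ^ 'd ^ 'm"
    and P :: "(real \<Rightarrow> real ^ 'd) measure"
    and \<Omega>' :: "(real \<Rightarrow> real ^ 'd) set"
  assumes "1 / 3 < H" and "H \<le> 1 / 2"
    and "1 / 3 < \<beta>" and "\<beta> < H"
    and "canonical_fbm H P"
    and "rough_lift_domain \<beta> P \<Omega>'"
    and "metric_dynamical_system (restrict_space P \<Omega>') wiener_shift"
    and "\<exists>L. L-lipschitz_on UNIV f"
    and "Cb3 g"
  shows "\<exists>\<phi> :: real \<Rightarrow> (real \<Rightarrow> real ^ 'd) \<Rightarrow> real ^ 'm \<Rightarrow> real ^ 'm.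
    random_dynamical_system (restrict_space P \<Omega>') wiener_shift \<phi> \<and>
    (\<forall>\<omega>\<in>\<Omega>'. \<forall>\<xi>. \<forall>T>0.
      rde_solution \<beta> A f g \<omega> T \<xi> (\<lambda>t. \<phi> t \<omega> \<xi>) \<and>
      (\<forall>y. rde_solution \<beta> A f g \<omega> T \<xi> y \<longrightarrow> (\<forall>t\<in>{0..T}. y t = \<phi> t \<omega> \<xi>)))"
proof -
  obtain L where L: "L-lipschitz_on UNIV f" using assms(8) by blast
  define b where "b x = A *v x + f x" for x
  define M where "M = restrict_space P \<Omega>'"
  from rough_field_of_Cb3[OF L assms(9), of A, folded b_def] obtain D C0 where
    Dg: "\<And>x. Dg_g g x = blinfun_apply (contraction (D x) (g x))" and
    field: "\<And>C. C0 \<le> C \<Longrightarrow>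
      rough_field b (\<lambda>x. matrix_op (g x)) (\<lambda>x. contraction (D x) (g x)) (\<lambda>x. Blinfun matrix_op o\<^sub>L D x) C"
    by blast
  let ?g = "\<lambda>x. matrix_op (g x)" and ?F = "\<lambda>x. contraction (D x) (g x)"
    and ?D = "\<lambda>x. Blinfun matrix_op o\<^sub>L D x"
  define \<phi> where "\<phi> t \<omega> x = rde_data.flow b ?g ?F \<omega> (second_order \<omega>) t x" for t \<omega> x
  have sets_P: "sets P = sets (restrict_space C0_borel (fbm_paths H))"
    using assms(5) by (simp add: canonical_fbm_def)
  have \<Omega>'_P: "\<Omega>' \<in> sets P" and shift_\<Omega>': "\<And>t. wiener_shift t ` \<Omega>' = \<Omega>'"
    and conv: "\<And>\<omega> T. \<omega> \<in> \<Omega>' \<Longrightarrow> 0 < T \<Longrightarrow>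
      ((\<lambda>\<delta>. rough_dist \<beta> T (W_approx \<delta> \<omega>) (WW_approx \<delta> \<omega>) \<omega> (second_order \<omega>)) \<longlongrightarrow> 0) (at_right 0)"
    using assms(6) by (auto simp: rough_lift_domain_def)
  have space_M: "space M = \<Omega>'"
    using sets.sets_into_space[OF \<Omega>'_P] by (auto simp: M_def space_restrict_space)
  have \<Omega>'_fbm: "\<omega> \<in> fbm_paths H" if "\<omega> \<in> \<Omega>'" for \<omega>
    using sets.sets_into_space[OF \<Omega>'_P] sets_eq_imp_space_eq[OF sets_P] that
    by (auto simp: space_restrict_space)
  have cont: "continuous_on UNIV \<omega>" if "\<omega> \<in> \<Omega>'" for \<omega>
    using \<Omega>'_fbm[OF that] by (auto simp: fbm_paths_def C0_paths_def)
  have hoelder: "hoelder_on \<beta> {-T..T} \<omega>" if "\<omega> \<in> \<Omega>'" "0 < T" for \<omega> T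
    using \<Omega>'_fbm[OF that(1)] that(2) assms(3,4) by (auto simp: fbm_paths_def)
  have rde: "\<exists>C. euclidean_rough_rde b ?g ?F \<omega> (second_order \<omega>) ?D C \<beta> T" if "\<omega> \<in> \<Omega>'" "0 < T" for \<omega> T
    using assms(2-4) that
    by (intro euclidean_rough_rde_of_lift[OF field] cont hoelder conv) auto
  have \<phi>_0: "\<phi> 0 \<omega> x = x" for \<omega> x
    by (simp add: \<phi>_def rde_data.flow_def rde_data.euler_path_def rde_data.euler.simps limI)
  \<comment> \<open>Apart from the initial condition both sides are the same formula once the matrix
    products are read as operators.\<close>
  have solution_iff: "rde_solution \<beta> A f g \<omega> T \<xi> y \<longleftrightarrow>
      y 0 = \<xi> \<and> euclidean_rough_rde.solution b ?g ?F \<omega> (second_order \<omega>) \<beta> T y"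
    if "euclidean_rough_rde b ?g ?F \<omega> (second_order \<omega>) ?D C \<beta> T" for \<omega> T \<xi> y C
    unfolding rde_solution_def controlled_on_def has_rough_integral_def
      euclidean_rough_rde.solution_def[OF that] rde_data.germ_def Dg b_def matrix_op_apply ..
  have "rde_solution \<beta> A f g \<omega> T \<xi> (\<lambda>t. \<phi> t \<omega> \<xi>) \<and>
      (\<forall>y. rde_solution \<beta> A f g \<omega> T \<xi> y \<longrightarrow> (\<forall>t\<in>{0..T}. y t = \<phi> t \<omega> \<xi>))"
    if \<omega>T: "\<omega> \<in> \<Omega>'" "0 < T" for \<omega> T \<xi>
  proof -
    obtain C where C: "euclidean_rough_rde b ?g ?F \<omega> (second_order \<omega>) ?D C \<beta> T"
      using rde[OF \<omega>T] by blast
    interpret R: euclidean_rough_rde b ?g ?F \<omega> "second_order \<omega>" ?D C \<beta> T by (rule C)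
    have "R.solution (\<lambda>t. \<phi> t \<omega> \<xi>)"
      using R.flow_davie[of \<xi>] R.davie_solution unfolding \<phi>_def by blast
    then have "rde_solution \<beta> A f g \<omega> T \<xi> (\<lambda>t. \<phi> t \<omega> \<xi>)"
      by (simp add: solution_iff[OF C] \<phi>_0)
    moreover have "y t = \<phi> t \<omega> \<xi>" if y: "rde_solution \<beta> A f g \<omega> T \<xi> y" and t: "t \<in> {0..T}" for y t
    proof -
      have "R.solution y" and y0: "y 0 = \<xi>" using y by (simp_all add: solution_iff[OF C])
      then obtain K where "0 \<le> K" "R.davie K 1 {0..T} y" using R.solution_davie by blast
      then have "y t = R.flow t (y 0)" using t by (intro R.davie_unique) auto
      then show ?thesis by (simp add: \<phi>_def y0)
    qed
    ultimately show ?thesis by blast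
  qed
  moreover have "random_dynamical_system M wiener_shift \<phi>"
    unfolding random_dynamical_system_def
  proof (intro conjI ballI allI impI)
    have "measurable_shift M"
    proof
      fix t
      have "(\<lambda>\<omega>. \<omega> t) \<in> borel_measurable P"
        unfolding measurable_cong_sets[OF sets_P refl]
        by (rule measurable_restrict_space1[OF measurable_C0_borel_eval])
      then show "(\<lambda>\<omega>. \<omega> t) \<in> borel_measurable M"
        unfolding M_def by (rule measurable_restrict_space1)
      show "(\<lambda>(t, \<omega>). wiener_shift t \<omega>) \<in> borel \<Otimes>\<^sub>M M \<rightarrow>\<^sub>M M"
        using assms(7) by (simp add: metric_dynamical_system_def M_def)
    qed (simp add: space_M cont)
    then interpret S: measurable_shift M .
    \<comment> \<open>Measurability concerns all paths at once, so only the fields are interpreted,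
      with the constant \<open>C0\<close> that is common to all paths.\<close>
    interpret field: rough_field b ?g ?F ?D C0 by (rule field) simp
    have lip_cont: "continuous_on UNIV h" if "\<And>x y. norm (h x - h y) \<le> C0 * norm (x - y)"
      for h :: "real ^ 'm \<Rightarrow> 'x::real_normed_vector"
      by (rule lipschitz_on_continuous_on[of C0])
         (use that field.C in \<open>auto simp: lipschitz_on_def dist_norm\<close>)
    have F_lip: "norm (?F x - ?F y) \<le> C0 * norm (x - y)" for x y
      using field.F_diff[of y "x - y" y 0] by simp
    show "(\<lambda>(t, \<omega>, x). \<phi> t \<omega> x) \<in> restrict_space borel {0..} \<Otimes>\<^sub>M (M \<Otimes>\<^sub>M borel) \<rightarrow>\<^sub>M borel"
      unfolding \<phi>_def
    proof (rule measurable_rde_flow)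
      show "continuous_on UNIV b" by (rule lip_cont[OF field.b_lip])
      show "continuous_on UNIV ?g" by (rule lip_cont[OF field.g_lip])
      show "continuous_on UNIV ?F" by (rule lip_cont[OF F_lip])
      show "(\<lambda>\<omega>. \<omega> t) \<in> borel_measurable M" for t by (rule S.eval)
      \<comment> \<open>The horizon is taken to be \<open>t\<close> itself, which is positive
        because \<open>0 \<le> s\<close> and \<open>s < t\<close>.\<close>
      show "(\<lambda>\<omega>. second_order \<omega> s t) \<in> borel_measurable M" if "0 \<le> s" "s < t" for s t
        using that by (intro S.measurable_second_order[OF _ _ order.refl conv]) (auto simp: space_M)
    qed
  next
    show "\<phi> 0 \<omega> x = x" for \<omega> x by (rule \<phi>_0)
  next
    fix t\<^sub>1 t\<^sub>2 :: real and \<omega> x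
    assume t: "0 \<le> t\<^sub>1" "0 \<le> t\<^sub>2" and "\<omega> \<in> space M"
    then have \<omega>: "\<omega> \<in> \<Omega>'" by (simp add: space_M)
    let ?\<omega> = "wiener_shift t\<^sub>1 \<omega>"
    have \<omega>': "?\<omega> \<in> \<Omega>'" using shift_\<Omega>' \<omega> by blast
    \<comment> \<open>The added 1 keeps the horizons positive when the times vanish.\<close>
    obtain C where C: "euclidean_rough_rde b ?g ?F \<omega> (second_order \<omega>) ?D C \<beta> (t\<^sub>1 + t\<^sub>2 + 1)"
      using rde[OF \<omega>, of "t\<^sub>1 + t\<^sub>2 + 1"] t by auto
    obtain C' where C': "euclidean_rough_rde b ?g ?F ?\<omega> (second_order ?\<omega>) ?D C' \<beta> (t\<^sub>2 + 1)"
      using rde[OF \<omega>', of "t\<^sub>2 + 1"] t by auto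
    interpret R: euclidean_rough_rde b ?g ?F \<omega> "second_order \<omega>" ?D C \<beta> "t\<^sub>1 + t\<^sub>2 + 1" by (rule C)
    interpret R': euclidean_rough_rde b ?g ?F ?\<omega> "second_order ?\<omega>" ?D C' \<beta> "t\<^sub>2 + 1" by (rule C')
    obtain K \<tau> where K: "0 \<le> K" "0 < \<tau>" "R.davie K \<tau> {0..t\<^sub>1 + t\<^sub>2 + 1} (\<lambda>t. R.flow t x)"
      using R.flow_davie by blast
    have step: "R'.step s t y = R.step (t\<^sub>1 + s) (t\<^sub>1 + t) y" if "s < t" for s t y
    proof -
      have X: "?\<omega> t - ?\<omega> s = \<omega> (t\<^sub>1 + t) - \<omega> (t\<^sub>1 + s)"
        by (simp add: wiener_shift_def add.commute)
      have X2: "second_order ?\<omega> s t = second_order \<omega> (t\<^sub>1 + s) (t\<^sub>1 + t)"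
        using second_order_shift[OF cont[OF \<omega>], of s t t\<^sub>1] that by (simp add: add.commute)
      show ?thesis
        unfolding rde_data.step_def rde_data.germ_def X X2 by simp
    qed
    \<comment> \<open>The one-step maps of the shifted path are those of the original path at
      shifted times. The trajectory after time \<open>t\<^sub>1\<close> is therefore a Davie path
      for the shifted driver with unchanged constants, and uniqueness identifies it with the flow
      started at its value there.\<close>
    have "R'.davie K \<tau> {0..t\<^sub>2 + 1} (\<lambda>t. R.flow (t\<^sub>1 + t) x)"
      unfolding R'.davie_def
    proof (intro conjI ballI impI)
      fix s assume "s \<in> {0..t\<^sub>2 + 1}"
      then show "norm (R.flow (t\<^sub>1 + s) x) \<le> K"
        using K(3) t by (auto simp: R.davie_def)
    next
      fix s t assume "s \<in> {0..t\<^sub>2 + 1}" "t \<in> {0..t\<^sub>2 + 1}" and st: "s < t \<and> t - s \<le> \<tau>"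
      then have "norm (R.flow (t\<^sub>1 + t) x - R.step (t\<^sub>1 + s) (t\<^sub>1 + t) (R.flow (t\<^sub>1 + s) x))
          \<le> K * ((t\<^sub>1 + t) - (t\<^sub>1 + s)) powr (3 * \<beta>)"
        using \<open>0 \<le> t\<^sub>1\<close> by (intro K(3)[unfolded R.davie_def, THEN conjunct2, rule_format]) auto
      then show "norm (R.flow (t\<^sub>1 + t) x - R'.step s t (R.flow (t\<^sub>1 + s) x)) \<le> K * (t - s) powr (3 * \<beta>)"
        using st by (simp add: step)
    qed
    from R'.davie_unique[OF K(1,2) this, of t\<^sub>2] t
    have "R.flow (t\<^sub>1 + t\<^sub>2) x = R'.flow t\<^sub>2 (R.flow t\<^sub>1 x)" by simp
    then show "\<phi> (t\<^sub>1 + t\<^sub>2) \<omega> x = \<phi> t\<^sub>2 ?\<omega> (\<phi> t\<^sub>1 \<omega> x)" by (simp add: \<phi>_def)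
  qed
  ultimately show ?thesis unfolding M_def by blast
qed

end
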